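(* For all integers $d\ge 1$ and $d'\ge 1$ there exists a probability distribution $\nu_{d,d'}$ on $\{0,1,2,\dots\}^{d'}$, with finite joint moments of all orders and depending only on $d$ and $d'$, such that the following holds. Let $k>1$ and let $w\in F_k$ be a word with canonical form $w=x_{k_r}^{\varepsilon_r}\cdots x_{k_1}^{\varepsilon_1}$, where $k_1\neq k_r$. Write $w=\Omega^d$ with $d\ge 1$ and $\Omega\in F_k$ not a power. For every $n\ge 1$ let $\sigma_{1,n},\dots,\sigma_{k,n}$ be independent random permutations in $\mathfrak S_n$, each with conjugation invariant distribution, such that for every $j\in\{1,\dots,k\}$ the sequence $(\sigma_{j,n})_{n\ge 1}$ has few short cycles with respect to $(\widehat{\mathcal N}_j(w),\mathcal N_j(w))$ in the strong sense. Then for every integer $d'\ge 1$, the random vector $$\bigl(\#_1 w(\sigma_{1,n},\dots,\sigma_{k,n}),\dots,\#_{d'}w(\sigma_{1,n},\dots,\sigma_{k,n})\bigr)$$ converges in distribution, as $n\to\infty$, to $\nu_{d,d'}$, and all its joint moments converge to the corresponding joint moments of $\nu_{d,d'}$.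
   Context: $\mathfrak S_n$ is the symmetric group on $\{1,\dots,n\}$; $\#_\ell\sigma$ is the number of cycles of length $\ell$ of the permutation $\sigma$ (fixed points are cycles of length $1$). A random permutation $\sigma_n$ of $\mathfrak S_n$ has conjugation invariant distribution if $\sigma^{-1}\circ\sigma_n\circ\sigma$ has the same distribution as $\sigma_n$ for every fixed $\sigma\in\mathfrak S_n$. $F_k=\langle x_1,\dots,x_k\rangle$ is the free group on $k$ generators ($k>1$). The canonical form of $w\in F_k$ is the unique writing $w=x_{k_r}^{\varepsilon_r}\cdots x_{k_1}^{\varepsilon_1}$ with $\varepsilon_j=\pm1$ and such that $k_{j+1}=k_j$ implies $\varepsilon_{j+1}=\varepsilon_j$. For permutations, $w(\sigma_1,\dots,\sigma_k):=\sigma_{k_r}^{\varepsilon_r}\cdots\sigma_{k_1}^{\varepsilon_1}$. A word $w$ is a power if there exist a word $\Omega\ne1$ and $d\ge2$ with $w=\Omega^d$. Every $w\neq 1$ can be written $w=\Omega^d$ with $\Omega$ not a power and $d\ge1$. The reduced form of $w$ is $w=x_{\alpha_1}^{\beta_1}\cdots x_{\alpha_\ell}^{\beta_\ell}$ with $\ell\ge1$, $\beta_i\in\mathbb Z\setminus\{0\}$, $\alpha_i\in\{1,\dots,k\}$, $\alpha_{i+1}\ne\alpha_i$. For $1\le j\le k$ set $\mathcal N'_j(w):=\{|\beta_i|:\alpha_i=j\}$; $\widehat{\mathcal N}_j(w):=\{|e| : e \text{ divides some } \beta\in\mathcal N'_j(w)\}$; $\mathcal N_j(w):=\{1,2,\dots,\max\widehat{\mathcal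 N}_j(w)\}\cup\{a+b: a,b\in\mathcal N'_j(w)\}$. If $x_j$ does not occur in $w$, all three sets are empty. For finite sets $S_1,S_2$ of positive integers, a sequence $(\sigma_n)_{n\ge1}$ of random permutations, $\sigma_n\in\mathfrak S_n$, has few short cycles with respect to $(S_1,S_2)$ in the strong sense if (i) for every $p\ge1$ and all $c_1,\dots,c_p\in S_1$, $\lim_{n\to\infty}\mathbb E\bigl(\prod_{i=1}^p\frac{\#_{c_i}\sigma_n}{\sqrt n}\bigr)=0$; and (ii) for every $i\in S_2$, $\lim_{n\to\infty}\mathbb E\bigl(\frac{\#_i\sigma_n}{n}\bigr)=0$. *)

theory Defs
  imports "HOL-Probability.Probability" "HOL-Algebra.Group" "HOL-Combinatorics.Orbits"
begin

section \<open>The free group, with canonical forms as elements\<close>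

text \<open>
  The letter \<open>x\<^sub>j\<^sup>\<epsilon>\<close> is the pair \<open>(j, \<epsilon>)\<close>, \<open>\<epsilon> \<in> {1, -1}\<close>. Letters are listed in the order in
  which they are written: the word \<open>x\<^bsub>k\<^sub>r\<^esub>\<^bsup>\<epsilon>\<^sub>r\<^esup> \<dots> x\<^bsub>k\<^sub>1\<^esub>\<^bsup>\<epsilon>\<^sub>1\<^esup>\<close> is \<open>[(k\<^sub>r, \<epsilon>\<^sub>r), \<dots>, (k\<^sub>1, \<epsilon>\<^sub>1)]\<close>.
\<close>

type_synonym fword = "(nat \<times> int) list"

definition canonical_words :: "nat \<Rightarrow> fword set" where
  "canonical_words k =
     {w. set w \<subseteq> {1..k} \<times> {1, -1} \<and> successively (\<lambda>(i, e) (j, f). i = j \<longrightarrow> e = f) w}"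

definition lmult :: "nat \<times> int \<Rightarrow> fword \<Rightarrow> fword" where
  "lmult a w = (if w \<noteq> [] \<and> hd w = (fst a, - snd a) then tl w else a # w)"

definition free_group :: "nat \<Rightarrow> fword monoid" where
  "free_group k = \<lparr>carrier = canonical_words k, monoid.mult = (\<lambda>u v. foldr lmult u v), one = []\<rparr>"

definition is_power :: "nat \<Rightarrow> fword \<Rightarrow> bool" where
  "is_power k w \<longleftrightarrow>
     (\<exists>\<Omega>\<in>carrier (free_group k). \<exists>d::nat.
        \<Omega> \<noteq> \<one>\<^bsub>free_group k\<^esub> \<and> 2 \<le> d \<and> w = \<Omega> [^]\<^bsub>free_group k\<^esub> d)"

text \<open>
  On canonical words, \<open>reduced_form\<close> collects maximal runs of one generator: the pair \<open>(\<alpha>, \<beta>)\<close>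
  stands for \<open>x\<^sub>\<alpha>\<^sup>\<beta>\<close>.
\<close>

fun reduced_form :: "fword \<Rightarrow> (nat \<times> int) list" where
  "reduced_form [] = []"
| "reduced_form ((j, e) # w) =
     (case reduced_form w of
        [] \<Rightarrow> [(j, e)]
      | (i, b) # s \<Rightarrow> if i = j then (j, b + e) # s else (j, e) # (i, b) # s)"

definition N' :: "nat \<Rightarrow> fword \<Rightarrow> nat set" where
  "N' j w = {nat \<bar>\<beta>\<bar> | \<beta>. (j, \<beta>) \<in> set (reduced_form w)}"

definition N_hat :: "nat \<Rightarrow> fword \<Rightarrow> nat set" where
  "N_hat j w = {e. \<exists>\<beta>\<in>N' j w. e dvd \<beta>}"

text \<open>The case distinction is needed because \<open>Max {}\<close> is unspecified.\<close>

definition N_set :: "nat \<Rightarrow> fword \<Rightarrow> nat set" where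
  "N_set j w =
     (if N' j w = {} then {}
      else {1..Max (N_hat j w)} \<union> {a + b | a b. a \<in> N' j w \<and> b \<in> N' j w})"

section \<open>Permutations\<close>

text \<open>
  A permutation of \<open>{1..n}\<close> is a function \<open>\<sigma>\<close> with \<open>\<sigma> permutes {1..n}\<close>; it is the identity
  outside \<open>{1..n}\<close>, so only cycles through points of \<open>{1..n}\<close> are counted.
\<close>

definition num_cycles :: "nat \<Rightarrow> nat \<Rightarrow> (nat \<Rightarrow> nat) \<Rightarrow> nat" where
  "num_cycles n l \<sigma> = card {C \<in> orbit \<sigma> ` {1..n}. card C = l}"

definition word_value :: "(nat \<Rightarrow> nat \<Rightarrow> nat) \<Rightarrow> fword \<Rightarrow> nat \<Rightarrow> nat" where
  "word_value \<tau> w = foldr (\<lambda>(j, e) \<pi>. (if e = 1 then \<tau> j else inv_into UNIV (\<tau> j)) \<circ> \<pi>) w id"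

definition cycle_counts :: "nat \<Rightarrow> nat \<Rightarrow> (nat \<Rightarrow> nat) \<Rightarrow> nat \<Rightarrow> nat" where
  "cycle_counts n d' \<sigma> = (\<lambda>i\<in>{1..d'}. num_cycles n i \<sigma>)"

section \<open>Random permutations\<close>

text \<open>
  A random permutation enters only through its distribution, a pmf on permutations; no type of
  sample points occurs.
\<close>

definition random_permutation :: "nat \<Rightarrow> (nat \<Rightarrow> nat) pmf \<Rightarrow> bool" where
  "random_permutation n P \<longleftrightarrow> (\<forall>\<sigma>\<in>set_pmf P. \<sigma> permutes {1..n})"

definition conjugation_invariant :: "nat \<Rightarrow> (nat \<Rightarrow> nat) pmf \<Rightarrow> bool" where
  "conjugation_invariant n P \<longleftrightarrow>
     (\<forall>s. s permutes {1..n} \<longrightarrow> map_pmf (\<lambda>\<sigma>. inv_into UNIV s \<circ> \<sigma> \<circ> s) P = P)"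

text \<open>
  The joint distribution of a tuple \<open>\<sigma>\<^sub>1, \<dots>, \<sigma>\<^sub>k\<close> is a distribution on functions \<open>\<tau>\<close> with
  \<open>\<tau> j = \<sigma>\<^sub>j\<close> for \<open>j \<in> {1..k}\<close>; other coordinates are irrelevant.
\<close>

definition marginal :: "nat \<Rightarrow> (nat \<Rightarrow> nat \<Rightarrow> nat) pmf \<Rightarrow> (nat \<Rightarrow> nat) pmf" where
  "marginal j Q = map_pmf (\<lambda>\<tau>. \<tau> j) Q"

definition independent_coords :: "nat \<Rightarrow> (nat \<Rightarrow> nat \<Rightarrow> nat) pmf \<Rightarrow> bool" where
  "independent_coords k Q \<longleftrightarrow>
     prob_space.indep_vars (measure_pmf Q) (\<lambda>_. count_space UNIV) (\<lambda>j \<tau>. \<tau> j) {1..k}"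

definition few_short_cycles_strong ::
    "nat set \<Rightarrow> nat set \<Rightarrow> (nat \<Rightarrow> (nat \<Rightarrow> nat) pmf) \<Rightarrow> bool" where
  "few_short_cycles_strong S1 S2 P \<longleftrightarrow>
     (\<forall>p\<ge>1. \<forall>c::nat \<Rightarrow> nat. (\<forall>i\<in>{1..p}. c i \<in> S1) \<longrightarrow>
        (\<lambda>n. measure_pmf.expectation (P n)
           (\<lambda>\<sigma>. \<Prod>i=1..p. real (num_cycles n (c i) \<sigma>) / sqrt (real n))) \<longlonglongrightarrow> 0) \<and>
     (\<forall>i\<in>S2.
        (\<lambda>n. measure_pmf.expectation (P n)
           (\<lambda>\<sigma>. real (num_cycles n i \<sigma>) / real n)) \<longlonglongrightarrow> 0)"

section \<open>Distributions on vectors of natural numbers\<close>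

text \<open>
  A vector indexed by \<open>{1..m}\<close> is an element of \<open>{1..m} \<rightarrow>\<^sub>E UNIV\<close>. This space is discrete, so the
  bounded continuous test functions for convergence in distribution are all bounded functions.
\<close>

definition vector_distribution :: "nat \<Rightarrow> (nat \<Rightarrow> nat) pmf \<Rightarrow> bool" where
  "vector_distribution m \<nu> \<longleftrightarrow> set_pmf \<nu> \<subseteq> {1..m} \<rightarrow>\<^sub>E UNIV"

definition monomial :: "nat \<Rightarrow> (nat \<Rightarrow> nat) \<Rightarrow> (nat \<Rightarrow> nat) \<Rightarrow> real" where
  "monomial m a v = (\<Prod>i=1..m. real (v i) ^ a i)"

definition finite_joint_moments :: "nat \<Rightarrow> (nat \<Rightarrow> nat) pmf \<Rightarrow> bool" where
  "finite_joint_moments m \<nu> \<longleftrightarrow> (\<forall>a. integrable (measure_pmf \<nu>) (monomial m a))"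

definition converges_in_distribution :: "(nat \<Rightarrow> 'a pmf) \<Rightarrow> 'a pmf \<Rightarrow> bool" where
  "converges_in_distribution P \<nu> \<longleftrightarrow>
     (\<forall>f :: 'a \<Rightarrow> real. bounded (range f) \<longrightarrow>
        (\<lambda>n. measure_pmf.expectation (P n) f) \<longlonglongrightarrow> measure_pmf.expectation \<nu> f)"

definition joint_moments_converge :: "nat \<Rightarrow> (nat \<Rightarrow> (nat \<Rightarrow> nat) pmf) \<Rightarrow> (nat \<Rightarrow> nat) pmf \<Rightarrow> bool" where
  "joint_moments_converge m P \<nu> \<longleftrightarrow>
     (\<forall>a. (\<lambda>n. measure_pmf.expectation (P n) (monomial m a))
            \<longlonglongrightarrow> measure_pmf.expectation \<nu> (monomial m a))"

section \<open>Adequacy of the encodings\<close>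

lemma lmult_canonical:
  assumes "a \<in> {1..k} \<times> {1, -1}" "w \<in> canonical_words k"
  shows "lmult a w \<in> canonical_words k"
  using assms
  by (cases w; cases "tl w")
     (auto simp: lmult_def canonical_words_def split: if_splits)

lemma foldr_lmult_canonical:
  assumes "set u \<subseteq> {1..k} \<times> {1, -1}" "w \<in> canonical_words k"
  shows "foldr lmult u w \<in> canonical_words k"
  using assms by (induction u) (auto intro!: lmult_canonical)

lemma lmult_inverse:
  assumes "w \<in> canonical_words k" "snd a = - snd b" "fst a = fst b" "snd b \<in> {1, -1}"
  shows "lmult a (lmult b w) = w"
  using assms
  by (cases a; cases b; cases w; cases "tl w")
     (auto simp: lmult_def canonical_words_def split: if_splits)

lemma canonical_ConsD:
  "a # w \<in> canonical_words k \<Longrightarrow> a \<in> {1..k} \<times> {1, -1} \<and> w \<in> canonical_words k"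
  by (cases w) (auto simp: canonical_words_def)

lemma foldr_lmult_foldr_lmult:
  assumes "u \<in> canonical_words k" "v \<in> canonical_words k" "w \<in> canonical_words k"
  shows "foldr lmult (foldr lmult u v) w = foldr lmult u (foldr lmult v w)"
  using assms(1)
proof (induction u)
  case (Cons a u)
  let ?x = "foldr lmult u v"
  from canonical_ConsD[OF Cons.prems] have a: "a \<in> {1..k} \<times> {1, -1}" and u: "u \<in> canonical_words k"
    by auto
  have x: "?x \<in> canonical_words k"
    using u assms(2) by (intro foldr_lmult_canonical) (auto simp: canonical_words_def)
  have "foldr lmult (lmult a ?x) w = lmult a (foldr lmult ?x w)"
  proof (cases "?x \<noteq> [] \<and> hd ?x = (fst a, - snd a)")
    case True
    then obtain y where y: "?x = (fst a, - snd a) # y" by (cases ?x) auto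
    have "y \<in> canonical_words k" using canonical_ConsD x y by metis
    then have "foldr lmult y w \<in> canonical_words k"
      using assms(3) by (intro foldr_lmult_canonical) (auto simp: canonical_words_def)
    then have "lmult a (lmult (fst a, - snd a) (foldr lmult y w)) = foldr lmult y w"
      using a by (intro lmult_inverse) auto
    then show ?thesis using y by (simp add: lmult_def[of a "(fst a, - snd a) # y"])
  next
    case False
    then have "lmult a ?x = a # ?x" unfolding lmult_def by (simp only: if_False)
    then show ?thesis by simp
  qed
  then show ?case using Cons.IH u by simp
qed simp

lemma foldr_lmult_Nil: "w \<in> canonical_words k \<Longrightarrow> foldr lmult w [] = w"
proof (induction w)
  case (Cons a w)
  have "foldr lmult w [] = w"
    using Cons.IH canonical_ConsD[OF Cons.prems] by blast
  moreover have "lmult a w = a # w"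
    using Cons.prems by (cases w) (auto simp: lmult_def canonical_words_def)
  ultimately show ?case by simp
qed simp

lemma group_free_group: "group (free_group k)"
proof (rule groupI)
  fix x assume "x \<in> carrier (free_group k)"
  then have x: "x \<in> canonical_words k" by (simp add: free_group_def)
  have ex: "\<exists>y. set y \<subseteq> {1..k} \<times> {1, -1} \<and> (\<forall>w\<in>canonical_words k. foldr lmult y (foldr lmult x w) = w)"
    using x
  proof (induction x)
    case (Cons a x)
    from canonical_ConsD[OF Cons.prems] have a: "a \<in> {1..k} \<times> {1, -1}" and x: "x \<in> canonical_words k"
      by auto
    from Cons.IH[OF x] obtain y where y: "set y \<subseteq> {1..k} \<times> {1, -1}"
      "\<And>w. w \<in> canonical_words k \<Longrightarrow> foldr lmult y (foldr lmult x w) = w" by blast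
    have "lmult (fst a, - snd a) (lmult a (foldr lmult x w)) = foldr lmult x w"
      if "w \<in> canonical_words k" for w
      using a x that by (intro lmult_inverse[of _ k] foldr_lmult_canonical)
        (auto simp: canonical_words_def)
    then show ?case using y a
      by (intro exI[of _ "y @ [(fst a, - snd a)]"]) auto
  qed (auto intro: exI[of _ "[]"])
  then obtain y where y: "set y \<subseteq> {1..k} \<times> {1, -1}"
    "\<And>w. w \<in> canonical_words k \<Longrightarrow> foldr lmult y (foldr lmult x w) = w" by blast
  have nil: "[] \<in> canonical_words k" by (simp add: canonical_words_def)
  let ?z = "foldr lmult y []"
  have z: "?z \<in> canonical_words k" using y(1) nil by (rule foldr_lmult_canonical)
  have act: "foldr lmult (foldr lmult ys []) w = foldr lmult ys w"
    if "set ys \<subseteq> {1..k} \<times> {1, -1}" "w \<in> canonical_words k" for ys w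
    using that
  proof (induction ys)
    case (Cons b ys)
    have 1: "foldr lmult ys [] \<in> canonical_words k"
      using Cons.prems nil by (intro foldr_lmult_canonical) auto
    have 2: "[b] \<in> canonical_words k" using Cons.prems by (auto simp: canonical_words_def)
    show ?case using foldr_lmult_foldr_lmult[OF 2 1 Cons.prems(2)] Cons by simp
  qed simp
  have "foldr lmult ?z x = []"
    using act[OF y(1) x] y(2)[OF nil] foldr_lmult_Nil[OF x] by simp
  then show "\<exists>y\<in>carrier (free_group k). y \<otimes>\<^bsub>free_group k\<^esub> x = \<one>\<^bsub>free_group k\<^esub>"
    using z by (auto simp: free_group_def)
next
  fix x y assume "x \<in> carrier (free_group k)" "y \<in> carrier (free_group k)"
  then show "x \<otimes>\<^bsub>free_group k\<^esub> y \<in> carrier (free_group k)"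
    using foldr_lmult_canonical[of x k y] by (simp add: free_group_def canonical_words_def)
next
  show "\<one>\<^bsub>free_group k\<^esub> \<in> carrier (free_group k)"
    by (simp add: free_group_def canonical_words_def)
qed (simp_all add: free_group_def foldr_lmult_foldr_lmult)

lemma reduced_form_alternates:
  "successively (\<lambda>(i, b) (j, c). i \<noteq> j) (reduced_form w)"
proof (induction w)
  case (Cons a w)
  obtain j e where a: "a = (j, e)" by force
  show ?case
  proof (cases "reduced_form w")
    case Nil
    then show ?thesis by (simp add: a)
  next
    case (Cons p s)
    then show ?thesis using \<open>successively _ (reduced_form w)\<close> by (cases p; cases s) (simp_all add: a split: prod.splits)
  qed
qed simp

lemma reduced_form_expand:
  assumes "w \<in> canonical_words k"
  shows "concat (map (\<lambda>(j, b). replicate (nat \<bar>b\<bar>) (j, sgn b)) (reduced_form w)) = w \<and>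
         (\<forall>(j, b)\<in>set (reduced_form w). b \<noteq> 0)"
  using assms
proof (induction w)
  case (Cons a w)
  obtain j e where a: "a = (j, e)" by force
  have e: "e = 1 \<or> e = -1" and w: "w \<in> canonical_words k"
    using canonical_ConsD[OF Cons.prems] a by auto
  note IH = Cons.IH[OF w]
  show ?case
  proof (cases "reduced_form w")
    case Nil
    then show ?thesis using IH a e by auto
  next
    case (Cons p s)
    obtain i b where p: "p = (i, b)" by force
    have b: "b \<noteq> 0" using IH Cons p by auto
    then obtain m where m: "nat \<bar>b\<bar> = Suc m" by (metis not0_implies_Suc nat_0_iff abs_le_zero_iff)
    then have hd: "hd w = (i, sgn b)" "w \<noteq> []" using IH Cons p by auto
    show ?thesis
    proof (cases "i = j")
      case True
      then have "sgn b = e" using Cons.prems hd a by (cases w) (auto simp: canonical_words_def)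
      then have "nat \<bar>b + e\<bar> = Suc (nat \<bar>b\<bar>)" "sgn (b + e) = e" "b + e \<noteq> 0"
        using e b by (auto simp: sgn_if split: if_splits)
      then show ?thesis using IH Cons p a True \<open>sgn b = e\<close> by auto
    next
      case False
      then show ?thesis using IH Cons p a e by auto
    qed
  qed
qed simp

end

theory Submission
  imports Defs "HOL-Combinatorics.Cycles"
begin

text \<open>
  If \<open>w = \<Omega>\<^sup>d\<close>, the cycle counts of \<open>w\<close> are linear functions of those of \<open>\<Omega>\<close>, so it suffices that
  for a word \<open>\<Omega>\<close> that is not a power the numbers of \<open>m\<close>-cycles become independent Poisson variables of
  parameters \<open>1 / m\<close>. Their joint factorial moments count tuples of points on distinct cycles of
  prescribed lengths, i.e. systems of closed trajectories labelled by \<open>\<Omega>\<close>. Grouping the labellings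
  by their kernel, each class contributes the expected number of embeddings of a quotient graph \<open>\<Gamma>\<close>
  with \<open>V\<close> vertices and \<open>E\<close> coloured edges. By conjugation invariance and independence this is of order
  \<open>n\<^sup>V\<^sup>-\<^sup>E\<close> times, for each monochromatic cycle of length \<open>c\<close> in \<open>\<Gamma>\<close>, a factor \<open>#\<^sub>c\<close>. Cyclic reducedness gives
  all vertices degree at least 2, so that \<open>2 (E - V)\<close> is at least the total number of vertices at which
  monochromatic cycles meet other colours. A monochromatic cycle with one such vertex has a
  length dividing an exponent of \<open>\<Omega>\<close>, one with two such vertices has a length in \<open>N_set\<close>, and
  the hypotheses on short cycles are exactly what makes these contributions vanish. The only remaining quotients have no
  vertex of degree above 2, and as \<open>\<Omega>\<close> is neither a power nor conjugate to its inverse there is only the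
  trivial one, which contributes 1.
\<close>

section \<open>Cycles of a permutation\<close>

text \<open>The hypotheses on short cycles dictate how the powers of \<open>n\<close> are shared
  out. The Euler count pays half a power of \<open>n\<close> for each attachment, a vertex where a
  monochromatic cycle meets another colour, while the cycle wins back at most its number of possible
  images, which never exceeds \<open>n\<close>. With three attachments the loss cannot be recovered.
  With two, a count is divided by \<open>n\<close>; the ratio is bounded by 1, so one first moment
  tending to 0 kills the whole product. With one, the count is divided only by
  \<open>sqrt n\<close>, the ratio is unbounded and several such cycles may share a colour, hence
  the mixed moments of every order in (i). The Poisson law comes from the limit 1 for every list of
  lengths: tuples mark a point on each cycle, so \<open>a\<close> cycles of length \<open>m\<close>
  are counted \<open>m ^ a * fact a\<close> times, and binomial moments tend to
  \<open>(1 / m) ^ a / fact a\<close>. As \<open>w\<close> begins and ends with different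
  generators, it is literally \<open>d\<close> copies of \<open>\<Omega>\<close> and no run crosses
  from one copy to the next, so the hypotheses on the exponents of \<open>w\<close> cover those of
  \<open>\<Omega>\<close>.\<close>

lemma funpow_eq_self_iff_card_orbit_dvd:
  assumes "permutation f"
  shows "(f ^^ i) x = x \<longleftrightarrow> card (orbit f x) dvd i"
proof -
  have self: "x \<in> orbit f x" using assms by (rule permutation_self_in_orbit)
  define D where "D = funpow_dist1 f x x"
  have D: "(f ^^ D) x = x" "D > 0" unfolding D_def using funpow_dist1_prop[OF self] by auto
  have "orbit f x = (\<lambda>n. (f ^^ n) x) ` {0..<D}" unfolding D_def by (rule orbit_conv_funpow_dist1[OF self])
  moreover have "inj_on (\<lambda>n. (f ^^ n) x) {0..<D}" unfolding D_def by (rule inj_on_funpow_dist1[OF self])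
  ultimately have c: "card (orbit f x) = D" by (simp add: card_image)
  have "(f ^^ i) x = (f ^^ (i mod D)) x" using funpow_mod_eq[OF D(1)] by metis
  moreover have "(f ^^ (i mod D)) x = x \<longleftrightarrow> i mod D = 0"
  proof (cases "i mod D = 0")
    case False
    have "(f ^^ l) x \<noteq> x" if "0 < l" "l < D" for l
      using that unfolding D_def by (rule funpow_dist1_least)
    then show ?thesis using False D(2) by simp
  qed simp
  ultimately show ?thesis unfolding c by auto
qed

lemma card_orbit_eqI:
  assumes "permutation f" "\<And>i. (f ^^ i) x = x \<longleftrightarrow> c dvd i"
  shows "card (orbit f x) = c"
proof (rule dvd_antisym)
  note iff = funpow_eq_self_iff_card_orbit_dvd[OF assms(1), of _ x]
  show "card (orbit f x) dvd c" using iff[of c] assms(2)[of c] by simp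
  show "c dvd card (orbit f x)" using iff[of "card (orbit f x)"] assms(2)[of "card (orbit f x)"] by simp
qed

lemma card_orbit_le:
  assumes "permutation f" "(f ^^ i) x = x" "0 < i"
  shows "card (orbit f x) \<le> i"
  using assms funpow_eq_self_iff_card_orbit_dvd[OF assms(1)] by (auto intro: dvd_imp_le)

lemma card_orbit_pos: "permutation f \<Longrightarrow> 0 < card (orbit f x)"
  using finite_orbit[OF permutation_self_in_orbit] orbit_nonempty[of f x] by (simp add: card_gt_0_iff)

lemma orbit_eq_iff:
  assumes "permutation f"
  shows "orbit f x = orbit f y \<longleftrightarrow> x \<in> orbit f y"
proof
  assume "x \<in> orbit f y"
  then show "orbit f x = orbit f y"
    by (rule orbit_cyclic_eq3[OF cyclic_on_orbit'[OF assms]])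
qed (use permutation_self_in_orbit[OF assms, of x] in simp)

lemma permutes_permutation: "\<sigma> permutes {1..n::nat} \<Longrightarrow> permutation \<sigma>"
  by (auto simp: permutation_permutes)

text \<open>Distinct orbits are disjoint, so each cycle of length \<open>l\<close> accounts for
  exactly \<open>l\<close> points. This converts counts of cycles into counts of points, which are
  easier to handle in sums and products.\<close>

lemma Union_orbits_of_card:
  fixes n :: nat
  assumes \<sigma>: "\<sigma> permutes {1..n}" and "\<C> \<subseteq> orbit \<sigma> ` {1..n}" "\<And>C. C \<in> \<C> \<Longrightarrow> card C = l"
  shows "card {x \<in> {1..n}. orbit \<sigma> x \<in> \<C>} = l * card \<C>"
proof -
  note p = permutes_permutation[OF \<sigma>]
  have sub: "orbit \<sigma> x \<subseteq> {1..n}" if "x \<in> {1..n}" for x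
    using permutes_orbit_subset[OF \<sigma> that] .
  have "\<Union>\<C> = {x \<in> {1..n}. orbit \<sigma> x \<in> \<C>}"
  proof (intro equalityI subsetI)
    fix v assume "v \<in> \<Union>\<C>"
    then obtain C where C: "C \<in> \<C>" "v \<in> C" by blast
    then obtain x where x: "x \<in> {1..n}" "C = orbit \<sigma> x" using assms(2) by blast
    then show "v \<in> {x \<in> {1..n}. orbit \<sigma> x \<in> \<C>}"
      using C sub[OF x(1)] orbit_eq_iff[OF p, of v x] by auto
  qed (use permutation_self_in_orbit[OF p] in blast)
  moreover have "l * card \<C> = card (\<Union>\<C>)"
  proof (rule card_partition)
    show "finite \<C>" using assms(2) by (rule finite_subset) simp
    have "\<Union>\<C> \<subseteq> \<Union> (orbit \<sigma> ` {1..n})" using assms(2) by (rule Union_mono)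
    also have "\<dots> \<subseteq> {1..n}" using sub by (intro Union_least) (auto simp only: image_iff)
    finally show "finite (\<Union>\<C>)" by (rule finite_subset) simp
    show "C \<inter> C' = {}" if C: "C \<in> \<C>" "C' \<in> \<C>" "C \<noteq> C'" for C C'
    proof -
      obtain x y where xy: "C = orbit \<sigma> x" "C' = orbit \<sigma> y" using C assms(2) by blast
      have "orbit \<sigma> x = orbit \<sigma> y" if "v \<in> orbit \<sigma> x" "v \<in> orbit \<sigma> y" for v
        using that orbit_eq_iff[OF p] by metis
      then show ?thesis using xy C(3) by blast
    qed
  qed (use assms in auto)
  ultimately show ?thesis by simp
qed

lemma card_points_of_cycles:
  assumes "\<sigma> permutes {1..n}"
  shows "card {x \<in> {1..n}. card (orbit \<sigma> x) = l} = l * num_cycles n l \<sigma>"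
proof -
  have *: "{x \<in> {1..n}. card (orbit \<sigma> x) = l} =
        {x \<in> {1..n}. orbit \<sigma> x \<in> {C \<in> orbit \<sigma> ` {1..n}. card C = l}}" by auto
  show ?thesis
    unfolding num_cycles_def by (subst *, rule Union_orbits_of_card[OF assms]) auto
qed

lemma num_cycles_le: "num_cycles n l \<sigma> \<le> n"
proof -
  have "num_cycles n l \<sigma> \<le> card (orbit \<sigma> ` {1..n})"
    unfolding num_cycles_def by (intro card_mono) auto
  also have "\<dots> \<le> n" using card_image_le[of "{1..n}" "orbit \<sigma>"] by simp
  finally show ?thesis .
qed

section \<open>Tuples of marked points on distinct cycles\<close>

text \<open>A factorial moment in disguise: the cycles are ordered and distinct, and each carries a
  marked point. The marked point is what a trajectory of the word starts from.\<close>

definition cycle_tuples :: "nat \<Rightarrow> (nat \<Rightarrow> nat) \<Rightarrow> nat list \<Rightarrow> (nat \<Rightarrow> nat) set" where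
  "cycle_tuples n \<sigma> ms = {x \<in> {..<length ms} \<rightarrow>\<^sub>E {1..n}.
     (\<forall>i<length ms. card (orbit \<sigma> (x i)) = ms ! i) \<and> inj_on (\<lambda>i. orbit \<sigma> (x i)) {..<length ms}}"

lemma finite_cycle_tuples: "finite (cycle_tuples n \<sigma> ms)"
  unfolding cycle_tuples_def by (rule finite_subset[of _ "{..<length ms} \<rightarrow>\<^sub>E {1..n}"]) (auto intro: finite_PiE)

text \<open>Among the cycles already used only those of the same length \<open>l\<close> are
  excluded, and there are \<open>count_list ms l\<close> of them. They form a subset of all
  \<open>l\<close>-cycles, so the truncated subtraction is exact.\<close>

lemma card_next_cycle_point:
  assumes \<sigma>: "\<sigma> permutes {1..n}" and x: "x \<in> cycle_tuples n \<sigma> ms"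
  shows "card {v \<in> {1..n}. card (orbit \<sigma> v) = l \<and> orbit \<sigma> v \<notin> (\<lambda>i. orbit \<sigma> (x i)) ` {..<length ms}} =
         l * (num_cycles n l \<sigma> - count_list ms l)"
proof -
  let ?A = "{C \<in> orbit \<sigma> ` {1..n}. card C = l}"
  let ?B = "(\<lambda>i. orbit \<sigma> (x i)) ` {i. i < length ms \<and> ms ! i = l}"
  have x': "\<And>i. i < length ms \<Longrightarrow> x i \<in> {1..n}" "\<And>i. i < length ms \<Longrightarrow> card (orbit \<sigma> (x i)) = ms ! i"
    "inj_on (\<lambda>i. orbit \<sigma> (x i)) {..<length ms}"
    using x unfolding cycle_tuples_def by auto
  have B: "?B \<subseteq> ?A" using x' by auto
  have "card ?B = card {i. i < length ms \<and> ms ! i = l}"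
    by (rule card_image) (use x'(3) in \<open>auto simp: inj_on_def\<close>)
  also have "\<dots> = count_list ms l"
    by (simp add: count_list_eq_length_filter length_filter_conv_card eq_commute)
  finally have cB: "card (?A - ?B) = num_cycles n l \<sigma> - count_list ms l"
    using B by (subst card_Diff_subset) (auto simp: num_cycles_def)
  have "orbit \<sigma> v \<in> ?B \<longleftrightarrow> orbit \<sigma> v \<in> (\<lambda>i. orbit \<sigma> (x i)) ` {..<length ms}"
    if "card (orbit \<sigma> v) = l" for v
  proof
    assume "orbit \<sigma> v \<in> (\<lambda>i. orbit \<sigma> (x i)) ` {..<length ms}"
    then obtain i where "i < length ms" "orbit \<sigma> v = orbit \<sigma> (x i)" by blast
    then show "orbit \<sigma> v \<in> ?B" using that x'(2)[of i] by (intro image_eqI[of _ _ i]) auto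
  qed auto
  then have *: "{v \<in> {1..n}. card (orbit \<sigma> v) = l \<and> orbit \<sigma> v \<notin> (\<lambda>i. orbit \<sigma> (x i)) ` {..<length ms}} =
        {v \<in> {1..n}. orbit \<sigma> v \<in> ?A - ?B}"
    by auto
  show ?thesis
    unfolding * cB[symmetric] by (rule Union_orbits_of_card[OF \<sigma>]) auto
qed

lemma card_cycle_tuples_snoc:
  assumes \<sigma>: "\<sigma> permutes {1..n}"
  shows "card (cycle_tuples n \<sigma> (ms @ [l])) =
         card (cycle_tuples n \<sigma> ms) * (l * (num_cycles n l \<sigma> - count_list ms l))"
proof -
  let ?p = "length ms"
  let ?N = "\<lambda>x. {v \<in> {1..n}. card (orbit \<sigma> v) = l \<and> orbit \<sigma> v \<notin> (\<lambda>i. orbit \<sigma> (x i)) ` {..<?p}}"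
  have "bij_betw (\<lambda>(x, v). x(?p := v)) (Sigma (cycle_tuples n \<sigma> ms) ?N) (cycle_tuples n \<sigma> (ms @ [l]))"
  proof (rule bij_betwI[where g = "\<lambda>y. (restrict y {..<?p}, y ?p)"])
    show "(\<lambda>(x, v). x(?p := v)) \<in> Sigma (cycle_tuples n \<sigma> ms) ?N \<rightarrow> cycle_tuples n \<sigma> (ms @ [l])"
    proof
      fix z assume "z \<in> Sigma (cycle_tuples n \<sigma> ms) ?N"
      then obtain x v where z: "z = (x, v)" and x: "x \<in> cycle_tuples n \<sigma> ms"
        and v: "v \<in> {1..n}" "card (orbit \<sigma> v) = l" "orbit \<sigma> v \<notin> (\<lambda>i. orbit \<sigma> (x i)) ` {..<?p}"
        by (cases z) simp
      have *: "{..<Suc ?p} = insert ?p {..<?p}" by auto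
      have "inj_on (\<lambda>i. orbit \<sigma> ((x(?p := v)) i)) (insert ?p {..<?p})"
        using x v(3) unfolding cycle_tuples_def by (auto simp: inj_on_def)
      moreover have "x(?p := v) \<in> {..<Suc ?p} \<rightarrow>\<^sub>E {1..n}"
        using x v(1) unfolding cycle_tuples_def * by (intro PiE_fun_upd) auto
      moreover have "card (orbit \<sigma> ((x(?p := v)) i)) = (ms @ [l]) ! i" if "i < Suc ?p" for i
        using that x v(2) unfolding cycle_tuples_def by (auto simp: nth_append less_Suc_eq)
      ultimately show "(\<lambda>(x, v). x(?p := v)) z \<in> cycle_tuples n \<sigma> (ms @ [l])"
        unfolding z cycle_tuples_def * by (simp add: * del: fun_upd_apply)
    qed
    show "(\<lambda>y. (restrict y {..<?p}, y ?p)) \<in> cycle_tuples n \<sigma> (ms @ [l]) \<rightarrow> Sigma (cycle_tuples n \<sigma> ms) ?N"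
    proof
      fix y assume "y \<in> cycle_tuples n \<sigma> (ms @ [l])"
      then have y: "\<And>i. i < Suc ?p \<Longrightarrow> y i \<in> {1..n}"
         "\<And>i. i < Suc ?p \<Longrightarrow> card (orbit \<sigma> (y i)) = (ms @ [l]) ! i"
         "inj_on (\<lambda>i. orbit \<sigma> (y i)) {..<Suc ?p}"
        unfolding cycle_tuples_def by (auto simp: PiE_iff)
      have "restrict y {..<?p} \<in> cycle_tuples n \<sigma> ms"
      proof -
        have "restrict y {..<?p} \<in> {..<?p} \<rightarrow>\<^sub>E {1..n}" using y(1) by simp
        moreover have "card (orbit \<sigma> (restrict y {..<?p} i)) = ms ! i" if "i < ?p" for i
          using y(2)[of i] that by (simp add: nth_append)
        moreover have "inj_on (\<lambda>i. orbit \<sigma> (restrict y {..<?p} i)) {..<?p}"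
          using inj_onD[OF y(3)] by (intro inj_onI) simp
        ultimately show ?thesis unfolding cycle_tuples_def by blast
      qed
      moreover have "orbit \<sigma> (y ?p) \<noteq> orbit \<sigma> (restrict y {..<?p} i)" if "i < ?p" for i
        using inj_onD[OF y(3), of ?p i] that by auto
      then have "y ?p \<in> ?N (restrict y {..<?p})"
        using y(1)[of ?p] y(2)[of ?p] by auto
      ultimately show "(restrict y {..<?p}, y ?p) \<in> Sigma (cycle_tuples n \<sigma> ms) ?N" by blast
    qed
    show "(\<lambda>y. (restrict y {..<?p}, y ?p)) ((\<lambda>(x, v). x(?p := v)) z) = z"
      if z': "z \<in> Sigma (cycle_tuples n \<sigma> ms) ?N" for z
    proof -
      obtain x v where z: "z = (x, v)" "x \<in> extensional {..<?p}"
        using z' unfolding cycle_tuples_def by (cases z) (auto simp: PiE_iff)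
      then show ?thesis by (auto simp: extensional_def restrict_def fun_eq_iff)
    qed
    show "(\<lambda>(x, v). x(?p := v)) (restrict y {..<?p}, y ?p) = y" if "y \<in> cycle_tuples n \<sigma> (ms @ [l])" for y
    proof -
      have "y \<in> extensional {..<Suc ?p}" using that unfolding cycle_tuples_def by (auto simp: PiE_iff)
      then show ?thesis by (auto simp: extensional_def restrict_def fun_eq_iff)
    qed
  qed
  then have "card (cycle_tuples n \<sigma> (ms @ [l])) = card (Sigma (cycle_tuples n \<sigma> ms) ?N)"
    by (simp add: bij_betw_same_card)
  also have "\<dots> = (\<Sum>x\<in>cycle_tuples n \<sigma> ms. card (?N x))"
    by (intro card_SigmaI finite_cycle_tuples) auto
  also have "\<dots> = (\<Sum>x\<in>cycle_tuples n \<sigma> ms. l * (num_cycles n l \<sigma> - count_list ms l))"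
    by (intro sum.cong refl card_next_cycle_point[OF \<sigma>])
  finally show ?thesis by simp
qed

text \<open>Appending a length multiplies the count by one more factor of a falling factorial, times
  the choice of the marked point. The result is written with binomials because these are the moments
  used for the Poisson limit.\<close>

lemma card_cycle_tuples:
  assumes \<sigma>: "\<sigma> permutes {1..n}" and "set ms \<subseteq> {1..M}"
  shows "card (cycle_tuples n \<sigma> ms) =
    (\<Prod>l\<in>{1..M}. l ^ count_list ms l * fact (count_list ms l) * (num_cycles n l \<sigma> choose count_list ms l))"
  using assms(2)
proof (induction ms rule: rev_induct)
  case Nil
  have "cycle_tuples n \<sigma> [] = {\<lambda>_. undefined}" unfolding cycle_tuples_def by auto
  then show ?case by simp
next
  case (snoc m ms)
  let ?f = "\<lambda>ms l. l ^ count_list ms l * fact (count_list ms l) * (num_cycles n l \<sigma> choose count_list ms l)"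
  have m: "m \<in> {1..M}" using snoc by auto
  have step: "?f (ms @ [m]) m = ?f ms m * (m * (num_cycles n m \<sigma> - count_list ms m))"
  proof -
    define c N where "c = count_list ms m" and "N = num_cycles n m \<sigma>"
    have "Suc c * (N choose Suc c) = (N - c) * (N choose c)"
      by (simp only: binomial_absorption binomial_absorb_comp)
    moreover have "m ^ Suc c * fact (Suc c) * (N choose Suc c) = m * m ^ c * fact c * (Suc c * (N choose Suc c))"
      by (simp only: fact_Suc power_Suc of_nat_id mult.assoc mult.left_commute)
    ultimately have "m ^ Suc c * fact (Suc c) * (N choose Suc c) = m ^ c * fact c * (N choose c) * (m * (N - c))"
      by (simp only: mult.assoc mult.left_commute mult.commute)
    then show ?thesis by (simp add: c_def N_def)
  qed
  have "(\<Prod>l\<in>{1..M}. ?f (ms @ [m]) l) = ?f (ms @ [m]) m * (\<Prod>l\<in>{1..M} - {m}. ?f (ms @ [m]) l)"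
    using m by (subst prod.remove[of _ m]) auto
  also have "(\<Prod>l\<in>{1..M} - {m}. ?f (ms @ [m]) l) = (\<Prod>l\<in>{1..M} - {m}. ?f ms l)"
    by (intro prod.cong) auto
  also have "?f (ms @ [m]) m * \<dots> = (m * (num_cycles n m \<sigma> - count_list ms m)) * (\<Prod>l\<in>{1..M}. ?f ms l)"
    unfolding step using m by (subst (2) prod.remove[of _ m]) (auto simp: algebra_simps)
  finally show ?case using snoc card_cycle_tuples_snoc[OF \<sigma>, of ms m]
    by (simp only: mult.commute set_append Un_subset_iff)
qed

text \<open>With \<open>m\<close> the length of the cycle of \<open>x\<close> under
  \<open>f\<close>, the power \<open>(f ^^ d) ^^ i\<close> fixes \<open>x\<close> iff
  \<open>m\<close> divides \<open>d * i\<close>, that is, iff \<open>m div gcd m d\<close> divides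
  \<open>i\<close>.\<close>

lemma card_orbit_funpow:
  assumes "permutation f"
  shows "card (orbit (f ^^ d) x) = card (orbit f x) div gcd (card (orbit f x)) d"
proof (rule card_orbit_eqI)
  let ?m = "card (orbit f x)"
  show "permutation (f ^^ d)" using assms by (metis permutation_funpow)
  have m: "?m > 0" using assms by (rule card_orbit_pos)
  fix i
  have "((f ^^ d) ^^ i) x = x \<longleftrightarrow> ?m dvd d * i"
    using funpow_eq_self_iff_card_orbit_dvd[OF assms, of "d * i" x] by (simp add: funpow_mult mult.commute)
  also have "\<dots> \<longleftrightarrow> ?m div gcd ?m d dvd i"
  proof -
    obtain a b where ab: "?m = a * gcd ?m d" "d = b * gcd ?m d" "coprime a b"
      using gcd_coprime_exists[of ?m d] m by auto
    have g: "gcd ?m d > 0" using m by auto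
    have "?m dvd d * i \<longleftrightarrow> a * gcd ?m d dvd (b * i) * gcd ?m d" using ab by (metis mult.assoc mult.commute)
    also have "\<dots> \<longleftrightarrow> a dvd b * i" using g by simp
    also have "\<dots> \<longleftrightarrow> a dvd i" using ab(3) by (simp add: coprime_dvd_mult_right_iff)
    finally show ?thesis using ab(1) g by (metis nonzero_mult_div_cancel_right neq0_conv)
  qed
  finally show "((f ^^ d) ^^ i) x = x \<longleftrightarrow> ?m div gcd ?m d dvd i" .
qed

text \<open>The condition \<open>m = l * gcd m d\<close> selects the cycles that break into
  \<open>l\<close>-cycles. Since \<open>gcd m d \<le> d\<close>, such \<open>m\<close> are at most
  \<open>d * d'\<close>, so finitely many cycle counts suffice. Points are counted on both sides and
  the factor \<open>l\<close> is cancelled.\<close>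

lemma num_cycles_funpow:
  assumes \<sigma>: "\<sigma> permutes {1..n}" and "d \<ge> 1" and l: "l \<in> {1..d'}"
  shows "num_cycles n l (\<sigma> ^^ d) =
    (\<Sum>m\<in>{m\<in>{1..d * d'}. m = l * gcd m d}. gcd m d * num_cycles n m \<sigma>)"
proof -
  note p = permutes_permutation[OF \<sigma>]
  let ?M = "{m\<in>{1..d * d'}. m = l * gcd m d}"
  have *: "card (orbit (\<sigma> ^^ d) x) = l \<longleftrightarrow> card (orbit \<sigma> x) \<in> ?M" for x
  proof -
    let ?m = "card (orbit \<sigma> x)"
    have m: "?m > 0" using p by (rule card_orbit_pos)
    have "card (orbit (\<sigma> ^^ d) x) = l \<longleftrightarrow> ?m = l * gcd ?m d"
      unfolding card_orbit_funpow[OF p] using m by (intro dvd_div_eq_mult) auto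
    moreover have "?m \<in> {1..d * d'}" if "?m = l * gcd ?m d"
    proof -
      have "l * gcd ?m d \<le> d' * d" using l assms(2) by (intro mult_mono) (auto intro: gcd_le2_nat)
      then show ?thesis using that m by (simp add: mult.commute)
    qed
    ultimately show ?thesis by blast
  qed
  have \<sigma>d: "(\<sigma> ^^ d) permutes {1..n}" using \<sigma> by (rule permutes_funpow)
  have "l * num_cycles n l (\<sigma> ^^ d) = card {x \<in> {1..n}. card (orbit \<sigma> x) \<in> ?M}"
    unfolding card_points_of_cycles[OF \<sigma>d, symmetric] * ..
  also have "{x \<in> {1..n}. card (orbit \<sigma> x) \<in> ?M} = (\<Union>m\<in>?M. {x \<in> {1..n}. card (orbit \<sigma> x) = m})" by auto
  also have "card \<dots> = (\<Sum>m\<in>?M. card {x \<in> {1..n}. card (orbit \<sigma> x) = m})"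
    by (rule card_UN_disjoint) auto
  also have "\<dots> = (\<Sum>m\<in>?M. l * (gcd m d * num_cycles n m \<sigma>))"
  proof (rule sum.cong[OF refl])
    fix m assume "m \<in> ?M"
    then have "m = l * gcd m d" by blast
    then show "card {x \<in> {1..n}. card (orbit \<sigma> x) = m} = l * (gcd m d * num_cycles n m \<sigma>)"
      unfolding card_points_of_cycles[OF \<sigma>] by (metis mult.assoc)
  qed
  also have "\<dots> = l * (\<Sum>m\<in>?M. gcd m d * num_cycles n m \<sigma>)" by (simp add: sum_distrib_left)
  finally show ?thesis using l by simp
qed

section \<open>Joint convergence to independent Poisson variables\<close>

text \<open>The value 0 outside \<open>{1..M}\<close> is the one used by
  \<open>cycle_vector\<close>, so both laws live on the same functions and can be compared point by
  point.\<close>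

definition poisson_vec :: "nat \<Rightarrow> (nat \<Rightarrow> nat) pmf" where
  "poisson_vec M = Pi_pmf {1..M} 0 (\<lambda>m. poisson_pmf (1 / real m))"

section \<open>Truncated inclusion-exclusion\<close>

lemma choose_mult_choose:
  "(x choose (v + b)) * ((v + b) choose v) = (x choose v) * ((x - v) choose b)"
proof (cases "v + b \<le> x")
  case True
  then show ?thesis using choose_mult[of v "v + b" x] by simp
next
  case False
  then show ?thesis by (cases "v \<le> x") (auto simp: binomial_eq_0)
qed

lemma alternating_binomial_sum:
  "(\<Sum>b\<le>B. (-1) ^ b * real (Suc y choose b)) = (-1) ^ B * real (y choose B)"
  by (induction B) (auto simp: algebra_simps)

text \<open>For \<open>y > 0\<close> the truncated sum collapses to
  \<open>(-1) ^ B * (y - 1 choose B)\<close>, and Pascal's rule bounds this by the first omitted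
  binomial.\<close>

lemma bonferroni_zero:
  "\<bar>of_bool (y = 0) - (\<Sum>b\<le>B. (-1) ^ b * real (y choose b))\<bar> \<le> real (y choose (B + 1))"
proof (cases y)
  case 0
  have "(\<Sum>b\<le>B. (-1) ^ b * real (0 choose b)) = (\<Sum>b\<le>B. of_bool (b = 0))"
    by (intro sum.cong) (auto simp: binomial_eq_0)
  then show ?thesis using 0 by simp
next
  case (Suc y')
  then show ?thesis by (simp only: alternating_binomial_sum) (simp add: abs_mult)
qed

text \<open>The case of 0 is applied to \<open>x - v\<close> and multiplied by
  \<open>x choose v\<close>. For \<open>x < v\<close> the truncated difference is 0, but then the
  factor \<open>x choose v\<close> vanishes as it should.\<close>

lemma bonferroni:
  "\<bar>of_bool (x = v) - (\<Sum>b\<le>B. (-1) ^ b * real ((v + b) choose v) * real (x choose (v + b)))\<bar>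
    \<le> real ((v + (B + 1)) choose v) * real (x choose (v + (B + 1)))"
proof -
  have m: "real ((v + b) choose v) * real (x choose (v + b)) = real (x choose v) * real ((x - v) choose b)" for b
    using choose_mult_choose[of x v b] by (metis mult.commute of_nat_mult)
  have i: "of_bool (x = v) = real (x choose v) * of_bool (x - v = 0)"
    by (cases "x < v") (auto simp: binomial_eq_0)
  have "of_bool (x = v) - (\<Sum>b\<le>B. (-1) ^ b * real ((v + b) choose v) * real (x choose (v + b)))
     = real (x choose v) * (of_bool (x - v = 0) - (\<Sum>b\<le>B. (-1) ^ b * real ((x - v) choose b)))"
    unfolding i right_diff_distrib sum_distrib_left
    by (intro arg_cong2[where f = "(-)"] refl sum.cong) (simp add: m mult.assoc mult.left_commute)
  then have "\<bar>of_bool (x = v) - (\<Sum>b\<le>B. (-1) ^ b * real ((v + b) choose v) * real (x choose (v + b)))\<bar>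
     = real (x choose v) * \<bar>of_bool (x - v = 0) - (\<Sum>b\<le>B. (-1) ^ b * real ((x - v) choose b))\<bar>"
    by (simp only: abs_mult abs_of_nat)
  also have "\<dots> \<le> real (x choose v) * real ((x - v) choose (B + 1))"
    by (intro mult_left_mono bonferroni_zero) auto
  finally show ?thesis unfolding m .
qed

lemma choose_over_fact:
  "real ((v + c) choose v) * (L ^ (v + c) / fact (v + c)) = L ^ v / fact v * (L ^ c / fact c)"
proof -
  have "real ((v + c) choose v) = fact (v + c) / (fact v * fact c)"
    using binomial_fact[of v "v + c", where 'a = real] by simp
  then show ?thesis by (simp add: power_add field_simps)
qed

text \<open>The terms below \<open>a\<close> vanish; after a shift by \<open>a\<close> the rest is a
  multiple of the exponential series. Working with the nonnegative integral yields integrability and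
  value together.\<close>

lemma poisson_binomial_moment:
  assumes "0 < (L :: real)"
  shows "integrable (poisson_pmf L) (\<lambda>x. real (x choose a))"
    "measure_pmf.expectation (poisson_pmf L) (\<lambda>x. real (x choose a)) = L ^ a / fact a"
proof -
  let ?g = "\<lambda>k. L ^ k / fact k * exp (- L) * real (k choose a)"
  have "(\<lambda>j. L ^ a / fact a * exp (- L) * (L ^ j /\<^sub>R fact j)) sums (L ^ a / fact a * exp (- L) * exp L)"
    by (intro sums_mult exp_converges)
  moreover have "L ^ a / fact a * exp (- L) * (L ^ j /\<^sub>R fact j) = ?g (j + a)" for j
  proof -
    have "?g (j + a) = exp (- L) * (real ((a + j) choose a) * (L ^ (a + j) / fact (a + j)))"
      by (simp add: add.commute)
    then show ?thesis unfolding choose_over_fact by (simp add: divide_inverse)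
  qed
  ultimately have "(\<lambda>j. ?g (j + a)) sums (L ^ a / fact a)" by (simp add: exp_minus_inverse mult.assoc flip: exp_add)
  then have s: "?g sums (L ^ a / fact a)" by (subst (asm) sums_zero_iff_shift) auto
  have "(\<integral>\<^sup>+ x. ennreal (real (x choose a)) \<partial>poisson_pmf L) =
        (\<integral>\<^sup>+ x. ennreal (?g x) \<partial>count_space UNIV)"
    unfolding nn_integral_measure_pmf using assms
    by (intro nn_integral_cong, subst ennreal_mult[symmetric]) auto
  also have "\<dots> = (\<Sum>k. ennreal (?g k))" by (rule nn_integral_count_space_nat)
  also have "\<dots> = ennreal (\<Sum>k. ?g k)" using s assms by (intro suminf_ennreal2) (auto simp: sums_iff)
  also have "\<dots> = ennreal (L ^ a / fact a)" using s by (simp add: sums_iff)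
  finally have "has_bochner_integral (poisson_pmf L) (\<lambda>x. real (x choose a)) (L ^ a / fact a)"
    using assms by (intro has_bochner_integral_nn_integral) auto
  then show "integrable (poisson_pmf L) (\<lambda>x. real (x choose a))"
    "measure_pmf.expectation (poisson_pmf L) (\<lambda>x. real (x choose a)) = L ^ a / fact a"
    by (auto simp: has_bochner_integral_iff)
qed

section \<open>Convergence of point probabilities and of laws\<close>

text \<open>An iterated limit: for fixed \<open>k\<close> both the approximant and its error bound
  converge in \<open>n\<close>, and afterwards \<open>k\<close> is chosen so large that the limiting
  error is small.\<close>

lemma tendsto_interchange:
  fixes q :: "nat \<Rightarrow> real"
  assumes bound: "\<And>k n. \<bar>q n - s k n\<bar> \<le> e k n"
    and s: "\<And>k. s k \<longlonglongrightarrow> S k" and e: "\<And>k. e k \<longlonglongrightarrow> E k"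
    and S: "S \<longlonglongrightarrow> l" and E: "E \<longlonglongrightarrow> 0"
  shows "q \<longlonglongrightarrow> l"
proof (rule LIMSEQ_I)
  fix r :: real assume r: "0 < r"
  have "eventually (\<lambda>k. \<bar>S k - l\<bar> < r / 4 \<and> \<bar>E k\<bar> < r / 4) sequentially"
    using tendstoD[OF S, of "r / 4"] tendstoD[OF E, of "r / 4"] r
    by (intro eventually_conj) (simp_all add: dist_real_def)
  then obtain k where k: "\<bar>S k - l\<bar> < r / 4" "\<bar>E k\<bar> < r / 4" by (auto simp: eventually_sequentially)
  have "eventually (\<lambda>n. \<bar>s k n - S k\<bar> < r / 4 \<and> \<bar>e k n - E k\<bar> < r / 4) sequentially"
    using tendstoD[OF s, of "r / 4" k] tendstoD[OF e, of "r / 4" k] r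
    by (intro eventually_conj) (simp_all add: dist_real_def)
  then obtain N where N: "\<And>n. n \<ge> N \<Longrightarrow> \<bar>s k n - S k\<bar> < r / 4 \<and> \<bar>e k n - E k\<bar> < r / 4"
    by (auto simp: eventually_sequentially)
  have "norm (q n - l) < r" if "n \<ge> N" for n
    using N[OF that] k bound[of n k] by (simp only: real_norm_def) linarith
  then show "\<exists>N. \<forall>n\<ge>N. norm (q n - l) < r" by blast
qed

text \<open>The indicators of \<open>x m = v m\<close> are introduced one coordinate at a time, each as a truncated
  alternating sum of binomials with the error controlled by Bonferroni's inequality.\<close>

lemma pmf_limit_of_binomial_moments:
  fixes P :: "nat \<Rightarrow> (nat \<Rightarrow> nat) pmf"
  assumes fin: "\<And>n. finite (set_pmf (P n))"
    and supp: "\<And>n x m. x \<in> set_pmf (P n) \<Longrightarrow> m \<notin> {1..M} \<Longrightarrow> x m = 0"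
    and lim: "\<And>a. (\<lambda>n. measure_pmf.expectation (P n) (\<lambda>x. \<Prod>m\<in>{1..M}. real (x m choose a m)))
                 \<longlonglongrightarrow> (\<Prod>m\<in>{1..M}. (1 / real m) ^ a m / fact (a m))"
  shows "(\<lambda>n. pmf (P n) v) \<longlonglongrightarrow> pmf (poisson_vec M) v"
proof -
  \<comment> \<open>Coordinates in \<open>A\<close> already carry an indicator, the others still a
    binomial moment of order \<open>a m\<close>. The induction leaves \<open>a\<close> arbitrary,
    because expanding one more indicator produces moments of that coordinate of all orders.\<close>
  define g where "g A a m y = (if m \<in> A then of_bool (y = v m) else real (y choose a m))"
    for A :: "nat set" and a :: "nat \<Rightarrow> nat" and m y
  define L where "L A a m = (if m \<in> A then pmf (poisson_pmf (1 / real m)) (v m) else (1 / real m) ^ a m / fact (a m))"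
    for A :: "nat set" and a :: "nat \<Rightarrow> nat" and m
  have g0: "g A a m y \<ge> 0" for A a m y unfolding g_def by auto
  have int: "integrable (P n) f" for n and f :: "_ \<Rightarrow> real"
    using fin by (rule integrable_measure_pmf_finite)
  have "(\<lambda>n. measure_pmf.expectation (P n) (\<lambda>x. \<Prod>m\<in>{1..M}. g A a m (x m))) \<longlonglongrightarrow> (\<Prod>m\<in>{1..M}. L A a m)"
    if "finite A" "A \<subseteq> {1..M}" for A a
    using that
  proof (induction A arbitrary: a)
    case empty
    then show ?case using lim[of a] by (simp add: g_def L_def)
  next
    case (insert l A)
    define R where "R x = (\<Prod>m\<in>{1..M} - {l}. g A a m (x m))" for x
    define r where "r = (\<Prod>m\<in>{1..M} - {l}. L A a m)"
    have l: "l \<in> {1..M}" "l \<notin> A" using insert by auto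
    have R0: "R x \<ge> 0" for x unfolding R_def by (intro prod_nonneg) (simp add: g0)
    have mom: "(\<lambda>n. measure_pmf.expectation (P n) (\<lambda>x. real (x l choose c) * R x))
         \<longlonglongrightarrow> (1 / real l) ^ c / fact c * r" for c
    proof -
      have 1: "(\<Prod>m\<in>{1..M}. g A (a(l := c)) m (x m)) = real (x l choose c) * R x" for x
      proof -
        have "(\<Prod>m\<in>{1..M} - {l}. g A (a(l := c)) m (x m)) = R x"
          unfolding R_def by (rule prod.cong) (auto simp: g_def)
        then show ?thesis using l by (subst prod.remove[of _ l]) (simp_all add: g_def)
      qed
      have 2: "(\<Prod>m\<in>{1..M}. L A (a(l := c)) m) = (1 / real l) ^ c / fact c * r"
      proof -
        have "(\<Prod>m\<in>{1..M} - {l}. L A (a(l := c)) m) = r"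
          unfolding r_def by (rule prod.cong) (auto simp: L_def)
        then show ?thesis using l by (subst prod.remove[of _ l]) (simp_all add: L_def)
      qed
      have "A \<subseteq> {1..M}" using insert.prems by simp
      from insert.IH[OF this, of "a(l := c)"] show ?thesis unfolding 1 2 .
    qed
    let ?u = "1 / real l"
    let ?q = "\<lambda>n. measure_pmf.expectation (P n) (\<lambda>x. of_bool (x l = v l) * R x)"
    let ?s = "\<lambda>B n. \<Sum>b\<le>B. (-1) ^ b * real ((v l + b) choose v l) *
                measure_pmf.expectation (P n) (\<lambda>x. real (x l choose (v l + b)) * R x)"
    let ?e = "\<lambda>B n. real ((v l + (B + 1)) choose v l) *
                measure_pmf.expectation (P n) (\<lambda>x. real (x l choose (v l + (B + 1))) * R x)"
    \<comment> \<open>Here \<open>B\<close> is the truncation level of the new indicator. After the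
      limit in \<open>n\<close> the truncated sums are partial sums of the exponential series at
      \<open>- ?u\<close>, and the error bound is one of its terms up to sign and a constant
      factor.\<close>
    have "?q \<longlonglongrightarrow> (?u ^ v l / fact (v l)) * exp (- ?u) * r"
    proof (rule tendsto_interchange)
      fix B n
      let ?T = "\<lambda>x. (of_bool (x l = v l) - (\<Sum>b\<le>B. (-1) ^ b * real ((v l + b) choose v l) * real (x l choose (v l + b)))) * R x"
      have eq: "?q n - ?s B n = measure_pmf.expectation (P n) ?T"
        by (simp add: int left_diff_distrib sum_distrib_right mult.assoc)
      have "\<bar>?q n - ?s B n\<bar> \<le> measure_pmf.expectation (P n) (\<lambda>x. \<bar>?T x\<bar>)"
        unfolding eq by (rule integral_abs_bound)
      also have "\<dots> \<le> measure_pmf.expectation (P n) (\<lambda>x. (real ((v l + (B + 1)) choose v l) * real (x l choose (v l + (B + 1)))) * R x)"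
      proof (rule integral_mono[OF int int])
        fix x
        have "\<bar>?T x\<bar> = \<bar>of_bool (x l = v l) - (\<Sum>b\<le>B. (-1) ^ b * real ((v l + b) choose v l) * real (x l choose (v l + b)))\<bar> * R x"
          by (simp only: abs_mult abs_of_nonneg[OF R0])
        also have "\<dots> \<le> (real ((v l + (B + 1)) choose v l) * real (x l choose (v l + (B + 1)))) * R x"
          by (rule mult_right_mono[OF bonferroni R0])
        finally show "\<bar>?T x\<bar> \<le> (real ((v l + (B + 1)) choose v l) * real (x l choose (v l + (B + 1)))) * R x" .
      qed
      also have "\<dots> = ?e B n" by (simp only: mult.assoc integral_mult_right_zero)
      finally show "\<bar>?q n - ?s B n\<bar> \<le> ?e B n" .
    next
      fix B
      show "?s B \<longlonglongrightarrow> (\<Sum>b\<le>B. (-1) ^ b * real ((v l + b) choose v l) * (?u ^ (v l + b) / fact (v l + b) * r))"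
        by (intro tendsto_sum tendsto_mult_left mom)
      show "?e B \<longlonglongrightarrow> real ((v l + (B + 1)) choose v l) * (?u ^ (v l + (B + 1)) / fact (v l + (B + 1)) * r)"
        by (intro tendsto_mult_left mom)
    next
      have t: "(-1) ^ b * real ((v l + b) choose v l) * (?u ^ (v l + b) / fact (v l + b) * r)
           = (?u ^ v l / fact (v l) * r) * ((- ?u) ^ b /\<^sub>R fact b)" for b
      proof -
        have "(-1) ^ b * real ((v l + b) choose v l) * (?u ^ (v l + b) / fact (v l + b) * r)
          = (-1) ^ b * (real ((v l + b) choose v l) * (?u ^ (v l + b) / fact (v l + b))) * r" by (simp only: mult.assoc)
        also have "\<dots> = (?u ^ v l / fact (v l) * r) * ((-1) ^ b * ?u ^ b / fact b)"
          unfolding choose_over_fact by (simp only: divide_inverse mult_ac)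
        also have "(-1) ^ b * ?u ^ b / fact b = (- ?u) ^ b /\<^sub>R fact b"
          unfolding power_minus[of ?u b] by (simp only: divide_inverse real_scaleR_def mult_ac)
        finally show ?thesis .
      qed
      have "(\<lambda>B. \<Sum>b\<le>B. (?u ^ v l / fact (v l) * r) * ((- ?u) ^ b /\<^sub>R fact b)) \<longlonglongrightarrow> (?u ^ v l / fact (v l) * r) * exp (- ?u)"
        using sums_mult[OF exp_converges] unfolding sums_def_le .
      then show "(\<lambda>B. \<Sum>b\<le>B. (-1) ^ b * real ((v l + b) choose v l) * (?u ^ (v l + b) / fact (v l + b) * r))
          \<longlonglongrightarrow> (?u ^ v l / fact (v l)) * exp (- ?u) * r"
        unfolding t by (simp add: mult_ac)
    next
      have "(\<lambda>n. ?u ^ n /\<^sub>R fact n) \<longlonglongrightarrow> 0"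
        by (rule summable_LIMSEQ_zero[OF summable_exp_generic])
      then have "(\<lambda>B. ?u ^ v l / fact (v l) * r * (?u ^ (B + 1) /\<^sub>R fact (B + 1))) \<longlonglongrightarrow> 0"
        by (intro tendsto_mult_right_zero) (rule LIMSEQ_ignore_initial_segment)
      moreover have "real ((v l + (B + 1)) choose v l) * (?u ^ (v l + (B + 1)) / fact (v l + (B + 1)) * r)
         = ?u ^ v l / fact (v l) * r * (?u ^ (B + 1) /\<^sub>R fact (B + 1))" for B
      proof -
        have "real ((v l + (B + 1)) choose v l) * (?u ^ (v l + (B + 1)) / fact (v l + (B + 1)) * r)
          = (real ((v l + (B + 1)) choose v l) * (?u ^ (v l + (B + 1)) / fact (v l + (B + 1)))) * r" by (simp only: mult.assoc)
        also have "\<dots> = ?u ^ v l / fact (v l) * r * (?u ^ (B + 1) /\<^sub>R fact (B + 1))"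
          unfolding choose_over_fact by (simp add: divide_inverse mult_ac)
        finally show ?thesis .
      qed
      ultimately show "(\<lambda>B. real ((v l + (B + 1)) choose v l) * (?u ^ (v l + (B + 1)) / fact (v l + (B + 1)) * r)) \<longlonglongrightarrow> 0"
        by simp
    qed
    moreover have "(\<Prod>m\<in>{1..M}. g (insert l A) a m (x m)) = of_bool (x l = v l) * R x" for x
    proof -
      have "(\<Prod>m\<in>{1..M} - {l}. g (insert l A) a m (x m)) = R x"
        unfolding R_def by (rule prod.cong) (auto simp: g_def)
      then show ?thesis using l by (subst prod.remove[of _ l]) (simp_all add: g_def)
    qed
    moreover have "(\<Prod>m\<in>{1..M}. L (insert l A) a m) = (?u ^ v l / fact (v l)) * exp (- ?u) * r"
    proof -
      have "(\<Prod>m\<in>{1..M} - {l}. L (insert l A) a m) = r"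
        unfolding r_def by (rule prod.cong) (auto simp: L_def)
      then show ?thesis using l by (subst prod.remove[of _ l]) (simp_all add: L_def)
    qed
    ultimately show ?case by simp
  qed
  from this[of "{1..M}" "\<lambda>_. 0"]
  have *: "(\<lambda>n. measure_pmf.expectation (P n) (\<lambda>x. \<Prod>m\<in>{1..M}. of_bool (x m = v m)))
      \<longlonglongrightarrow> (\<Prod>m\<in>{1..M}. pmf (poisson_pmf (1 / real m)) (v m))"
    by (simp add: g_def L_def)
  show ?thesis
  proof (cases "\<forall>m. m \<notin> {1..M} \<longrightarrow> v m = 0")
    case True
    have "measure_pmf.expectation (P n) (\<lambda>x. \<Prod>m\<in>{1..M}. of_bool (x m = v m)) = pmf (P n) v" for n
    proof -
      have ind: "(\<Prod>m\<in>{1..M}. of_bool (x m = v m)) = (indicator {v} x :: real)"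
        if x: "x \<in> set_pmf (P n)" for x
      proof (cases "x = v")
        case False
        then obtain m where "x m \<noteq> v m" by auto
        moreover from this have "m \<in> {1..M}" using supp[OF x, of m] True by metis
        ultimately have "(\<Prod>m\<in>{1..M}. of_bool (x m = v m)) = (0 :: real)"
          by (intro prod_zero) auto
        then show ?thesis using False by simp
      qed simp
      have "measure_pmf.expectation (P n) (\<lambda>x. \<Prod>m\<in>{1..M}. of_bool (x m = v m)) =
            measure_pmf.expectation (P n) (indicator {v} :: _ \<Rightarrow> real)"
        by (rule integral_cong_AE, simp, simp, rule AE_pmfI, rule ind)
      then show ?thesis by (simp add: measure_pmf_single)
    qed
    moreover have "pmf (poisson_vec M) v = (\<Prod>m\<in>{1..M}. pmf (poisson_pmf (1 / real m)) (v m))"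
      unfolding poisson_vec_def using True by (intro pmf_Pi') auto
    ultimately show ?thesis using * by simp
  next
    case False
    then obtain m where m: "m \<notin> {1..M}" "v m \<noteq> 0" by auto
    then have "v \<notin> set_pmf (P n)" for n using supp by metis
    then have "pmf (P n) v = 0" for n by (simp add: set_pmf_iff)
    moreover have "pmf (poisson_vec M) v = 0"
      unfolding poisson_vec_def using m by (intro pmf_Pi_outside) auto
    ultimately show ?thesis by simp
  qed
qed

text \<open>No mass escapes: a finite set carrying almost all of \<open>Z\<close> carries almost all
  of \<open>P n\<close> for large \<open>n\<close>, since finitely many point probabilities
  converge. On that set the expectation is a finite sum, and off it \<open>f\<close> contributes at
  most its bound times the missing mass.\<close>

lemma converges_in_distribution_of_pmf:
  fixes P :: "nat \<Rightarrow> 'a pmf"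
  assumes lim: "\<And>v. (\<lambda>n. pmf (P n) v) \<longlonglongrightarrow> pmf Z v"
  shows "converges_in_distribution P Z"
  unfolding converges_in_distribution_def
proof (intro allI impI)
  fix f :: "'a \<Rightarrow> real" assume "bounded (range f)"
  then obtain B where B: "\<And>x. \<bar>f x\<bar> \<le> B" by (auto simp: bounded_iff)
  have int: "integrable (measure_pmf p) (\<lambda>x. f x * indicator S x)" for p S
    by (intro measure_pmf.integrable_const_bound[where B = B])
       (auto simp: AE_measure_pmf_iff abs_mult indicator_def intro: B order_trans[OF abs_ge_zero B])
  define A where "A k = from_nat_into (set_pmf Z) ` {..<k}" for k
  have finA: "finite (A k)" for k unfolding A_def by simp
  have ZA: "(\<lambda>k. measure (measure_pmf Z) (A k)) \<longlonglongrightarrow> 1"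
  proof -
    have "(\<lambda>k. measure (measure_pmf Z) (A k)) \<longlonglongrightarrow> measure (measure_pmf Z) (\<Union>k. A k)"
      by (intro measure_pmf.finite_Lim_measure_incseq) (auto simp: A_def incseq_def)
    moreover have "(\<Union>k. A k) = set_pmf Z"
    proof -
      have "(\<Union>k. A k) = range (from_nat_into (set_pmf Z))" unfolding A_def by auto
      then show ?thesis using range_from_nat_into[OF set_pmf_not_empty countable_set_pmf] by metis
    qed
    moreover have "measure (measure_pmf Z) (set_pmf Z) = 1"
      using measure_pmf.prob_eq_1[of "set_pmf Z" Z] AE_measure_pmf[of Z] by simp
    ultimately show ?thesis by simp
  qed
  have split: "\<bar>measure_pmf.expectation p f - measure_pmf.expectation p (\<lambda>x. f x * indicator (A k) x)\<bar>
      \<le> B * (1 - measure (measure_pmf p) (A k))" for p k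
  proof -
    have eq: "measure_pmf.expectation p f - measure_pmf.expectation p (\<lambda>x. f x * indicator (A k) x)
        = measure_pmf.expectation p (\<lambda>x. f x * indicator (- A k) x)"
    proof -
      have "measure_pmf.expectation p f = measure_pmf.expectation p (\<lambda>x. f x * indicator (A k) x + f x * indicator (- A k) x)"
        by (intro Bochner_Integration.integral_cong) (auto simp: indicator_def)
      also have "\<dots> = measure_pmf.expectation p (\<lambda>x. f x * indicator (A k) x) + measure_pmf.expectation p (\<lambda>x. f x * indicator (- A k) x)"
        by (intro Bochner_Integration.integral_add int)
      finally show ?thesis by simp
    qed
    have "\<bar>measure_pmf.expectation p f - measure_pmf.expectation p (\<lambda>x. f x * indicator (A k) x)\<bar>
        \<le> measure_pmf.expectation p (\<lambda>x. \<bar>f x * indicator (- A k) x\<bar>)"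
      unfolding eq by (rule integral_abs_bound)
    also have "\<dots> \<le> measure_pmf.expectation p (\<lambda>x. B * indicator (- A k) x)"
    proof (rule integral_mono[OF integrable_abs[OF int]])
      show "integrable (measure_pmf p) (\<lambda>x. B * indicator (- A k) x)"
        by (intro integrable_mult_right integrable_real_indicator) (auto simp: measure_pmf.emeasure_finite less_top[symmetric])
    qed (auto simp: indicator_def B)
    also have "\<dots> = B * (1 - measure (measure_pmf p) (A k))"
      by (simp add: measure_pmf.prob_compl[symmetric] Compl_eq_Diff_UNIV)
    finally show ?thesis .
  qed
  have expA: "measure_pmf.expectation p (\<lambda>x. f x * indicator (A k) x) = (\<Sum>a\<in>A k. f a * pmf p a)" for p k
    by (subst integral_measure_pmf_real[OF finA[of k]]) (auto simp: indicator_def intro!: sum.cong)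
  show "(\<lambda>n. measure_pmf.expectation (P n) f) \<longlonglongrightarrow> measure_pmf.expectation Z f"
  proof (rule tendsto_interchange)
    show "\<bar>measure_pmf.expectation (P n) f - measure_pmf.expectation (P n) (\<lambda>x. f x * indicator (A k) x)\<bar>
      \<le> B * (1 - measure (measure_pmf (P n)) (A k))" for k n by (rule split)
    show "(\<lambda>n. measure_pmf.expectation (P n) (\<lambda>x. f x * indicator (A k) x)) \<longlonglongrightarrow> (\<Sum>a\<in>A k. f a * pmf Z a)" for k
      unfolding expA by (intro tendsto_intros lim)
    show "(\<lambda>n. B * (1 - measure (measure_pmf (P n)) (A k))) \<longlonglongrightarrow> B * (1 - measure (measure_pmf Z) (A k))" for k
      unfolding measure_measure_pmf_finite[OF finA] by (intro tendsto_intros lim)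
    have e0: "(\<lambda>k. B * (1 - measure (measure_pmf Z) (A k))) \<longlonglongrightarrow> B * (1 - 1)"
      by (intro tendsto_intros ZA)
    then show "(\<lambda>k. B * (1 - measure (measure_pmf Z) (A k))) \<longlonglongrightarrow> 0" by simp
    then have "(\<lambda>k. measure_pmf.expectation Z f - measure_pmf.expectation Z (\<lambda>x. f x * indicator (A k) x)) \<longlonglongrightarrow> 0"
      by (rule Lim_null_comparison[rotated]) (simp add: split)
    then have "(\<lambda>k. measure_pmf.expectation Z (\<lambda>x. f x * indicator (A k) x)) \<longlonglongrightarrow> measure_pmf.expectation Z f"
      using tendsto_diff[OF tendsto_const[of "measure_pmf.expectation Z f"]] by fastforce
    then show "(\<lambda>k. \<Sum>a\<in>A k. f a * pmf Z a) \<longlonglongrightarrow> measure_pmf.expectation Z f" unfolding expA .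
  qed
qed

section \<open>Convergence of mixed moments\<close>

lemma poisson_vec_binomial_moment:
  "integrable (poisson_vec M) (\<lambda>x. \<Prod>m\<in>{1..M}. real (x m choose a m))"
  "measure_pmf.expectation (poisson_vec M) (\<lambda>x. \<Prod>m\<in>{1..M}. real (x m choose a m)) =
     (\<Prod>m\<in>{1..M}. (1 / real m) ^ a m / fact (a m))"
proof -
  show "integrable (poisson_vec M) (\<lambda>x. \<Prod>m\<in>{1..M}. real (x m choose a m))"
    unfolding poisson_vec_def by (intro integrable_prod_Pi_pmf poisson_binomial_moment) auto
  have "measure_pmf.expectation (poisson_vec M) (\<lambda>x. \<Prod>m\<in>{1..M}. real (x m choose a m)) =
     (\<Prod>m\<in>{1..M}. measure_pmf.expectation (poisson_pmf (1 / real m)) (\<lambda>y. real (y choose a m)))"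
    unfolding poisson_vec_def by (intro expectation_prod_Pi_pmf poisson_binomial_moment) auto
  also have "\<dots> = (\<Prod>m\<in>{1..M}. (1 / real m) ^ a m / fact (a m))"
    by (intro prod.cong refl poisson_binomial_moment) auto
  finally show "measure_pmf.expectation (poisson_vec M) (\<lambda>x. \<Prod>m\<in>{1..M}. real (x m choose a m)) =
     (\<Prod>m\<in>{1..M}. (1 / real m) ^ a m / fact (a m))" .
qed

lemma mult_choose_nat: "real y * real (y choose a) = real (Suc a) * real (y choose Suc a) + real a * real (y choose a)"
proof (cases "y < a")
  case False
  have "Suc a * (y choose Suc a) = (y - a) * (y choose a)" by (simp only: binomial_absorption binomial_absorb_comp)
  then have "real (Suc a) * real (y choose Suc a) = (real y - real a) * real (y choose a)"
    using False by (metis not_less of_nat_diff of_nat_mult)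
  then show ?thesis by (simp add: algebra_simps)
qed (simp add: binomial_eq_0)

text \<open>Integrability is bundled with convergence so that the property is closed under linear
  combinations.\<close>

definition expectation_limit ::
    "(nat \<Rightarrow> 'a pmf) \<Rightarrow> 'a pmf \<Rightarrow> ('a \<Rightarrow> real) \<Rightarrow> bool" where
  "expectation_limit P Z h \<longleftrightarrow> (\<forall>n. integrable (P n) h) \<and> integrable Z h \<and>
     (\<lambda>n. measure_pmf.expectation (P n) h) \<longlonglongrightarrow> measure_pmf.expectation Z h"

lemma expectation_limit_add:
  "expectation_limit P Z g \<Longrightarrow> expectation_limit P Z h \<Longrightarrow> expectation_limit P Z (\<lambda>x. g x + h x)"
  unfolding expectation_limit_def by (auto intro: tendsto_add)

lemma expectation_limit_cmult:
  "expectation_limit P Z g \<Longrightarrow> expectation_limit P Z (\<lambda>x. c * g x)"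
  unfolding expectation_limit_def by (auto intro: tendsto_mult_left)

text \<open>Products of binomials span the polynomials: multiplying \<open>y choose a\<close> by
  \<open>y\<close> gives a combination of binomials of orders \<open>a\<close> and
  \<open>a + 1\<close>. The limits of binomial moments therefore pass to every product of powers of
  linear forms.\<close>

lemma expectation_limit_polynomial:
  fixes P :: "nat \<Rightarrow> (nat \<Rightarrow> nat) pmf" and T :: "nat \<Rightarrow> (nat \<Rightarrow> nat) \<Rightarrow> nat"
  assumes int: "\<And>n a. integrable (P n) (\<lambda>x. \<Prod>m\<in>{1..M}. real (x m choose a m))"
    and lim: "\<And>a. (\<lambda>n. measure_pmf.expectation (P n) (\<lambda>x. \<Prod>m\<in>{1..M}. real (x m choose a m)))
                 \<longlonglongrightarrow> (\<Prod>m\<in>{1..M}. (1 / real m) ^ a m / fact (a m))"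
    and T: "\<And>i x. i \<in> {1..d'} \<Longrightarrow> T i x = (\<Sum>m\<in>S i. c i m * x m)" and S: "\<And>i. S i \<subseteq> {1..M}"
  shows "expectation_limit P (poisson_vec M) (\<lambda>x. \<Prod>i=1..d'. real (T i x) ^ b i)"
proof -
  define F where "F a x = (\<Prod>m\<in>{1..M}. real (x m choose a m))" for a x :: "nat \<Rightarrow> nat"
  \<comment> \<open>The products with all \<open>F a\<close> are included to make \<open>G\<close> stable under multiplication by a coordinate.\<close>
  define G where "G = {h. \<forall>a. expectation_limit P (poisson_vec M) (\<lambda>x. h x * F a x)}"
  have F: "expectation_limit P (poisson_vec M) (F a)" for a
    unfolding expectation_limit_def F_def
    by (simp only: poisson_vec_binomial_moment lim int simp_thms)
  have G1: "(\<lambda>_. 1) \<in> G" unfolding G_def using F by simp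
  have Gadd: "(\<lambda>x. g x + h x) \<in> G" if "g \<in> G" "h \<in> G" for g h
    using that unfolding G_def by (auto simp: distrib_right intro: expectation_limit_add)
  have Gc: "(\<lambda>x. k * g x) \<in> G" if "g \<in> G" for g k
    using that unfolding G_def by (auto simp: mult.assoc intro: expectation_limit_cmult)
  have Gx: "(\<lambda>x. real (x l) * h x) \<in> G" if h: "h \<in> G" and l: "l \<in> {1..M}" for h l
  proof -
    have "expectation_limit P (poisson_vec M) (\<lambda>x. real (x l) * h x * F a x)" for a
    proof -
      have "real (x l) * F a x = real (Suc (a l)) * F (a(l := Suc (a l))) x + real (a l) * F a x" for x
      proof -
        let ?R = "\<Prod>m\<in>{1..M} - {l}. real (x m choose a m)"
        have 1: "F a x = real (x l choose a l) * ?R" unfolding F_def using l by (subst prod.remove[of _ l]) auto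
        have 2: "F (a(l := Suc (a l))) x = real (x l choose Suc (a l)) * ?R"
          unfolding F_def using l by (subst prod.remove[of _ l]) (auto intro!: prod.cong)
        show ?thesis unfolding 1 2 mult.assoc[symmetric] mult_choose_nat by (simp only: distrib_right)
      qed
      then have eq: "real (x l) * h x * F a x =
          real (Suc (a l)) * (h x * F (a(l := Suc (a l))) x) + real (a l) * (h x * F a x)" for x
        by (metis (no_types, opaque_lifting) distrib_left mult.assoc mult.commute)
      show ?thesis unfolding eq using h unfolding G_def
        by (intro expectation_limit_add expectation_limit_cmult) auto
    qed
    then show ?thesis unfolding G_def by simp
  qed
  have Gsum: "(\<lambda>x. \<Sum>m\<in>U. g m x) \<in> G" if "finite U" "\<And>m. m \<in> U \<Longrightarrow> g m \<in> G" for U :: "nat set" and g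
    using that
  proof (induction U)
    case empty
    then show ?case using Gc[OF G1, of 0] by simp
  qed (auto intro: Gadd)
  have GT: "(\<lambda>x. real (T i x) * h x) \<in> G" if h: "h \<in> G" and i: "i \<in> {1..d'}" for h i
  proof -
    have "(\<lambda>x. \<Sum>m\<in>S i. real (c i m) * (real (x m) * h x)) \<in> G"
      using S[of i] by (intro Gsum Gc Gx h) (auto intro: finite_subset)
    moreover have "real (T i x) * h x = (\<Sum>m\<in>S i. real (c i m) * (real (x m) * h x))" for x
      unfolding T[OF i] by (simp add: sum_distrib_right mult.assoc)
    ultimately show ?thesis by simp
  qed
  have Gpow: "(\<lambda>x. real (T i x) ^ k * h x) \<in> G" if "h \<in> G" "i \<in> {1..d'}" for i k h
    using that by (induction k) (auto simp: mult.assoc intro: GT)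
  have "(\<lambda>x. \<Prod>i\<in>U. real (T i x) ^ b i) \<in> G" if "finite U" "U \<subseteq> {1..d'}" for U
    using that by (induction U) (auto intro: Gpow G1)
  from this[of "{1..d'}"] have "(\<lambda>x. \<Prod>i=1..d'. real (T i x) ^ b i) \<in> G" by simp
  then have "expectation_limit P (poisson_vec M) (\<lambda>x. (\<Prod>i=1..d'. real (T i x) ^ b i) * F (\<lambda>_. 0) x)"
    unfolding G_def by blast
  then show ?thesis by (simp add: F_def)
qed

section \<open>Embeddings of partial injections into a permutation\<close>

text \<open>One colour class of a quotient graph: a finite disjoint union of directed paths,
  possibly single vertices, and directed cycles.\<close>

definition partial_inj :: "'v set \<Rightarrow> 'v rel \<Rightarrow> bool" where
  "partial_inj W E \<longleftrightarrow> finite W \<and> E \<subseteq> W \<times> W \<and> single_valued E \<and> single_valued (E\<inverse>)"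

definition embeddings :: "nat \<Rightarrow> 'v set \<Rightarrow> 'v rel \<Rightarrow> (nat \<Rightarrow> nat) \<Rightarrow> ('v \<Rightarrow> nat) set" where
  "embeddings n W E \<sigma> = {z \<in> W \<rightarrow>\<^sub>E {1..n}. inj_on z W \<and> (\<forall>(u, v)\<in>E. \<sigma> (z u) = z v)}"

definition cycle_verts :: "'v rel \<Rightarrow> 'v set" where
  "cycle_verts E = {u. (u, u) \<in> E\<^sup>+}"

definition cycles_of :: "'v rel \<Rightarrow> 'v set set" where
  "cycles_of E = (\<lambda>u. E\<^sup>+ `` {u}) ` cycle_verts E"

lemma finite_embeddings: "finite W \<Longrightarrow> finite (embeddings n W E \<sigma>)"
  unfolding embeddings_def by (rule finite_subset[of _ "W \<rightarrow>\<^sub>E {1..n}"]) (auto intro: finite_PiE)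

lemma cycle_verts_back:
  assumes "single_valued E" "u \<in> cycle_verts E" "(u, v) \<in> E\<^sup>*"
  shows "(v, u) \<in> E\<^sup>+"
  using assms(3)
proof (induction rule: rtrancl_induct)
  case base
  then show ?case using assms(2) by (simp add: cycle_verts_def)
next
  case (step y z)
  from step.IH obtain z' where z': "(y, z') \<in> E" "(z', u) \<in> E\<^sup>*" by (meson tranclD)
  then have "z' = z" using step.hyps(2) assms(1) by (meson single_valuedD)
  then have "(z, u) \<in> E\<^sup>*" using z'(2) by simp
  then show ?case using assms(2) unfolding cycle_verts_def by (meson CollectD rtrancl_trancl_trancl)
qed

lemma cycle_verts_closed:
  assumes "single_valued E" "u \<in> cycle_verts E" "(u, v) \<in> E\<^sup>+"
  shows "v \<in> cycle_verts E" "E\<^sup>+ `` {v} = E\<^sup>+ `` {u}"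
proof -
  have "(v, u) \<in> E\<^sup>+" by (rule cycle_verts_back[OF assms(1,2)]) (use assms(3) in auto)
  then show "v \<in> cycle_verts E" "E\<^sup>+ `` {v} = E\<^sup>+ `` {u}"
    using assms(3) unfolding cycle_verts_def by (auto intro: trancl_trans)
qed

lemma cycles_of_disjoint:
  assumes "single_valued E" "C \<in> cycles_of E" "C' \<in> cycles_of E" "v \<in> C" "v \<in> C'"
  shows "C = C'"
proof -
  obtain u u' where u: "C = E\<^sup>+ `` {u}" "u \<in> cycle_verts E" "C' = E\<^sup>+ `` {u'}" "u' \<in> cycle_verts E"
    using assms unfolding cycles_of_def by auto
  then show ?thesis using cycle_verts_closed(2)[OF assms(1)] assms(4,5) by (metis Image_singleton_iff)
qed

lemma cycles_ofD:
  assumes "single_valued E" "C \<in> cycles_of E" "v \<in> C"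
  shows "v \<in> cycle_verts E" "C = E\<^sup>+ `` {v}"
proof -
  obtain u where u: "C = E\<^sup>+ `` {u}" "u \<in> cycle_verts E" using assms unfolding cycles_of_def by auto
  then have "(u, v) \<in> E\<^sup>+" using assms(3) by auto
  then show "v \<in> cycle_verts E" "C = E\<^sup>+ `` {v}" using cycle_verts_closed[OF assms(1) u(2)] u(1) by auto
qed

lemma cycles_of_nonempty: "C \<in> cycles_of E \<Longrightarrow> C \<noteq> {}"
  unfolding cycles_of_def cycle_verts_def by auto

lemma partial_inj_trancl: "partial_inj W E \<Longrightarrow> E\<^sup>+ \<subseteq> W \<times> W"
  unfolding partial_inj_def by (metis trancl_subset_Sigma)

lemma cycle_verts_subset:
  assumes "partial_inj W E" shows "cycle_verts E \<subseteq> W"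
proof
  fix u assume "u \<in> cycle_verts E"
  then have "(u, u) \<in> E\<^sup>+" by (simp add: cycle_verts_def)
  then show "u \<in> W" using partial_inj_trancl[OF assms] by blast
qed

lemma cycles_of_subset:
  assumes "partial_inj W E" "C \<in> cycles_of E" shows "C \<subseteq> W"
proof -
  obtain u where "C = E\<^sup>+ `` {u}" using assms(2) unfolding cycles_of_def by blast
  then show ?thesis using partial_inj_trancl[OF assms(1)] by blast
qed

lemma finite_cycles_of:
  assumes "partial_inj W E" shows "finite (cycles_of E)"
proof -
  have "finite (cycle_verts E)"
    by (rule finite_subset[OF cycle_verts_subset[OF assms]]) (use assms in \<open>simp add: partial_inj_def\<close>)
  then show ?thesis unfolding cycles_of_def by simp
qed

text \<open>If no vertex without predecessor leads to \<open>v\<close>, every ancestor of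
  \<open>v\<close> has a predecessor among the ancestors. Choosing one is an injective map of a
  finite set into itself, hence onto, so \<open>v\<close> precedes one of its own ancestors and lies
  on a cycle.\<close>

lemma root_or_cycle:
  assumes "partial_inj W E" "v \<in> W"
  shows "v \<in> cycle_verts E \<or> (\<exists>b\<in>W - Range E. (b, v) \<in> E\<^sup>*)"
proof (rule ccontr)
  assume neg: "\<not> ?thesis"
  define P where "P = {u \<in> W. (u, v) \<in> E\<^sup>*}"
  have E: "finite W" "E \<subseteq> W \<times> W" "single_valued E" using assms unfolding partial_inj_def by auto
  have "\<forall>u\<in>P. \<exists>u'\<in>P. (u', u) \<in> E"
  proof
    fix u assume u: "u \<in> P"
    then have "u \<in> Range E" using neg unfolding P_def by auto
    then obtain u' where "(u', u) \<in> E" by auto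
    then show "\<exists>u'\<in>P. (u', u) \<in> E" using u E(2) unfolding P_def
      by (metis (mono_tags, lifting) converse_rtrancl_into_rtrancl mem_Collect_eq mem_Sigma_iff subsetD)
  qed
  then obtain f where f: "\<And>u. u \<in> P \<Longrightarrow> f u \<in> P \<and> (f u, u) \<in> E" by metis
  have "inj_on f P" using f E(3) by (metis inj_onI single_valuedD)
  moreover have "finite P" using E unfolding P_def by auto
  ultimately have "f ` P = P" using f by (intro endo_inj_surj) auto
  moreover have "v \<in> P" using assms unfolding P_def by auto
  ultimately obtain u where "u \<in> P" "v = f u" by auto
  then have "(v, u) \<in> E" "(u, v) \<in> E\<^sup>*" using f unfolding P_def by auto
  then have "v \<in> cycle_verts E" unfolding cycle_verts_def by auto
  then show False using neg by auto
qed

section \<open>Bounds for the number of embeddings\<close>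

lemma constraints_determine:
  assumes "\<forall>(u, v)\<in>E. \<sigma> (z u) = z v" "\<forall>(u, v)\<in>E. \<sigma> (z' u) = z' v" "z u = z' u" "(u, v) \<in> E\<^sup>*"
  shows "z v = z' v"
  using assms(4)
proof (induction rule: rtrancl_induct)
  case (step y w)
  have "\<sigma> (z y) = z w" "\<sigma> (z' y) = z' w" using assms(1,2) step.hyps(2) by auto
  then show ?case using step.IH by simp
qed (use assms(3) in simp)

text \<open>Following a directed cycle of the graph traces the permutation until it closes up, so
  the image is an entire cycle of the same length. This is the origin of the factors counting short
  cycles.\<close>

lemma embedding_cycle_orbit:
  assumes pi: "partial_inj W E" and z: "z \<in> embeddings n W E \<sigma>" and u: "u \<in> cycle_verts E"
  shows "orbit \<sigma> (z u) = z ` (E\<^sup>+ `` {u})" "card (orbit \<sigma> (z u)) = card (E\<^sup>+ `` {u})"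
proof -
  have sv: "single_valued E" using pi unfolding partial_inj_def by auto
  have zE: "\<And>u v. (u, v) \<in> E \<Longrightarrow> \<sigma> (z u) = z v" using z unfolding embeddings_def by auto
  show 1: "orbit \<sigma> (z u) = z ` (E\<^sup>+ `` {u})"
  proof (intro equalityI subsetI)
    fix x assume "x \<in> orbit \<sigma> (z u)"
    then show "x \<in> z ` (E\<^sup>+ `` {u})"
    proof induction
      case base
      obtain v where "(u, v) \<in> E" using u unfolding cycle_verts_def by (auto dest: tranclD)
      then show ?case using zE by (metis Image_singleton_iff image_eqI r_into_trancl)
    next
      case (step x)
      then obtain v where v: "x = z v" "(u, v) \<in> E\<^sup>+" by auto
      then have "v \<in> cycle_verts E" using cycle_verts_closed[OF sv u] by auto
      then obtain v' where "(v, v') \<in> E" unfolding cycle_verts_def by (auto dest: tranclD)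
      then show ?case using zE v by (metis Image_singleton_iff image_eqI trancl_into_trancl)
    qed
  next
    fix x assume "x \<in> z ` (E\<^sup>+ `` {u})"
    then obtain v where v: "x = z v" "(u, v) \<in> E\<^sup>+" by auto
    from v(2) have "z v \<in> orbit \<sigma> (z u)"
    proof induction
      case (base y)
      then show ?case using zE orbit.base by metis
    next
      case (step y w)
      then show ?case using zE orbit.step by metis
    qed
    then show "x \<in> orbit \<sigma> (z u)" using v by simp
  qed
  have "E\<^sup>+ `` {u} \<subseteq> W" using partial_inj_trancl[OF pi] by auto
  then have "inj_on z (E\<^sup>+ `` {u})" using z unfolding embeddings_def by (auto intro: inj_on_subset)
  then show "card (orbit \<sigma> (z u)) = card (E\<^sup>+ `` {u})" unfolding 1 by (rule card_image)
qed

lemma card_roots: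
  assumes "partial_inj W E"
  shows "card (W - Range E) = card W - card E" "card (Range E) = card E" "card (Domain E) = card E"
proof -
  have E: "finite W" "E \<subseteq> W \<times> W" "single_valued E" "single_valued (E\<inverse>)"
    using assms unfolding partial_inj_def by auto
  have "inj_on snd E" using E(4) unfolding single_valued_def by (auto intro!: inj_onI)
  then show r: "card (Range E) = card E" by (metis Range_snd card_image)
  have "inj_on fst E" using E(3) unfolding single_valued_def by (auto intro!: inj_onI)
  then show "card (Domain E) = card E" by (metis Domain_fst card_image)
  have "Range E \<subseteq> W" using E by auto
  then show "card (W - Range E) = card W - card E"
    using r E(1) by (metis card_Diff_subset finite_subset)
qed

text \<open>An embedding is determined by its values at the vertices without predecessor and at one vertex of
  each cycle.\<close>

lemma card_embeddings_le:
  assumes pi: "partial_inj W E"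
  shows "card (embeddings n W E \<sigma>) \<le>
     n ^ (card W - card E) * (\<Prod>C\<in>cycles_of E. card {x \<in> {1..n}. card (orbit \<sigma> x) = card C})"
proof -
  have W: "finite W" and sv: "single_valued E" using pi unfolding partial_inj_def by auto
  define rep where "rep C = (SOME u. u \<in> C)" for C :: "'a set"
  have rep: "rep C \<in> C" if "C \<in> cycles_of E" for C
    unfolding rep_def using cycles_of_nonempty[OF that] by (simp add: some_in_eq)
  let ?B = "W - Range E"
  let ?X = "\<lambda>C. {x \<in> {1..n}. card (orbit \<sigma> x) = card C}"
  define g where "g z = (restrict z ?B, restrict (z \<circ> rep) (cycles_of E))" for z :: "'a \<Rightarrow> nat"
  have "inj_on g (embeddings n W E \<sigma>)"
  proof (rule inj_onI)
    fix z z' assume z: "z \<in> embeddings n W E \<sigma>" "z' \<in> embeddings n W E \<sigma>" and eq: "g z = g z'"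
    have c: "\<forall>(u, v)\<in>E. \<sigma> (z u) = z v" "\<forall>(u, v)\<in>E. \<sigma> (z' u) = z' v" "z \<in> extensional W" "z' \<in> extensional W"
      using z unfolding embeddings_def by (auto simp: PiE_def)
    have eqB: "z b = z' b" if "b \<in> ?B" for b
    proof -
      have "restrict z ?B = restrict z' ?B" using eq unfolding g_def by simp
      then have "restrict z ?B b = restrict z' ?B b" by (rule fun_cong)
      then show ?thesis using that by simp
    qed
    have eqC: "z (rep C) = z' (rep C)" if "C \<in> cycles_of E" for C
    proof -
      have "restrict (z \<circ> rep) (cycles_of E) = restrict (z' \<circ> rep) (cycles_of E)" using eq unfolding g_def by simp
      then have "restrict (z \<circ> rep) (cycles_of E) C = restrict (z' \<circ> rep) (cycles_of E) C" by (rule fun_cong)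
      then show ?thesis using that by simp
    qed
    have "z v = z' v" if v: "v \<in> W" for v
      using root_or_cycle[OF pi v]
    proof
      assume "v \<in> cycle_verts E"
      then have C: "E\<^sup>+ `` {v} \<in> cycles_of E" and vv: "(v, v) \<in> E\<^sup>+" unfolding cycles_of_def cycle_verts_def by auto
      have "(rep (E\<^sup>+ `` {v}), v) \<in> E\<^sup>*"
        using cycles_ofD(2)[OF sv C rep[OF C]] vv by (metis Image_singleton_iff trancl_into_rtrancl)
      then show ?thesis by (rule constraints_determine[OF c(1,2) eqC[OF C]])
    next
      assume "\<exists>b\<in>?B. (b, v) \<in> E\<^sup>*"
      then obtain b where b: "b \<in> ?B" "(b, v) \<in> E\<^sup>*" by auto
      show ?thesis by (rule constraints_determine[OF c(1,2) eqB[OF b(1)] b(2)])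
    qed
    then show "z = z'" using c(3,4) by (rule extensionalityI[rotated 2])
  qed
  moreover have "g ` embeddings n W E \<sigma> \<subseteq> (?B \<rightarrow>\<^sub>E {1..n}) \<times> Pi\<^sub>E (cycles_of E) ?X"
  proof
    fix p assume "p \<in> g ` embeddings n W E \<sigma>"
    then obtain z where z: "z \<in> embeddings n W E \<sigma>" "p = g z" by auto
    have zW: "z v \<in> {1..n}" if "v \<in> W" for v using z(1) that unfolding embeddings_def by auto
    have "z (rep C) \<in> ?X C" if C: "C \<in> cycles_of E" for C
    proof -
      note D = cycles_ofD[OF sv C rep[OF C]]
      have "card (orbit \<sigma> (z (rep C))) = card C"
        using embedding_cycle_orbit(2)[OF pi z(1) D(1)] D(2) by simp
      moreover have "rep C \<in> W" using cycles_of_subset[OF pi C] rep[OF C] by auto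
      ultimately show ?thesis using zW by auto
    qed
    then show "p \<in> (?B \<rightarrow>\<^sub>E {1..n}) \<times> Pi\<^sub>E (cycles_of E) ?X"
      using zW unfolding z(2) g_def by simp
  qed
  ultimately have "card (embeddings n W E \<sigma>) \<le> card ((?B \<rightarrow>\<^sub>E {1..n}) \<times> Pi\<^sub>E (cycles_of E) ?X)"
    using W finite_cycles_of[OF pi] by (intro card_inj_on_le) (auto intro!: finite_PiE)
  also have "\<dots> = n ^ (card W - card E) * (\<Prod>C\<in>cycles_of E. card (?X C))"
    using W finite_cycles_of[OF pi] card_roots(1)[OF pi] by (simp add: card_cartesian_product card_PiE)
  finally show ?thesis .
qed

text \<open>Steps backwards are forced and end precisely at a vertex without predecessor. Root and
  distance thus serve as coordinates on an acyclic colour class.\<close>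

lemma relpow_root_unique:
  assumes "single_valued (E\<inverse>)" "b \<notin> Range E" "b' \<notin> Range E" "(b, v) \<in> E ^^ d" "(b', v) \<in> E ^^ d'"
  shows "b = b' \<and> d = d'"
  using assms(4,5)
proof (induction d arbitrary: v d')
  case 0
  then have b: "b = v" by simp
  have "d' = 0"
  proof (rule ccontr)
    assume "d' \<noteq> 0"
    then obtain d'' where "d' = Suc d''" by (cases d') simp
    then have "(b', v) \<in> E ^^ Suc d''" using "0.prems"(2) by simp
    then obtain y where "(y, v) \<in> E" by (rule relpow_Suc_E)
    then show False using assms(2) b by (simp add: Range_iff)
  qed
  then show ?case using "0.prems"(2) b by simp
next
  case (Suc d)
  from Suc.prems(1) obtain y where y: "(b, y) \<in> E ^^ d" "(y, v) \<in> E" by (rule relpow_Suc_E)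
  have "d' \<noteq> 0"
  proof
    assume "d' = 0"
    then have "b' = v" using Suc.prems(2) by simp
    then show False using y(2) assms(3) by (simp add: Range_iff)
  qed
  then obtain d'' where d'': "d' = Suc d''" by (cases d') simp
  then have "(b', v) \<in> E ^^ Suc d''" using Suc.prems(2) by simp
  then obtain y' where y': "(b', y') \<in> E ^^ d''" "(y', v) \<in> E" by (rule relpow_Suc_E)
  have "y = y'" using single_valuedD[OF assms(1)] y(2) y'(2) by blast
  then show ?case using Suc.IH[OF y(1)] y'(1) d'' by simp
qed

lemma single_valued_relpow_nat:
  fixes E :: "'v rel"
  assumes "single_valued E" "(u, v) \<in> E ^^ d" "(u, v') \<in> E ^^ d"
  shows "v = v'"
  using assms(2,3)
proof (induction d arbitrary: v v')
  case (Suc d)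
  from Suc.prems(1) obtain y where y: "(u, y) \<in> E ^^ d" "(y, v) \<in> E" by (rule relpow_Suc_E)
  from Suc.prems(2) obtain y' where y': "(u, y') \<in> E ^^ d" "(y', v') \<in> E" by (rule relpow_Suc_E)
  show ?case using Suc.IH[OF y(1) y'(1)] y(2) y'(2) single_valuedD[OF assms(1)] by blast
qed simp

text \<open>The roots may be labelled freely, and \<open>\<sigma>\<close> propagates the labels. A
  labelling fails only if two vertices collide. Under different roots, a collision determines one
  root label from another and costs a factor \<open>n\<close>, which the summand 1 covers. Under the
  same root, the root label lies on a cycle of \<open>\<sigma>\<close> of length at most
  \<open>D\<close>. The factor \<open>(card W)\<^sup>2\<close> comes from a union bound over pairs
  of vertices.\<close>

lemma card_embeddings_ge:
  assumes pi: "partial_inj W E" and acyc: "cycle_verts E = {}"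
    and D: "\<And>u v d. (u, v) \<in> E ^^ d \<Longrightarrow> d \<le> D" and \<sigma>: "\<sigma> permutes {1..n}"
  shows "n ^ (card W - card E) \<le> card (embeddings n W E \<sigma>) +
     (card W)\<^sup>2 * (n ^ (card W - card E - 1) * (1 + (\<Sum>c=1..D. card {x \<in> {1..n}. card (orbit \<sigma> x) = c})))"
proof -
  have E: "finite W" "E \<subseteq> W \<times> W" "single_valued E" "single_valued (E\<inverse>)"
    using pi unfolding partial_inj_def by auto
  note perm = permutes_permutation[OF \<sigma>]
  let ?B = "W - Range E"
  let ?q = "card W - card E"
  let ?S = "1 + (\<Sum>c=1..D. card {x \<in> {1..n}. card (orbit \<sigma> x) = c})"
  have "\<exists>b d. b \<in> ?B \<and> (b, v) \<in> E ^^ d" if "v \<in> W" for v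
    using root_or_cycle[OF pi that] acyc by (auto simp: rtrancl_power)
  then obtain root dist where rd: "\<And>v. v \<in> W \<Longrightarrow> root v \<in> ?B \<and> (root v, v) \<in> E ^^ dist v" by metis
  have uniq: "root v = b \<and> dist v = d" if "v \<in> W" "b \<in> ?B" "(b, v) \<in> E ^^ d" for v b d
    using relpow_root_unique[OF E(4), of "root v" b v "dist v" d] rd[OF that(1)] that by auto
  define Z where "Z x = (\<lambda>v\<in>W. (\<sigma> ^^ dist v) (x (root v)))" for x :: "'a \<Rightarrow> nat"
  have pw: "(\<sigma> ^^ i) permutes {1..n}" for i using \<sigma> by (rule permutes_funpow)
  have ZB: "Z x b = x b" if "b \<in> ?B" for x b
    using uniq[of b b 0] that by (auto simp: Z_def)
  have Zin: "Z x \<in> W \<rightarrow>\<^sub>E {1..n}" if "x \<in> ?B \<rightarrow>\<^sub>E {1..n}" for x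
    unfolding Z_def
  proof (rule restrict_PiE_iff[THEN iffD2], rule ballI)
    fix v assume "v \<in> W"
    then have "x (root v) \<in> {1..n}" using rd that by (auto simp: PiE_iff)
    then show "(\<sigma> ^^ dist v) (x (root v)) \<in> {1..n}" using permutes_in_image[OF pw] by blast
  qed
  have ZE: "\<sigma> (Z x u) = Z x v" if "(u, v) \<in> E" for x u v
  proof -
    have uv: "u \<in> W" "v \<in> W" using that E(2) by auto
    have "(root u, v) \<in> E ^^ Suc (dist u)" using rd[OF uv(1)] that by auto
    then have "root v = root u \<and> dist v = Suc (dist u)" using uniq[OF uv(2)] rd[OF uv(1)] by blast
    then show ?thesis using uv by (simp add: Z_def)
  qed
  let ?X = "?B \<rightarrow>\<^sub>E {1..n}"
  have finX: "finite ?X" using E(1) by (auto intro: finite_PiE)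
  have cX: "card ?X = n ^ ?q" using E(1) by (simp add: card_PiE card_roots(1)[OF pi])
  have good: "card {x \<in> ?X. inj_on (Z x) W} \<le> card (embeddings n W E \<sigma>)"
  proof (rule card_inj_on_le[where f = Z])
    show "inj_on Z {x \<in> ?X. inj_on (Z x) W}"
    proof (rule inj_onI)
      fix x x' assume x: "x \<in> {x \<in> ?X. inj_on (Z x) W}" "x' \<in> {x \<in> ?X. inj_on (Z x) W}" "Z x = Z x'"
      show "x = x'"
      proof (rule PiE_ext)
        show "x \<in> ?X" "x' \<in> ?X" using x by auto
        show "x b = x' b" if "b \<in> ?B" for b using ZB[OF that] x(3) by metis
      qed
    qed
    show "Z ` {x \<in> ?X. inj_on (Z x) W} \<subseteq> embeddings n W E \<sigma>"
      using Zin ZE unfolding embeddings_def by auto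
  qed (rule finite_embeddings[OF E(1)])
  have pair: "card {x \<in> ?X. Z x u = Z x v} \<le> n ^ (?q - 1) * ?S" if uv: "u \<in> W" "v \<in> W" "u \<noteq> v" for u v
  proof -
    let ?r = "root u"
    let ?B' = "?B - {?r}"
    have r: "?r \<in> ?B" using rd uv by auto
    have cB': "card ?B' = ?q - 1" using r E(1) card_roots(1)[OF pi] by simp
    have fB': "finite (?B' \<rightarrow>\<^sub>E {1..n})" using E(1) by (auto intro: finite_PiE)
    have cP: "card (?B' \<rightarrow>\<^sub>E {1..n}) = n ^ (?q - 1)" using E(1) cB' by (simp add: card_PiE)
    have res: "restrict x ?B' \<in> ?B' \<rightarrow>\<^sub>E {1..n}" if "x \<in> ?X" for x
      using PiE_mem[OF that] by (intro restrict_PiE_iff[THEN iffD2] ballI) blast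
    have ZZ: "(\<sigma> ^^ dist u) (x (root u)) = (\<sigma> ^^ dist v) (x (root v))" if "Z x u = Z x v" for x
      using that uv by (simp add: Z_def)
    show ?thesis
    proof (cases "root v = root u")
      case False
      have "card {x \<in> ?X. Z x u = Z x v} \<le> card (?B' \<rightarrow>\<^sub>E {1..n})"
      proof (rule card_inj_on_le[where f = "\<lambda>x. restrict x ?B'"])
        show "inj_on (\<lambda>x. restrict x ?B') {x \<in> ?X. Z x u = Z x v}"
        proof (rule inj_onI)
          fix x x' assume x: "x \<in> {x \<in> ?X. Z x u = Z x v}" "x' \<in> {x \<in> ?X. Z x u = Z x v}"
            and eq: "restrict x ?B' = restrict x' ?B'"
          have eq': "x b = x' b" if "b \<in> ?B'" for b using fun_cong[OF eq, of b] that by simp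
          have "root v \<in> ?B'" using rd uv False by auto
          then have "x (root v) = x' (root v)" by (rule eq')
          then have "(\<sigma> ^^ dist u) (x ?r) = (\<sigma> ^^ dist u) (x' ?r)" using ZZ[of x] ZZ[of x'] x by auto
          then have "x ?r = x' ?r" using permutes_inj[OF pw] by (auto dest: injD)
          then have eqB: "x b = x' b" if "b \<in> ?B" for b using eq' that by blast
          have "x \<in> ?X" "x' \<in> ?X" using x by blast+
          then show "x = x'" using eqB by (rule PiE_ext)
        qed
        show "(\<lambda>x. restrict x ?B') ` {x \<in> ?X. Z x u = Z x v} \<subseteq> ?B' \<rightarrow>\<^sub>E {1..n}"
          using res by (intro image_subsetI) blast
      qed (rule fB')
      also have "\<dots> \<le> n ^ (?q - 1) * ?S" unfolding cP by simp
      finally show ?thesis .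
    next
      case True
      have ne: "dist u \<noteq> dist v"
        using rd uv True single_valued_relpow_nat[OF E(3)] by metis
      define Y where "Y = {y \<in> {1..n}. (\<sigma> ^^ dist u) y = (\<sigma> ^^ dist v) y}"
      have "Y \<subseteq> (\<Union>c\<in>{1..D}. {x \<in> {1..n}. card (orbit \<sigma> x) = c})"
      proof
        fix y assume y: "y \<in> Y"
        define a b where "a = min (dist u) (dist v)" and "b = max (dist u) (dist v)"
        have ab: "a < b" "(\<sigma> ^^ a) y = (\<sigma> ^^ b) y" "b \<le> D"
          using ne y D rd uv unfolding a_def b_def Y_def by (auto simp: min_def max_def)
        have "(\<sigma> ^^ (b - a)) y = y" using ab by (intro funpow_diff[OF permutes_inj[OF \<sigma>]]) auto
        then have "card (orbit \<sigma> y) \<le> b - a" using ab by (intro card_orbit_le[OF perm]) auto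
        then show "y \<in> (\<Union>c\<in>{1..D}. {x \<in> {1..n}. card (orbit \<sigma> x) = c})"
          using card_orbit_pos[OF perm, of y] ab y unfolding Y_def by auto
      qed
      then have "card Y \<le> card (\<Union>c\<in>{1..D}. {x \<in> {1..n}. card (orbit \<sigma> x) = c})" by (intro card_mono) auto
      also have "\<dots> \<le> (\<Sum>c=1..D. card {x \<in> {1..n}. card (orbit \<sigma> x) = c})" by (intro card_UN_le) auto
      finally have cY: "card Y \<le> ?S" by simp
      have "card {x \<in> ?X. Z x u = Z x v} \<le> card ((?B' \<rightarrow>\<^sub>E {1..n}) \<times> Y)"
      proof (rule card_inj_on_le[where f = "\<lambda>x. (restrict x ?B', x ?r)"])
        show "inj_on (\<lambda>x. (restrict x ?B', x ?r)) {x \<in> ?X. Z x u = Z x v}"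
        proof (rule inj_onI)
          fix x x' assume x: "x \<in> {x \<in> ?X. Z x u = Z x v}" "x' \<in> {x \<in> ?X. Z x u = Z x v}"
            and eq: "(restrict x ?B', x ?r) = (restrict x' ?B', x' ?r)"
          have eq': "x b = x' b" if "b \<in> ?B'" for b
          proof -
            have "restrict x ?B' = restrict x' ?B'" using eq by simp
            from fun_cong[OF this, of b] that show ?thesis by simp
          qed
          moreover have "x ?r = x' ?r" using eq by simp
          ultimately have eqB: "x b = x' b" if "b \<in> ?B" for b using that by blast
          have "x \<in> ?X" "x' \<in> ?X" using x by blast+
          then show "x = x'" using eqB by (rule PiE_ext)
        qed
        have "x ?r \<in> Y" if "x \<in> ?X" "Z x u = Z x v" for x :: "'a \<Rightarrow> nat"
          using PiE_mem[OF that(1) r] ZZ[OF that(2)] True unfolding Y_def by simp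
        then show "(\<lambda>x. (restrict x ?B', x ?r)) ` {x \<in> ?X. Z x u = Z x v} \<subseteq> (?B' \<rightarrow>\<^sub>E {1..n}) \<times> Y"
          using res by (intro image_subsetI) simp
        have "finite Y" unfolding Y_def by simp
        then show "finite ((?B' \<rightarrow>\<^sub>E {1..n}) \<times> Y)" using fB' by (intro finite_cartesian_product)
      qed
      also have "\<dots> = n ^ (?q - 1) * card Y" by (simp only: card_cartesian_product cP)
      also have "\<dots> \<le> n ^ (?q - 1) * ?S" using cY by (rule mult_le_mono2)
      finally show ?thesis .
    qed
  qed
  let ?P = "{p \<in> W \<times> W. fst p \<noteq> snd p}"
  have "{x \<in> ?X. \<not> inj_on (Z x) W} \<subseteq> (\<Union>p\<in>?P. {x \<in> ?X. Z x (fst p) = Z x (snd p)})"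
  proof
    fix x assume x: "x \<in> {x \<in> ?X. \<not> inj_on (Z x) W}"
    then obtain u v where "u \<in> W" "v \<in> W" "u \<noteq> v" "Z x u = Z x v" unfolding inj_on_def by blast
    then show "x \<in> (\<Union>p\<in>?P. {x \<in> ?X. Z x (fst p) = Z x (snd p)})"
      using x by (intro UN_I[of "(u, v)"]) auto
  qed
  then have "card {x \<in> ?X. \<not> inj_on (Z x) W} \<le> card (\<Union>p\<in>?P. {x \<in> ?X. Z x (fst p) = Z x (snd p)})"
    using finX E(1) by (intro card_mono) auto
  also have "\<dots> \<le> (\<Sum>p\<in>?P. card {x \<in> ?X. Z x (fst p) = Z x (snd p)})" using E(1) by (intro card_UN_le) auto
  also have "\<dots> \<le> (\<Sum>p\<in>?P. n ^ (?q - 1) * ?S)" by (intro sum_mono pair) auto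
  also have "\<dots> = card ?P * (n ^ (?q - 1) * ?S)" by simp
  also have "\<dots> \<le> (card W)\<^sup>2 * (n ^ (?q - 1) * ?S)"
    using card_mono[of "W \<times> W" ?P] E(1) by (intro mult_le_mono1) (auto simp: card_cartesian_product power2_eq_square)
  finally have bad: "card {x \<in> ?X. \<not> inj_on (Z x) W} \<le> (card W)\<^sup>2 * (n ^ (?q - 1) * ?S)" .
  have "?X = {x \<in> ?X. inj_on (Z x) W} \<union> {x \<in> ?X. \<not> inj_on (Z x) W}" by blast
  then have "card ?X \<le> card {x \<in> ?X. inj_on (Z x) W} + card {x \<in> ?X. \<not> inj_on (Z x) W}"
    by (metis (no_types, lifting) card_Un_le)
  then show ?thesis using good bad unfolding cX by linarith
qed

section \<open>Trails in quotient graphs\<close>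

lemma card_filter_swap:
  assumes "finite A" "finite B"
  shows "(\<Sum>a\<in>A. card {b \<in> B. R a b}) = (\<Sum>b\<in>B. card {a \<in> A. R a b})"
proof -
  have 1: "card {b \<in> B. R a b} = (\<Sum>b\<in>B. if R a b then 1 else 0)" for a
    using sum.inter_filter[OF assms(2), of "\<lambda>_. 1::nat" "R a"] by simp
  have 2: "card {a \<in> A. R a b} = (\<Sum>a\<in>A. if R a b then 1 else 0)" for b
    using sum.inter_filter[OF assms(1), of "\<lambda>_. 1::nat" "\<lambda>a. R a b"] by simp
  show ?thesis unfolding 1 2 by (rule sum.swap)
qed

section \<open>Cycles of a relation as orbits of a function\<close>

lemma cycle_vert_edge_back:
  assumes "single_valued E" "single_valued (E\<inverse>)" "v \<in> cycle_verts E" "(u, v) \<in> E"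
  shows "u \<in> cycle_verts E" "E\<^sup>+ `` {u} = E\<^sup>+ `` {v}"
proof -
  have "(v, v) \<in> E\<^sup>+" using assms(3) by (simp add: cycle_verts_def)
  then obtain u' where u': "(v, u') \<in> E\<^sup>*" "(u', v) \<in> E" by (meson tranclD2)
  have "u' = u" using assms(2) u'(2) assms(4) unfolding single_valued_def by blast
  then have "(v, u) \<in> E\<^sup>*" using u' by simp
  then have "(v, u) \<in> E\<^sup>+" using assms(3) \<open>(v, v) \<in> E\<^sup>+\<close> by (meson trancl_rtrancl_trancl)
  then show "u \<in> cycle_verts E" "E\<^sup>+ `` {u} = E\<^sup>+ `` {v}"
    using cycle_verts_closed[OF assms(1,3)] by blast+
qed

text \<open>Replacing the edges by a function makes the orbit calculus available; positions on a
  cycle then become residues modulo its length.\<close>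

definition succ_of :: "'v rel \<Rightarrow> 'v \<Rightarrow> 'v" where
  "succ_of E u = (SOME v. (u, v) \<in> E)"

lemma succ_of_eq: "single_valued E \<Longrightarrow> (u, v) \<in> E \<Longrightarrow> succ_of E u = v"
  unfolding succ_of_def by (metis single_valuedD someI_ex)

lemma cycle_succ_edge: "u \<in> cycle_verts E \<Longrightarrow> (u, succ_of E u) \<in> E"
proof -
  assume "u \<in> cycle_verts E"
  then have "(u, u) \<in> E\<^sup>+" by (simp add: cycle_verts_def)
  then obtain v where "(u, v) \<in> E" by (meson tranclD)
  then show ?thesis unfolding succ_of_def by (rule someI)
qed

lemma cycle_orbit:
  assumes sv: "single_valued E" and u: "u \<in> cycle_verts E"
  shows "orbit (succ_of E) u = E\<^sup>+ `` {u}"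
proof (intro equalityI subsetI)
  fix x assume "x \<in> orbit (succ_of E) u"
  then have "(u, x) \<in> E\<^sup>+"
  proof induction
    case base
    show ?case using cycle_succ_edge[OF u] by (rule r_into_trancl)
  next
    case (step x)
    then have "x \<in> cycle_verts E" using cycle_verts_closed(1)[OF sv u] by blast
    then show ?case using cycle_succ_edge step.IH by (metis trancl_into_trancl)
  qed
  then show "x \<in> E\<^sup>+ `` {u}" by simp
next
  fix x assume "x \<in> E\<^sup>+ `` {u}"
  then have "(u, x) \<in> E\<^sup>+" by simp
  then show "x \<in> orbit (succ_of E) u"
  proof induction
    case (base y)
    then show ?case using succ_of_eq[OF sv] orbit.base by metis
  next
    case (step y z)
    then show ?case using succ_of_eq[OF sv] orbit.step by metis
  qed
qed

lemma cycle_funpow: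
  assumes sv: "single_valued E" and C: "C \<in> cycles_of E"
  shows "u \<in> C \<Longrightarrow> (succ_of E ^^ i) u = (succ_of E ^^ i') u \<longleftrightarrow> i mod card C = i' mod card C"
    and "u \<in> C \<Longrightarrow> v \<in> C \<Longrightarrow> \<exists>i<card C. (succ_of E ^^ i) u = v"
    and "0 < card C"
    and "u \<in> C \<Longrightarrow> (succ_of E ^^ i) u \<in> C"
proof -
  let ?f = "succ_of E"
  have main: "((?f ^^ i) u = (?f ^^ i') u \<longleftrightarrow> i mod card C = i' mod card C) \<and>
     (v \<in> C \<longrightarrow> (\<exists>i<card C. (?f ^^ i) u = v)) \<and> 0 < card C \<and> (?f ^^ i) u \<in> C" if uC: "u \<in> C" for u v i i'
  proof -
    have u: "u \<in> cycle_verts E" "C = E\<^sup>+ `` {u}" using cycles_ofD[OF sv C uC] .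
    have orb: "orbit ?f u = C" using cycle_orbit[OF sv u(1)] u(2) by simp
    have self: "u \<in> orbit ?f u" using uC orb by simp
    define D where "D = funpow_dist1 ?f u u"
    have D: "(?f ^^ D) u = u" "D > 0" unfolding D_def using funpow_dist1_prop[OF self] by auto
    have im: "C = (\<lambda>n. (?f ^^ n) u) ` {0..<D}" unfolding D_def orb[symmetric] by (rule orbit_conv_funpow_dist1[OF self])
    have inj: "inj_on (\<lambda>n. (?f ^^ n) u) {0..<D}" unfolding D_def by (rule inj_on_funpow_dist1[OF self])
    have c: "card C = D" using inj unfolding im by (simp add: card_image)
    have md: "(?f ^^ m) u = (?f ^^ (m mod D)) u" for m using funpow_mod_eq[OF D(1)] by metis
    have 1: "(?f ^^ i) u = (?f ^^ i') u \<longleftrightarrow> i mod card C = i' mod card C"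
    proof
      assume "(?f ^^ i) u = (?f ^^ i') u"
      then have "(?f ^^ (i mod D)) u = (?f ^^ (i' mod D)) u" using md by metis
      then show "i mod card C = i' mod card C" unfolding c
        using inj_onD[OF inj, of "i mod D" "i' mod D"] D(2) by simp
    next
      assume "i mod card C = i' mod card C"
      then show "(?f ^^ i) u = (?f ^^ i') u" unfolding c using md by metis
    qed
    have 2: "\<exists>i<card C. (?f ^^ i) u = v" if "v \<in> C"
      using that c unfolding im by auto
    have "(?f ^^ i) u \<in> C" unfolding im md[of i] using D(2) by (intro imageI) simp
    then show ?thesis using 1 2 c D(2) by blast
  qed
  show "u \<in> C \<Longrightarrow> (succ_of E ^^ i) u = (succ_of E ^^ i') u \<longleftrightarrow> i mod card C = i' mod card C" using main by blast
  show "u \<in> C \<Longrightarrow> v \<in> C \<Longrightarrow> \<exists>i<card C. (succ_of E ^^ i) u = v" using main by blast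
  obtain w where "w \<in> C" using cycles_of_nonempty[OF C] by blast
  then show "0 < card C" using main by blast
  show "u \<in> C \<Longrightarrow> (succ_of E ^^ i) u \<in> C" using main by blast
qed

section \<open>Closed reduced walks and their quotients\<close>

text \<open>A family of closed walks: \<open>I\<close> is the set of times, \<open>s\<close> passes
  to the next time, and \<open>col\<close> and \<open>pos\<close> give generator and sign of the
  letter read. The assumption \<open>red\<close> is cyclic reducedness. By \<open>runs\<close>,
  every time lies in a block of one colour whose length \<open>b\<close> is an allowed exponent and
  which is preceded and followed by other colours.\<close>

locale trail =
  fixes I :: "'a set" and s :: "'a \<Rightarrow> 'a" and col :: "'a \<Rightarrow> nat" and pos :: "'a \<Rightarrow> bool"
    and K :: "nat set" and N :: "nat \<Rightarrow> nat set"
  assumes finI: "finite I" and finK: "finite K" and bij: "bij_betw s I I"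
    and colK: "\<And>t. t \<in> I \<Longrightarrow> col t \<in> K"
    and red: "\<And>t. t \<in> I \<Longrightarrow> col (s t) = col t \<Longrightarrow> pos (s t) = pos t"
    and runs: "\<And>t. t \<in> I \<Longrightarrow> \<exists>t0\<in>I. \<exists>b\<in>N (col t). \<exists>i<b. t = (s ^^ i) t0 \<and>
       (\<forall>i<b. col ((s ^^ i) t0) = col t) \<and> col ((s ^^ b) t0) \<noteq> col t \<and>
       (\<exists>t1\<in>I. s t1 = t0 \<and> col t1 \<noteq> col t)"
begin

text \<open>An inverse letter traverses its edge against the orientation, so that all edges of one
  colour describe the action of the generator itself.\<close>

definition src :: "'a \<Rightarrow> 'a" where "src t = (if pos t then t else s t)"
definition tgt :: "'a \<Rightarrow> 'a" where "tgt t = (if pos t then s t else t)"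

definition edges :: "('a \<Rightarrow> 'v) \<Rightarrow> nat \<Rightarrow> 'v rel" where
  "edges \<rho> j = (\<lambda>t. (\<rho> (src t), \<rho> (tgt t))) ` {t \<in> I. col t = j}"

definition attached :: "('a \<Rightarrow> 'v) \<Rightarrow> nat \<Rightarrow> 'v \<Rightarrow> bool" where
  "attached \<rho> j v \<longleftrightarrow> (\<exists>j'\<in>K. j' \<noteq> j \<and> v \<in> Field (edges \<rho> j'))"

text \<open>Folded in the sense of Stallings. Only such quotients can occur inside the graph of a
  tuple of permutations.\<close>

definition folded :: "('a \<Rightarrow> 'v) \<Rightarrow> bool" where
  "folded \<rho> \<longleftrightarrow> (\<forall>j\<in>K. single_valued (edges \<rho> j) \<and> single_valued ((edges \<rho> j)\<inverse>))"

text \<open>\<open>True\<close> marks an outgoing and \<open>False\<close> an incoming edge, so a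
  loop counts twice. At time \<open>t\<close> the walk leaves \<open>\<rho> t\<close> by
  \<open>(col t, pos t)\<close> and enters \<open>\<rho> (s t)\<close> by
  \<open>(col t, \<not> pos t)\<close>.\<close>

definition half_edges :: "('a \<Rightarrow> 'v) \<Rightarrow> 'v \<Rightarrow> (nat \<times> bool) set" where
  "half_edges \<rho> v = {j \<in> K. v \<in> Domain (edges \<rho> j)} \<times> {True} \<union> {j \<in> K. v \<in> Range (edges \<rho> j)} \<times> {False}"

lemma s_in: "t \<in> I \<Longrightarrow> s t \<in> I"
  using bij by (rule bij_betwE[THEN bspec])

lemma s_pow_in: "t \<in> I \<Longrightarrow> (s ^^ i) t \<in> I"
  by (induction i) (auto intro: s_in)

lemma edges_subset: "edges \<rho> j \<subseteq> \<rho> ` I \<times> \<rho> ` I"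
  unfolding edges_def src_def tgt_def by (auto intro!: imageI s_in)

lemma partial_inj_edges: "folded \<rho> \<Longrightarrow> j \<in> K \<Longrightarrow> partial_inj (\<rho> ` I) (edges \<rho> j)"
  unfolding partial_inj_def folded_def using finI edges_subset by blast

lemma edgeI: "t \<in> I \<Longrightarrow> (\<rho> (src t), \<rho> (tgt t)) \<in> edges \<rho> (col t)"
  unfolding edges_def by blast

lemma out_half: "t \<in> I \<Longrightarrow> (col t, pos t) \<in> half_edges \<rho> (\<rho> t)"
  using edgeI[of t \<rho>] colK[of t] unfolding half_edges_def src_def tgt_def by (cases "pos t") auto

lemma in_half: "t \<in> I \<Longrightarrow> (col t, \<not> pos t) \<in> half_edges \<rho> (\<rho> (s t))"
  using edgeI[of t \<rho>] colK[of t] unfolding half_edges_def src_def tgt_def by (cases "pos t") auto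

lemma in_out_neq: "t \<in> I \<Longrightarrow> (col t, \<not> pos t) \<noteq> (col (s t), pos (s t))"
  using red[of t] by auto

lemma attachedI:
  assumes "t \<in> I" "col t \<noteq> j"
  shows "attached \<rho> j (\<rho> t)" "attached \<rho> j (\<rho> (s t))"
proof -
  have "\<rho> t \<in> Field (edges \<rho> (col t)) \<and> \<rho> (s t) \<in> Field (edges \<rho> (col t))"
    using edgeI[OF assms(1), of \<rho>] unfolding src_def tgt_def by (cases "pos t") (auto simp: Field_def)
  then show "attached \<rho> j (\<rho> t)" "attached \<rho> j (\<rho> (s t))"
    using assms(2) colK[OF assms(1)] unfolding attached_def by blast+
qed

lemma finite_half_edges: "finite (half_edges \<rho> v)"
  unfolding half_edges_def using finK by simp

lemma card_half_edges:
  "card (half_edges \<rho> v) = card {j \<in> K. v \<in> Domain (edges \<rho> j)} + card {j \<in> K. v \<in> Range (edges \<rho> j)}"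
  unfolding half_edges_def using finK by (subst card_Un_disjoint) (auto simp: card_cartesian_product)

lemma sum_half_edges:
  assumes "folded \<rho>"
  shows "(\<Sum>v\<in>\<rho> ` I. card (half_edges \<rho> v)) = 2 * (\<Sum>j\<in>K. card (edges \<rho> j))"
proof -
  have dr: "{v \<in> \<rho> ` I. v \<in> Domain (edges \<rho> j)} = Domain (edges \<rho> j)"
    "{v \<in> \<rho> ` I. v \<in> Range (edges \<rho> j)} = Range (edges \<rho> j)" for j
    using edges_subset[of \<rho> j] by blast+
  have "(\<Sum>v\<in>\<rho> ` I. card (half_edges \<rho> v)) =
     (\<Sum>j\<in>K. card {v \<in> \<rho> ` I. v \<in> Domain (edges \<rho> j)}) + (\<Sum>j\<in>K. card {v \<in> \<rho> ` I. v \<in> Range (edges \<rho> j)})"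
    unfolding card_half_edges sum.distrib
    using card_filter_swap[of "\<rho> ` I" K "\<lambda>v j. v \<in> Domain (edges \<rho> j)"]
      card_filter_swap[of "\<rho> ` I" K "\<lambda>v j. v \<in> Range (edges \<rho> j)"] finI finK by simp
  also have "\<dots> = (\<Sum>j\<in>K. card (edges \<rho> j)) + (\<Sum>j\<in>K. card (edges \<rho> j))"
    unfolding dr using card_roots(2,3)[OF partial_inj_edges[OF assms]] by simp
  finally show ?thesis by simp
qed

text \<open>Because the walk is reduced, it leaves a vertex by a half-edge other than the one by
  which it entered.\<close>

lemma two_le_half_edges:
  assumes "v \<in> \<rho> ` I"
  shows "2 \<le> card (half_edges \<rho> v)"
proof -
  obtain u where u: "u \<in> I" "v = \<rho> u" using assms by blast
  obtain t where t: "t \<in> I" "u = s t" using bij u(1) unfolding bij_betw_def by blast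
  have "{(col t, \<not> pos t), (col u, pos u)} \<subseteq> half_edges \<rho> v"
    using in_half[OF t(1), of \<rho>] out_half[OF u(1), of \<rho>] unfolding u(2) t(2) by blast
  then have "card {(col t, \<not> pos t), (col u, pos u)} \<le> card (half_edges \<rho> v)"
    by (rule card_mono[OF finite_half_edges])
  moreover have "card {(col t, \<not> pos t), (col u, pos u)} = 2"
    using in_out_neq[OF t(1)] unfolding t(2) by simp
  ultimately show ?thesis by simp
qed

section \<open>Half-edges and attachments\<close>

definition attached_colours :: "('a \<Rightarrow> 'v) \<Rightarrow> 'v \<Rightarrow> nat set" where
  "attached_colours \<rho> v = {j \<in> K. v \<in> cycle_verts (edges \<rho> j) \<and> attached \<rho> j v}"

lemma cycle_half_edges:
  assumes "j \<in> K" "v \<in> cycle_verts (edges \<rho> j)"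
  shows "(j, b) \<in> half_edges \<rho> v"
proof -
  have c: "(v, v) \<in> (edges \<rho> j)\<^sup>+" using assms(2) by (simp add: cycle_verts_def)
  from tranclD[OF c] have "v \<in> Domain (edges \<rho> j)" by blast
  moreover from tranclD2[OF c] have "v \<in> Range (edges \<rho> j)" by blast
  ultimately show ?thesis using assms(1) unfolding half_edges_def by (cases b) auto
qed

text \<open>Every cycle colour at \<open>v\<close> uses two half-edges. If exactly one such colour
  is attached, a half-edge of another colour is the third; if there are \<open>m \<ge> 2\<close>,
  then \<open>2 * m \<ge> m + 2\<close>.\<close>

lemma attached_colours_le:
  assumes "v \<in> \<rho> ` I"
  shows "card (attached_colours \<rho> v) + 2 \<le> card (half_edges \<rho> v)"
proof -
  let ?J = "attached_colours \<rho> v" and ?H = "half_edges \<rho> v"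
  have finJ: "finite ?J" unfolding attached_colours_def using finK by simp
  have sub: "?J \<times> UNIV \<subseteq> ?H"
    using cycle_half_edges unfolding attached_colours_def by auto
  consider "card ?J = 0" | "card ?J = 1" | "card ?J \<ge> 2" by linarith
  then show ?thesis
  proof cases
    case 1
    then show ?thesis using two_le_half_edges[OF assms] by simp
  next
    case 2
    then obtain j where j: "?J = {j}" by (auto simp: card_1_singleton_iff)
    then have "attached \<rho> j v" unfolding attached_colours_def by blast
    then obtain j' where j': "j' \<in> K" "j' \<noteq> j" "v \<in> Field (edges \<rho> j')" unfolding attached_def by blast
    then obtain b where b: "(j', b) \<in> ?H" unfolding half_edges_def Field_def by blast
    have "{(j, True), (j, False), (j', b)} \<subseteq> ?H" using sub b unfolding j by blast
    then have "card {(j, True), (j, False), (j', b)} \<le> card ?H" by (rule card_mono[OF finite_half_edges])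
    then show ?thesis using j'(2) 2 by simp
  next
    case 3
    have "card (?J \<times> (UNIV :: bool set)) \<le> card ?H" by (rule card_mono[OF finite_half_edges sub])
    then show ?thesis using 3 by (simp add: card_cartesian_product)
  qed
qed

definition attachments :: "('a \<Rightarrow> 'v) \<Rightarrow> nat \<Rightarrow> 'v set \<Rightarrow> nat" where
  "attachments \<rho> j C = card {v \<in> C. attached \<rho> j v}"

lemma sum_attachments:
  assumes "folded \<rho>" "j \<in> K"
  shows "(\<Sum>C\<in>cycles_of (edges \<rho> j). attachments \<rho> j C) =
    card {v \<in> \<rho> ` I. v \<in> cycle_verts (edges \<rho> j) \<and> attached \<rho> j v}"
proof -
  note pi = partial_inj_edges[OF assms]
  have sv: "single_valued (edges \<rho> j)" using pi unfolding partial_inj_def by blast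
  have "{v \<in> \<rho> ` I. v \<in> cycle_verts (edges \<rho> j) \<and> attached \<rho> j v} =
      (\<Union>C\<in>cycles_of (edges \<rho> j). {v \<in> C. attached \<rho> j v})"
  proof (intro equalityI subsetI)
    fix v assume v: "v \<in> {v \<in> \<rho> ` I. v \<in> cycle_verts (edges \<rho> j) \<and> attached \<rho> j v}"
    then have "(edges \<rho> j)\<^sup>+ `` {v} \<in> cycles_of (edges \<rho> j)" "v \<in> (edges \<rho> j)\<^sup>+ `` {v}"
      unfolding cycles_of_def cycle_verts_def by blast+
    then show "v \<in> (\<Union>C\<in>cycles_of (edges \<rho> j). {v \<in> C. attached \<rho> j v})" using v by blast
  next
    fix v assume "v \<in> (\<Union>C\<in>cycles_of (edges \<rho> j). {v \<in> C. attached \<rho> j v})"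
    then obtain C where "C \<in> cycles_of (edges \<rho> j)" "v \<in> C" "attached \<rho> j v" by blast
    then show "v \<in> {v \<in> \<rho> ` I. v \<in> cycle_verts (edges \<rho> j) \<and> attached \<rho> j v}"
      using cycles_ofD(1)[OF sv] cycles_of_subset[OF pi] by blast
  qed
  also have "card \<dots> = (\<Sum>C\<in>cycles_of (edges \<rho> j). card {v \<in> C. attached \<rho> j v})"
  proof (rule card_UN_disjoint)
    show "finite (cycles_of (edges \<rho> j))" by (rule finite_cycles_of[OF pi])
    show "\<forall>C\<in>cycles_of (edges \<rho> j). finite {v \<in> C. attached \<rho> j v}"
    proof
      fix C assume "C \<in> cycles_of (edges \<rho> j)"
      then have "finite C" using cycles_of_subset[OF pi] finI by (metis finite_imageI finite_subset)
      then show "finite {v \<in> C. attached \<rho> j v}" by simp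
    qed
    show "\<forall>C\<in>cycles_of (edges \<rho> j). \<forall>C'\<in>cycles_of (edges \<rho> j). C \<noteq> C' \<longrightarrow>
       {v \<in> C. attached \<rho> j v} \<inter> {v \<in> C'. attached \<rho> j v} = {}"
      using cycles_of_disjoint[OF sv] by blast
  qed
  finally show ?thesis unfolding attachments_def by simp
qed

text \<open>The local inequality is summed over the vertices, where the half-edges add up to twice
  the edges. In powers of \<open>n\<close>, each attachment is thus worth a factor
  \<open>1 / sqrt n\<close>.\<close>

lemma euler_bound:
  assumes "folded \<rho>"
  shows "2 * card (\<rho> ` I) + (\<Sum>j\<in>K. \<Sum>C\<in>cycles_of (edges \<rho> j). attachments \<rho> j C)
      \<le> 2 * (\<Sum>j\<in>K. card (edges \<rho> j))"
proof -
  have "(\<Sum>j\<in>K. \<Sum>C\<in>cycles_of (edges \<rho> j). attachments \<rho> j C) =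
    (\<Sum>j\<in>K. card {v \<in> \<rho> ` I. v \<in> cycle_verts (edges \<rho> j) \<and> attached \<rho> j v})"
    by (intro sum.cong refl sum_attachments[OF assms])
  also have "\<dots> = (\<Sum>v\<in>\<rho> ` I. card (attached_colours \<rho> v))"
    unfolding attached_colours_def using finI finK by (intro card_filter_swap) auto
  finally have "2 * card (\<rho> ` I) + (\<Sum>j\<in>K. \<Sum>C\<in>cycles_of (edges \<rho> j). attachments \<rho> j C) =
     (\<Sum>v\<in>\<rho> ` I. card (attached_colours \<rho> v) + 2)"
    by (simp only: sum.distrib sum_constant) simp
  also have "\<dots> \<le> (\<Sum>v\<in>\<rho> ` I. card (half_edges \<rho> v))"
    by (intro sum_mono attached_colours_le)
  finally show ?thesis unfolding sum_half_edges[OF assms] .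
qed

lemma half_edges_eq_2:
  assumes "folded \<rho>" "(\<Sum>j\<in>K. card (edges \<rho> j)) \<le> card (\<rho> ` I)" "v \<in> \<rho> ` I"
  shows "card (half_edges \<rho> v) = 2"
proof (rule ccontr)
  assume "card (half_edges \<rho> v) \<noteq> 2"
  then have "2 < card (half_edges \<rho> v)" using two_le_half_edges[OF assms(3)] by simp
  then have "(\<Sum>v\<in>\<rho> ` I. 2) < (\<Sum>v\<in>\<rho> ` I. card (half_edges \<rho> v))"
    using assms(3) by (intro sum_strict_mono_ex1 finite_imageI finI ballI two_le_half_edges) auto
  then show False using assms(2) unfolding sum_half_edges[OF assms(1)] by simp
qed

section \<open>Runs and the lengths of monochromatic cycles\<close>

lemma run_cover:
  assumes fold: "folded \<rho>" and j: "j \<in> K" and e: "(v, v') \<in> edges \<rho> j"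
  obtains z b i where "b \<in> N j" "i < b" "z i = v" "\<And>k. k < b \<Longrightarrow> (z k, z (Suc k)) \<in> edges \<rho> j"
    "attached \<rho> j (z 0)" "attached \<rho> j (z b)"
proof -
  let ?E = "edges \<rho> j"
  obtain t where t: "t \<in> I" "col t = j" "v = \<rho> (src t)" using e unfolding edges_def by blast
  obtain t0 b i0 t1 where r: "t0 \<in> I" "b \<in> N j" "i0 < b" "t = (s ^^ i0) t0"
    "\<And>i. i < b \<Longrightarrow> col ((s ^^ i) t0) = j" "col ((s ^^ b) t0) \<noteq> j" "t1 \<in> I" "s t1 = t0" "col t1 \<noteq> j"
    using runs[OF t(1)] unfolding t(2) by blast
  define x where "x i = \<rho> ((s ^^ i) t0)" for i
  have posc: "pos ((s ^^ i) t0) = pos t0" if "i < b" for i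
    using that
  proof (induction i)
    case (Suc i)
    have "col (s ((s ^^ i) t0)) = col ((s ^^ i) t0)" using r(5)[of i] r(5)[of "Suc i"] Suc.prems by simp
    then have "pos (s ((s ^^ i) t0)) = pos ((s ^^ i) t0)" by (rule red[OF s_pow_in[OF r(1)]])
    then show ?case using Suc by simp
  qed simp
  have edge: "(if pos t0 then (x i, x (Suc i)) else (x (Suc i), x i)) \<in> ?E" if "i < b" for i
  proof -
    have "(\<rho> (src ((s ^^ i) t0)), \<rho> (tgt ((s ^^ i) t0))) \<in> ?E"
      using edgeI[OF s_pow_in[OF r(1)], of \<rho> i] unfolding r(5)[OF that] .
    then show ?thesis unfolding src_def tgt_def x_def posc[OF that] by (cases "pos t0") simp_all
  qed
  \<comment> \<open>A run of inverse letters is reversed, so that \<open>z\<close> always follows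
    the orientation of the edges.\<close>
  define z where "z k = (if pos t0 then x k else x (b - k))" for k
  have zE: "(z k, z (Suc k)) \<in> ?E" if "k < b" for k
  proof (cases "pos t0")
    case True
    then show ?thesis using edge[OF that] by (simp add: z_def)
  next
    case False
    have "Suc (b - Suc k) = b - k" using that by simp
    then show ?thesis using edge[of "b - Suc k"] that False by (simp add: z_def)
  qed
  have att: "attached \<rho> j (x 0)" "attached \<rho> j (x b)"
    using attachedI(2)[OF r(7,9), of \<rho>] attachedI(1)[OF s_pow_in[OF r(1)] r(6), of \<rho>] r(8)
    unfolding x_def by simp_all
  have attz: "attached \<rho> j (z 0)" "attached \<rho> j (z b)" using att unfolding z_def by auto
  obtain i where i: "i < b" "v = z i"
  proof (cases "pos t0")
    case True
    then have "v = z i0" using t(3) posc[OF r(3)] unfolding r(4) src_def z_def x_def by simp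
    then show ?thesis using that r(3) by blast
  next
    case False
    then have "v = x (Suc i0)" using t(3) posc[OF r(3)] unfolding r(4) src_def x_def by simp
    moreover have "b - (b - Suc i0) = Suc i0" using r(3) by simp
    ultimately have "v = z (b - Suc i0)" using False by (simp add: z_def)
    moreover have "b - Suc i0 < b" using r(3) by simp
    ultimately show ?thesis using that by blast
  qed
  show ?thesis
    using that[of b i z] r(2) i zE attz by blast
qed

text \<open>In a folded quotient a cycle is a full component of its colour. A run using one of its
  edges therefore stays on it, back to its starting vertex, where it meets another colour.\<close>

lemma run_on_cycle:
  assumes fold: "folded \<rho>" and j: "j \<in> K" and C: "C \<in> cycles_of (edges \<rho> j)" and v: "v \<in> C"
  obtains P b i where "b \<in> N j" "i < b" "P \<in> C" "attached \<rho> j P" "(succ_of (edges \<rho> j) ^^ i) P = v"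
    "attached \<rho> j ((succ_of (edges \<rho> j) ^^ b) P)"
proof -
  let ?E = "edges \<rho> j"
  note pi = partial_inj_edges[OF fold j]
  have sv: "single_valued ?E" "single_valued (?E\<inverse>)" using pi unfolding partial_inj_def by blast+
  note vc = cycles_ofD[OF sv(1) C v]
  obtain z b i where i: "b \<in> N j" "i < b" "z i = v" and zE: "\<And>k. k < b \<Longrightarrow> (z k, z (Suc k)) \<in> ?E"
    and attz: "attached \<rho> j (z 0)" "attached \<rho> j (z b)"
    using run_cover[OF fold j cycle_succ_edge[OF vc(1)]] by blast
  have zC: "z (i - k) \<in> C" if "k \<le> i" for k
    using that
  proof (induction k)
    case 0
    then show ?case using v i(3) by simp
  next
    case (Suc k)
    then have IH: "z (i - k) \<in> C" by simp
    have "Suc (i - Suc k) = i - k" using Suc.prems by simp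
    then have e: "(z (i - Suc k), z (i - k)) \<in> ?E" using zE[of "i - Suc k"] i(2) by simp
    note c = cycles_ofD[OF sv(1) C IH]
    note prv = cycle_vert_edge_back[OF sv c(1) e]
    then show ?case using c(2) unfolding cycle_verts_def by blast
  qed
  have pw: "(succ_of ?E ^^ k) (z 0) = z k" if "k \<le> b" for k
    using that
  proof (induction k)
    case (Suc k)
    then show ?case using succ_of_eq[OF sv(1) zE[of k]] by simp
  qed simp
  show ?thesis
  proof (rule that[of b i "z 0"])
    show "z 0 \<in> C" using zC[of i] by simp
    show "(succ_of ?E ^^ i) (z 0) = v" using pw[of i] i by simp
    show "attached \<rho> j ((succ_of ?E ^^ b) (z 0))" using pw[of b] attz(2) by simp
  qed (use i attz(1) in auto)
qed

text \<open>Some run passes through the cycle, and its starting vertex is attached. Hence no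
  monochromatic cycle is free of charge in the Euler count.\<close>

lemma attachments_pos:
  assumes "folded \<rho>" "j \<in> K" "C \<in> cycles_of (edges \<rho> j)"
  shows "1 \<le> attachments \<rho> j C"
proof -
  obtain v where "v \<in> C" using cycles_of_nonempty[OF assms(3)] by blast
  then obtain P where "P \<in> C" "attached \<rho> j P" using run_on_cycle[OF assms] by metis
  moreover have "finite C" using cycles_of_subset[OF partial_inj_edges[OF assms(1,2)] assms(3)] finI
    by (metis finite_imageI finite_subset)
  ultimately have "0 < card {v \<in> C. attached \<rho> j v}" by (subst card_gt_0_iff) auto
  then show ?thesis unfolding attachments_def by simp
qed

text \<open>A run begins and ends at attached vertices. With only one available it returns to its
  start, having gone round the cycle a whole number of times.\<close>

lemma attachments_1:
  assumes "folded \<rho>" "j \<in> K" "C \<in> cycles_of (edges \<rho> j)" "attachments \<rho> j C = 1"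
  shows "\<exists>b\<in>N j. card C dvd b"
proof -
  let ?f = "succ_of (edges \<rho> j)"
  have sv: "single_valued (edges \<rho> j)" using assms(1,2) unfolding folded_def by blast
  obtain a where a: "{v \<in> C. attached \<rho> j v} = {a}"
    using assms(4) unfolding attachments_def by (auto simp: card_1_singleton_iff)
  then have "a \<in> C" by blast
  then obtain P b i where P: "b \<in> N j" "P \<in> C" "attached \<rho> j P" "attached \<rho> j ((?f ^^ b) P)"
    using run_on_cycle[OF assms(1-3)] by metis
  have "(?f ^^ b) P \<in> C" by (rule cycle_funpow(4)[OF sv assms(3) P(2)])
  moreover have "x = a" if "x \<in> C" "attached \<rho> j x" for x using a that by auto
  ultimately have "(?f ^^ b) P = P" using P by metis
  then have "b mod card C = 0 mod card C" using cycle_funpow(1)[OF sv assms(3) P(2), of b 0] by simp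
  then show ?thesis using P(1) by auto
qed

text \<open>A run shorter than the cycle cannot end where it starts, so it joins the two attached
  vertices. The run through the edge leaving \<open>P\<close> either starts at \<open>P\<close> and
  reaches \<open>Q\<close> after \<open>q\<close> steps, or starts at \<open>Q\<close>, passes
  \<open>P\<close> before its last step and ends at \<open>P\<close> again, which its length
  forbids.\<close>

lemma run_between_attachments:
  assumes "folded \<rho>" "j \<in> K" "C \<in> cycles_of (edges \<rho> j)"
    and A: "{v \<in> C. attached \<rho> j v} = {P, Q}" and short: "\<And>b. b \<in> N j \<Longrightarrow> b < card C"
    and q: "Q = (succ_of (edges \<rho> j) ^^ q) P" "0 < q" "q < card C"
  shows "q \<in> N j"
proof -
  let ?f = "succ_of (edges \<rho> j)" and ?c = "card C"
  have sv: "single_valued (edges \<rho> j)" using assms(1,2) unfolding folded_def by blast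
  note cf = cycle_funpow[OF sv assms(3)]
  have PQ: "P \<in> C" "Q \<in> C" using A by blast+
  obtain P1 b i where r: "b \<in> N j" "i < b" "P1 \<in> C" "attached \<rho> j P1" "(?f ^^ i) P1 = P"
    "attached \<rho> j ((?f ^^ b) P1)"
    using run_on_cycle[OF assms(1-3) PQ(1)] by metis
  have b: "b < ?c" "0 < b" using short[OF r(1)] r(2) by auto
  have end_in: "(?f ^^ b) P1 \<in> {P, Q}" using cf(4)[OF r(3), of b] r(6) A by blast
  have no_fix: "(?f ^^ b) P1 \<noteq> P1"
    using cf(1)[OF r(3), of b 0] b by simp
  have "P1 \<in> {P, Q}" using A r(3,4) by blast
  then show ?thesis
  proof (cases "P1 = P")
    case True
    then have "(?f ^^ b) P = (?f ^^ q) P" using end_in no_fix q(1) by auto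
    then have "b mod ?c = q mod ?c" using cf(1)[OF PQ(1)] by blast
    then show ?thesis using b q(3) r(1) by simp
  next
    case False
    then have P1: "P1 = (?f ^^ q) P" using \<open>P1 \<in> {P, Q}\<close> q(1) by simp
    have "(?f ^^ (i + q)) P = (?f ^^ 0) P" using r(5) unfolding P1 by (simp add: funpow_add)
    then have 1: "(i + q) mod ?c = 0" using cf(1)[OF PQ(1), of "i + q" 0] by simp
    have "(?f ^^ b) P1 = P" using end_in no_fix False P1 q(1) by auto
    then have "(?f ^^ (b + q)) P = (?f ^^ 0) P" unfolding P1 by (simp add: funpow_add)
    then have 2: "(b + q) mod ?c = 0" using cf(1)[OF PQ(1), of "b + q" 0] by simp
    have "((b + q) - (i + q)) mod ?c = 0" using 1 2 by (meson dvd_diff_nat mod_0_imp_dvd dvd_imp_mod_0)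
    then show ?thesis using r(2) b by simp
  qed
qed

text \<open>If every run is shorter than the cycle, the two attached vertices cut it into two arcs,
  and each arc is a single run. This explains the sums \<open>a + b\<close> in
  \<open>N_set\<close>.\<close>

lemma attachments_2:
  assumes "folded \<rho>" "j \<in> K" "C \<in> cycles_of (edges \<rho> j)" "attachments \<rho> j C = 2"
  shows "(\<exists>b\<in>N j. card C \<le> b) \<or> (\<exists>a\<in>N j. \<exists>b\<in>N j. card C = a + b)"
proof (cases "\<exists>b\<in>N j. card C \<le> b")
  case False
  then have short: "\<And>b. b \<in> N j \<Longrightarrow> b < card C" by force
  let ?f = "succ_of (edges \<rho> j)" and ?c = "card C"
  have sv: "single_valued (edges \<rho> j)" using assms(1,2) unfolding folded_def by blast
  note cf = cycle_funpow[OF sv assms(3)]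
  obtain P Q where A: "{v \<in> C. attached \<rho> j v} = {P, Q}" "P \<noteq> Q"
    using assms(4) unfolding attachments_def by (auto simp: card_2_iff)
  have PQ: "P \<in> C" "Q \<in> C" using A by blast+
  obtain q where q: "q < ?c" "(?f ^^ q) P = Q" using cf(2)[OF PQ] by blast
  have q0: "0 < q" using q(2) A(2) by (cases q) auto
  have "(?f ^^ (?c - q)) Q = (?f ^^ (?c - q + q)) P" unfolding q(2)[symmetric] by (simp only: funpow_add comp_apply)
  also have "\<dots> = (?f ^^ 0) P" using cf(1)[OF PQ(1), of "?c - q + q" 0] q(1) by simp
  finally have prv: "P = (?f ^^ (?c - q)) Q" by simp
  have "q \<in> N j"
    by (rule run_between_attachments[OF assms(1-3) A(1) short q(2)[symmetric] q0 q(1)])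
  moreover have "?c - q \<in> N j"
  proof -
    have A': "{v \<in> C. attached \<rho> j v} = {Q, P}" unfolding A(1) by (rule insert_commute)
    have "0 < ?c - q" "?c - q < ?c" using q0 q(1) by simp_all
    with A' prv show ?thesis by (intro run_between_attachments[OF assms(1-3) A' short prv])
  qed
  moreover have "card C = q + (?c - q)" using q(1) by simp
  ultimately show ?thesis by blast
qed blast

section \<open>Quotients with two half-edges at every vertex\<close>

lemma half_edge_step:
  assumes "folded \<rho>" "t \<in> I" "t' \<in> I" "\<rho> t = \<rho> t'" "(col t, pos t) = (col t', pos t')"
  shows "\<rho> (s t) = \<rho> (s t')"
proof -
  let ?E = "edges \<rho> (col t)"
  have sv: "single_valued ?E" "single_valued (?E\<inverse>)"
    using assms(1) colK[OF assms(2)] unfolding folded_def by blast+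
  have "(\<rho> (src t), \<rho> (tgt t)) \<in> ?E" "(\<rho> (src t'), \<rho> (tgt t')) \<in> ?E"
    using edgeI[OF assms(2), of \<rho>] edgeI[OF assms(3), of \<rho>] assms(5) by simp_all
  then show ?thesis using assms(4,5) sv unfolding src_def tgt_def single_valued_def
    by (cases "pos t") auto
qed

lemma half_edge_step_opposite:
  assumes "folded \<rho>" "t \<in> I" "u \<in> I" "\<rho> t = \<rho> (s u)" "(col t, pos t) = (col u, \<not> pos u)"
  shows "\<rho> (s t) = \<rho> u"
proof -
  let ?E = "edges \<rho> (col t)"
  have sv: "single_valued ?E" "single_valued (?E\<inverse>)"
    using assms(1) colK[OF assms(2)] unfolding folded_def by blast+
  have "(\<rho> (src t), \<rho> (tgt t)) \<in> ?E" "(\<rho> (src u), \<rho> (tgt u)) \<in> ?E"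
    using edgeI[OF assms(2), of \<rho>] edgeI[OF assms(3), of \<rho>] assms(5) by simp_all
  then show ?thesis using assms(4,5) sv unfolding src_def tgt_def single_valued_def
    by (cases "pos t") auto
qed

lemma card_2_remaining:
  assumes "card H = 2" "a \<in> H" "b \<in> H" "c \<in> H" "a \<noteq> b" "a \<noteq> c"
  shows "b = c"
  using assms by (auto simp: card_2_iff)

text \<open>Where a vertex has only two half-edges, the one by which the trail enters determines the one by
  which it leaves.\<close>

lemma rigid:
  assumes fold: "folded \<rho>" and H: "\<And>v. v \<in> \<rho> ` I \<Longrightarrow> card (half_edges \<rho> v) = 2"
    and t: "t \<in> I" "u \<in> I" "\<rho> t = \<rho> (s u)"
  shows "(\<forall>q. \<rho> ((s ^^ q) t) = \<rho> ((s ^^ q) (s u)) \<and> col ((s ^^ q) t) = col ((s ^^ q) (s u)) \<and>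
            pos ((s ^^ q) t) = pos ((s ^^ q) (s u))) \<or>
         (\<forall>q u'. u' \<in> I \<longrightarrow> (s ^^ q) u' = u \<longrightarrow> col ((s ^^ q) t) = col u' \<and> pos ((s ^^ q) t) = (\<not> pos u'))"
proof -
  have Ht: "(col (s a), pos (s a)) = c" if "a \<in> I" "c \<in> half_edges \<rho> (\<rho> (s a))" "(col a, \<not> pos a) \<noteq> c" for a c
    using card_2_remaining[OF H[OF imageI[OF s_in[OF that(1)]]] in_half[OF that(1)] out_half[OF s_in[OF that(1)]] that(2)
        in_out_neq[OF that(1)] that(3)] .
  have out_t: "(col t, pos t) \<in> half_edges \<rho> (\<rho> (s u))" using out_half[OF t(1), of \<rho>] t(3) by simp
  \<comment> \<open>At the common vertex the walk from \<open>t\<close> has only two exits. It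
    either takes the one used by \<open>s u\<close>, and both walks agree from then on, or the one
    by which \<open>u\<close> came in, and it retraces the other walk backwards.\<close>
  show ?thesis
  proof (cases "(col u, \<not> pos u) = (col t, pos t)")
    case False
    then have eq: "(col (s u), pos (s u)) = (col t, pos t)" by (rule Ht[OF t(2) out_t])
    have "\<rho> ((s ^^ q) t) = \<rho> ((s ^^ q) (s u)) \<and>
       (col ((s ^^ q) t), pos ((s ^^ q) t)) = (col ((s ^^ q) (s u)), pos ((s ^^ q) (s u)))" for q
    proof (induction q)
      case 0
      then show ?case using t(3) eq by simp
    next
      case (Suc q)
      let ?a = "(s ^^ q) t" and ?b = "(s ^^ q) (s u)"
      have I: "?a \<in> I" "?b \<in> I" using s_pow_in t s_in by blast+
      have e: "(col ?a, pos ?a) = (col ?b, pos ?b)" and r: "\<rho> ?a = \<rho> ?b" using Suc.IH by blast+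
      have r': "\<rho> (s ?a) = \<rho> (s ?b)" by (rule half_edge_step[OF fold I r e])
      have "(col (s ?a), pos (s ?a)) = (col (s ?b), pos (s ?b))"
      proof (rule Ht[OF I(1)])
        show "(col (s ?b), pos (s ?b)) \<in> half_edges \<rho> (\<rho> (s ?a))"
          unfolding r' by (rule out_half[OF s_in[OF I(2)]])
        show "(col ?a, \<not> pos ?a) \<noteq> (col (s ?b), pos (s ?b))"
          using in_out_neq[OF I(2)] e by simp
      qed
      then show ?case using r' by simp
    qed
    then show ?thesis by blast
  next
    case True
    have "\<rho> ((s ^^ q) t) = \<rho> (s u') \<and> (col ((s ^^ q) t), pos ((s ^^ q) t)) = (col u', \<not> pos u')"
      if "u' \<in> I" "(s ^^ q) u' = u" for q u'
      using that
    proof (induction q arbitrary: u')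
      case 0
      then show ?case using True t(3) by auto
    next
      case (Suc q)
      let ?a = "(s ^^ q) t"
      have aI: "?a \<in> I" using s_pow_in t by blast
      have "(s ^^ q) (s u') = u" using Suc.prems(2) by (simp add: funpow_swap1)
      then have IH: "\<rho> ?a = \<rho> (s (s u'))" "(col ?a, pos ?a) = (col (s u'), \<not> pos (s u'))"
        using Suc.IH[OF s_in[OF Suc.prems(1)]] by blast+
      have r': "\<rho> (s ?a) = \<rho> (s u')"
        by (rule half_edge_step_opposite[OF fold aI s_in[OF Suc.prems(1)] IH])
      have "(col (s ?a), pos (s ?a)) = (col u', \<not> pos u')"
      proof (rule Ht[OF aI])
        show "(col u', \<not> pos u') \<in> half_edges \<rho> (\<rho> (s ?a))"
          unfolding r' by (rule in_half[OF Suc.prems(1)])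
        show "(col ?a, \<not> pos ?a) \<noteq> (col u', \<not> pos u')"
          using in_out_neq[OF Suc.prems(1)] IH(2) by auto
      qed
      then show ?case using r' by simp
    qed
    then show ?thesis by blast
  qed
qed

text \<open>A monochromatic path cannot outlast the run it starts in: the end of the run would have
  two half-edges of this colour and one of another. This supplies the bound \<open>D\<close> for
  \<open>card_embeddings_ge\<close>.\<close>

lemma path_length_le:
  assumes fold: "folded \<rho>" and H: "\<And>v. v \<in> \<rho> ` I \<Longrightarrow> card (half_edges \<rho> v) = 2" and j: "j \<in> K"
    and uv: "(u, v) \<in> edges \<rho> j ^^ d" and d: "0 < d"
  shows "\<exists>b\<in>N j. d \<le> b"
proof -
  let ?E = "edges \<rho> j"
  have sv: "single_valued ?E" using fold j unfolding folded_def by blast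
  obtain f where f: "f 0 = u" "f d = v" "\<And>m. m < d \<Longrightarrow> (f m, f (Suc m)) \<in> ?E"
    using uv unfolding relpow_fun_conv by blast
  obtain z b i where z: "b \<in> N j" "i < b" "z i = f 0" "\<And>k. k < b \<Longrightarrow> (z k, z (Suc k)) \<in> ?E"
    "attached \<rho> j (z b)"
    using run_cover[OF fold j f(3)[OF d]] by metis
  have follow: "f m = z (i + m)" if "i + m \<le> b" "m \<le> d" for m
    using that
  proof (induction m)
    case 0
    then show ?case using z(3) by simp
  next
    case (Suc m)
    have "(z (i + m), f (Suc m)) \<in> ?E" using f(3)[of m] Suc by simp
    moreover have "(z (i + m), z (Suc (i + m))) \<in> ?E" using z(4)[of "i + m"] Suc by simp
    ultimately show ?case using single_valuedD[OF sv] by fastforce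
  qed
  have "d \<le> b - i"
  proof (rule ccontr)
    assume neg: "\<not> d \<le> b - i"
    then have "f (b - i) = z b" using follow[of "b - i"] z(2) by simp
    then have out: "(z b, f (Suc (b - i))) \<in> ?E" using f(3)[of "b - i"] neg by simp
    have "(z (b - 1), z b) \<in> ?E" using z(4)[of "b - 1"] z(2) by simp
    then have 1: "(j, False) \<in> half_edges \<rho> (z b)" "(j, True) \<in> half_edges \<rho> (z b)" and zb: "z b \<in> \<rho> ` I"
      using out j edges_subset[of \<rho> j] unfolding half_edges_def by blast+
    obtain j' where j': "j' \<in> K" "j' \<noteq> j" "z b \<in> Field (edges \<rho> j')" using z(5) unfolding attached_def by blast
    then obtain c where c: "(j', c) \<in> half_edges \<rho> (z b)" unfolding half_edges_def Field_def by blast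
    show False using card_2_remaining[OF H[OF zb] 1(1) 1(2) c] j'(2) by simp
  qed
  then show ?thesis using z(1) by (intro bexI[of _ b]) auto
qed

text \<open>Two different times of one colour share a source or a target only if they are
  consecutive with opposite signs, which \<open>red\<close> excludes. So edges correspond to times,
  and there are as many as vertices.\<close>

lemma injective_folded:
  assumes inj: "inj_on \<rho> I"
  shows "folded \<rho>" "(\<Sum>j\<in>K. card (edges \<rho> j)) = card (\<rho> ` I)"
proof -
  have injs: "t = t'" if "t \<in> I" "t' \<in> I" "s t = s t'" for t t'
    using bij that unfolding bij_betw_def inj_on_def by blast
  have io: "src t \<in> I" "tgt t \<in> I" if "t \<in> I" for t
    using that s_in unfolding src_def tgt_def by auto
  have src: "t = t'" if t: "t \<in> I" "t' \<in> I" "col t = col t'" "src t = src t'" for t t'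
    using t red[of t] red[of t'] injs[of t t'] unfolding src_def by (auto split: if_splits)
  have tgt: "t = t'" if t: "t \<in> I" "t' \<in> I" "col t = col t'" "tgt t = tgt t'" for t t'
    using t red[of t] red[of t'] injs[of t t'] unfolding tgt_def by (auto split: if_splits)
  show "folded \<rho>"
    unfolding folded_def
  proof (intro ballI conjI)
    fix j
    show "single_valued (edges \<rho> j)"
    proof (rule single_valuedI)
      fix u v v' assume "(u, v) \<in> edges \<rho> j" "(u, v') \<in> edges \<rho> j"
      then obtain t t' where t: "t \<in> I" "col t = j" "u = \<rho> (src t)" "v = \<rho> (tgt t)"
        "t' \<in> I" "col t' = j" "u = \<rho> (src t')" "v' = \<rho> (tgt t')" unfolding edges_def by blast
      have "src t = src t'" using inj_onD[OF inj] io t by metis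
      then show "v = v'" using src[of t t'] t by simp
    qed
    show "single_valued ((edges \<rho> j)\<inverse>)"
    proof (rule single_valuedI)
      fix u v v' assume "(u, v) \<in> (edges \<rho> j)\<inverse>" "(u, v') \<in> (edges \<rho> j)\<inverse>"
      then obtain t t' where t: "t \<in> I" "col t = j" "v = \<rho> (src t)" "u = \<rho> (tgt t)"
        "t' \<in> I" "col t' = j" "v' = \<rho> (src t')" "u = \<rho> (tgt t')" unfolding edges_def by blast
      have "tgt t = tgt t'" using inj_onD[OF inj] io t by metis
      then show "v = v'" using tgt[of t t'] t by simp
    qed
  qed
  have "card (edges \<rho> j) = card {t \<in> I. col t = j}" for j
    unfolding edges_def
  proof (rule card_image, rule inj_onI)
    fix t t' assume t: "t \<in> {t \<in> I. col t = j}" "t' \<in> {t \<in> I. col t = j}"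
      "(\<rho> (src t), \<rho> (tgt t)) = (\<rho> (src t'), \<rho> (tgt t'))"
    then have "src t = src t'" using inj_onD[OF inj, of "src t" "src t'"] io by auto
    then show "t = t'" using src[of t t'] t by simp
  qed
  then have "(\<Sum>j\<in>K. card (edges \<rho> j)) = (\<Sum>j\<in>K. card {t \<in> I. col t = j})" by simp
  also have "\<dots> = card (\<Union>j\<in>K. {t \<in> I. col t = j})"
    using finI finK by (intro card_UN_disjoint[symmetric]) auto
  also have "(\<Union>j\<in>K. {t \<in> I. col t = j}) = I" using colK by blast
  finally show "(\<Sum>j\<in>K. card (edges \<rho> j)) = card (\<rho> ` I)" using card_image[OF inj] by simp
qed

text \<open>A monochromatic cycle has an attachment, and \<open>euler_bound\<close> then forces more
  edges than vertices.\<close>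

lemma no_cycles:
  assumes "folded \<rho>" "(\<Sum>j\<in>K. card (edges \<rho> j)) \<le> card (\<rho> ` I)" "j \<in> K"
  shows "cycles_of (edges \<rho> j) = {}"
proof (rule ccontr)
  assume "cycles_of (edges \<rho> j) \<noteq> {}"
  then obtain C where C: "C \<in> cycles_of (edges \<rho> j)" by blast
  have "1 \<le> attachments \<rho> j C" by (rule attachments_pos[OF assms(1,3) C])
  also have "\<dots> \<le> (\<Sum>C\<in>cycles_of (edges \<rho> j). attachments \<rho> j C)"
    using finite_cycles_of[OF partial_inj_edges[OF assms(1,3)]] C by (intro member_le_sum) auto
  also have "\<dots> \<le> (\<Sum>j\<in>K. \<Sum>C\<in>cycles_of (edges \<rho> j). attachments \<rho> j C)"
    using finK assms(3) by (intro member_le_sum[of j K "\<lambda>j. \<Sum>C\<in>cycles_of (edges \<rho> j). attachments \<rho> j C"]) auto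
  finally show False using euler_bound[OF assms(1)] assms(2) by simp
qed

end

section \<open>Expected number of embeddings of a trail\<close>

lemma extend_to_permutation:
  assumes "inj_on y I" "inj_on y' I" "y ` I \<subseteq> S" "y' ` I \<subseteq> S" "finite S"
  obtains p where "p permutes S" "\<And>t. t \<in> I \<Longrightarrow> p (y t) = y' t"
proof -
  define f where "f v = y' (inv_into I y v)" for v
  have f: "f (y t) = y' t" if "t \<in> I" for t unfolding f_def using assms(1) that by simp
  have bf: "bij_betw f (y ` I) (y' ` I)"
    unfolding bij_betw_def
  proof
    show "inj_on f (y ` I)" using f assms(2) by (auto simp: inj_on_def)
    show "f ` y ` I = y' ` I" using f by (auto simp: image_iff)
  qed
  have fin: "finite (y ` I)" "finite (y' ` I)" using assms finite_subset by blast+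
  have "card (S - y ` I) = card (S - y' ` I)"
    using card_Diff_subset[OF fin(1) assms(3)] card_Diff_subset[OF fin(2) assms(4)] bij_betw_same_card[OF bf] by simp
  then obtain g where g: "bij_betw g (S - y ` I) (S - y' ` I)"
    using finite_same_card_bij[of "S - y ` I" "S - y' ` I"] assms(5) by auto
  define p where "p v = (if v \<in> y ` I then f v else if v \<in> S then g v else v)" for v
  have "bij_betw p (y ` I) (y' ` I)"
    using bf by (subst bij_betw_cong[of _ _ f]) (auto simp: p_def)
  moreover have "bij_betw p (S - y ` I) (S - y' ` I)"
    using g by (subst bij_betw_cong[of _ _ g]) (auto simp: p_def)
  ultimately have "bij_betw p (y ` I \<union> (S - y ` I)) (y' ` I \<union> (S - y' ` I))"
    by (rule bij_betw_combine) auto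
  moreover have "y ` I \<union> (S - y ` I) = S" "y' ` I \<union> (S - y' ` I) = S" using assms by auto
  ultimately have "bij_betw p S S" by simp
  then have "p permutes S" using assms(3) by (intro bij_imp_permutes) (auto simp: p_def)
  then show ?thesis using that f by (auto simp: p_def)
qed

lemma finite_random_permutation:
  assumes "random_permutation n P" shows "finite (set_pmf P)"
proof (rule finite_subset)
  show "set_pmf P \<subseteq> {\<sigma>. \<sigma> permutes {1..n}}" using assms unfolding random_permutation_def by blast
  show "finite {\<sigma>. \<sigma> permutes {1..n}}" by (rule finite_permutations) simp
qed

context trail
begin

section \<open>Labellings grouped by their coincidences\<close>

definition kernel_class :: "('a \<Rightarrow> 'v) \<Rightarrow> nat \<Rightarrow> ('a \<Rightarrow> nat) set" where
  "kernel_class \<rho> n = {y \<in> I \<rightarrow>\<^sub>E {1..n}. \<forall>t\<in>I. \<forall>t'\<in>I. y t = y t' \<longleftrightarrow> \<rho> t = \<rho> t'}"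

definition obeys :: "('a \<Rightarrow> nat) \<Rightarrow> nat \<Rightarrow> (nat \<Rightarrow> nat) \<Rightarrow> bool" where
  "obeys y j \<sigma> \<longleftrightarrow> (\<forall>t\<in>I. col t = j \<longrightarrow> \<sigma> (y (src t)) = y (tgt t))"

lemma src_tgt_in: "t \<in> I \<Longrightarrow> src t \<in> I" "t \<in> I \<Longrightarrow> tgt t \<in> I"
  unfolding src_def tgt_def using s_in by auto

lemma finite_kernel_class: "finite (kernel_class \<rho> n)"
  unfolding kernel_class_def by (rule finite_subset[of _ "I \<rightarrow>\<^sub>E {1..n}"]) (auto intro: finite_PiE finI)

text \<open>A labelling with the coincidences of \<open>\<rho>\<close> is an injective labelling of
  the quotient. Conversely, the label of a vertex is read at any time above it;
  \<open>inv_into\<close> merely picks one.\<close>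

lemma bij_embeddings_kernel_class:
  "bij_betw (\<lambda>z. \<lambda>t\<in>I. z (\<rho> t)) (embeddings n (\<rho> ` I) E \<sigma>)
     {y \<in> kernel_class \<rho> n. \<forall>(u, v)\<in>E. \<sigma> ((\<lambda>v\<in>\<rho> ` I. y (inv_into I \<rho> v)) u) = (\<lambda>v\<in>\<rho> ` I. y (inv_into I \<rho> v)) v}"
  (is "bij_betw ?f ?A ?B")
proof (rule bij_betwI[where g = "\<lambda>y. \<lambda>v\<in>\<rho> ` I. y (inv_into I \<rho> v)"])
  let ?g = "\<lambda>y. \<lambda>v\<in>\<rho> ` I. y (inv_into I \<rho> v)"
  have inv: "inv_into I \<rho> v \<in> I" "\<rho> (inv_into I \<rho> v) = v" if "v \<in> \<rho> ` I" for v
    using that by (rule inv_into_into, rule f_inv_into_f)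
  have gf: "?g (?f z) = z" if "z \<in> extensional (\<rho> ` I)" for z :: "'b \<Rightarrow> nat"
  proof
    fix v
    show "?g (?f z) v = z v"
      using that inv[of v] by (cases "v \<in> \<rho> ` I") (auto simp: extensional_def)
  qed
  show "?g (?f z) = z" if "z \<in> ?A" for z
    using that by (intro gf) (auto simp: embeddings_def PiE_def)
  show "?f \<in> ?A \<rightarrow> ?B"
  proof
    fix z assume z: "z \<in> ?A"
    then have z': "z \<in> \<rho> ` I \<rightarrow>\<^sub>E {1..n}" "inj_on z (\<rho> ` I)" "\<forall>(u, v)\<in>E. \<sigma> (z u) = z v"
      unfolding embeddings_def by blast+
    have "z (\<rho> t) \<in> {1..n}" if "t \<in> I" for t using PiE_mem[OF z'(1) imageI[OF that]] .
    moreover have "z (\<rho> t) = z (\<rho> t') \<longleftrightarrow> \<rho> t = \<rho> t'" if "t \<in> I" "t' \<in> I" for t t'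
      using inj_on_eq_iff[OF z'(2)] that by blast
    ultimately have "?f z \<in> kernel_class \<rho> n" unfolding kernel_class_def by simp
    moreover have gz: "?g (?f z) = z" using z'(1) by (intro gf) (simp add: PiE_def)
    have "\<forall>(u, v)\<in>E. \<sigma> (?g (?f z) u) = ?g (?f z) v" unfolding gz by (rule z'(3))
    ultimately show "?f z \<in> ?B" by blast
  qed
  show fg: "?f (?g y) = y" if "y \<in> ?B" for y
  proof
    fix t
    have y: "y \<in> extensional I" "\<forall>t\<in>I. \<forall>t'\<in>I. y t = y t' \<longleftrightarrow> \<rho> t = \<rho> t'"
      using that unfolding kernel_class_def by (auto simp: PiE_def)
    show "?f (?g y) t = y t"
    proof (cases "t \<in> I")
      case True
      then show ?thesis using y(2) inv[OF imageI[OF True]] by auto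
    qed (use y(1) in \<open>simp add: extensional_def\<close>)
  qed
  show "?g \<in> ?B \<rightarrow> ?A"
  proof
    fix y assume y: "y \<in> ?B"
    then have y': "y \<in> I \<rightarrow>\<^sub>E {1..n}" "\<forall>t\<in>I. \<forall>t'\<in>I. y t = y t' \<longleftrightarrow> \<rho> t = \<rho> t'"
      unfolding kernel_class_def by blast+
    have "?g y \<in> \<rho> ` I \<rightarrow>\<^sub>E {1..n}"
      using PiE_mem[OF y'(1) inv(1)] by (intro restrict_PiE_iff[THEN iffD2] ballI) blast
    moreover have "inj_on (?g y) (\<rho> ` I)"
    proof (rule inj_onI)
      fix u v assume uv: "u \<in> \<rho> ` I" "v \<in> \<rho> ` I" "?g y u = ?g y v"
      then have "y (inv_into I \<rho> u) = y (inv_into I \<rho> v)" by simp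
      then show "u = v" using y'(2) inv uv(1,2) by metis
    qed
    ultimately show "?g y \<in> ?A" using y unfolding embeddings_def by blast
  qed
qed

lemma obeys_iff:
  assumes "y \<in> kernel_class \<rho> n"
  shows "(\<forall>(u, v)\<in>edges \<rho> j. \<sigma> ((\<lambda>v\<in>\<rho> ` I. y (inv_into I \<rho> v)) u) = (\<lambda>v\<in>\<rho> ` I. y (inv_into I \<rho> v)) v)
     \<longleftrightarrow> obeys y j \<sigma>"
proof -
  have "(\<lambda>v\<in>\<rho> ` I. y (inv_into I \<rho> v)) (\<rho> t) = y t" if "t \<in> I" for t
    using assms that f_inv_into_f[OF imageI[OF that], of \<rho>] inv_into_into[OF imageI[OF that], of \<rho>]
    unfolding kernel_class_def by auto
  then show ?thesis
    unfolding edges_def obeys_def using src_tgt_in by auto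
qed

lemma card_obeys:
  "card {y \<in> kernel_class \<rho> n. obeys y j \<sigma>} = card (embeddings n (\<rho> ` I) (edges \<rho> j) \<sigma>)"
proof -
  have "{y \<in> kernel_class \<rho> n. obeys y j \<sigma>} = {y \<in> kernel_class \<rho> n. \<forall>(u, v)\<in>edges \<rho> j.
      \<sigma> ((\<lambda>v\<in>\<rho> ` I. y (inv_into I \<rho> v)) u) = (\<lambda>v\<in>\<rho> ` I. y (inv_into I \<rho> v)) v}"
    using obeys_iff by blast
  then show ?thesis using bij_betw_same_card[OF bij_embeddings_kernel_class[of \<rho> n "edges \<rho> j" \<sigma>]] by simp
qed

lemma card_kernel_class: "card (kernel_class \<rho> n) = card (embeddings n (\<rho> ` I) {} \<sigma>)"
  using bij_betw_same_card[OF bij_embeddings_kernel_class[of \<rho> n "{}" \<sigma>]] by simp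

text \<open>Permutations are single-valued and injective, so a labelling they realise identifies the
  targets of equal sources and the sources of equal targets. Quotients that are not folded thus
  contribute nothing.\<close>

lemma obeys_not_folded:
  assumes y: "y \<in> kernel_class \<rho> n" and \<sigma>: "\<And>j. j \<in> K \<Longrightarrow> \<sigma> j permutes {1..n}" "\<And>j. j \<in> K \<Longrightarrow> obeys y j (\<sigma> j)"
  shows "folded \<rho>"
  unfolding folded_def
proof (intro ballI conjI)
  have ker: "y t = y t' \<longleftrightarrow> \<rho> t = \<rho> t'" if "t \<in> I" "t' \<in> I" for t t'
    using y that unfolding kernel_class_def by blast
  fix j assume j: "j \<in> K"
  have ob: "\<sigma> j (y (src t)) = y (tgt t)" if "t \<in> I" "col t = j" for t
    using \<sigma>(2)[OF j] that unfolding obeys_def by blast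
  show "single_valued (edges \<rho> j)"
  proof (rule single_valuedI)
    fix u v v' assume "(u, v) \<in> edges \<rho> j" "(u, v') \<in> edges \<rho> j"
    then obtain t t' where t: "t \<in> I" "col t = j" "u = \<rho> (src t)" "v = \<rho> (tgt t)"
      "t' \<in> I" "col t' = j" "u = \<rho> (src t')" "v' = \<rho> (tgt t')" unfolding edges_def by blast
    have "y (src t) = y (src t')" using ker src_tgt_in t by metis
    then have "y (tgt t) = y (tgt t')" using ob t by metis
    then show "v = v'" using ker src_tgt_in t by metis
  qed
  show "single_valued ((edges \<rho> j)\<inverse>)"
  proof (rule single_valuedI)
    fix u v v' assume "(u, v) \<in> (edges \<rho> j)\<inverse>" "(u, v') \<in> (edges \<rho> j)\<inverse>"
    then obtain t t' where t: "t \<in> I" "col t = j" "v = \<rho> (src t)" "u = \<rho> (tgt t)"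
      "t' \<in> I" "col t' = j" "v' = \<rho> (src t')" "u = \<rho> (tgt t')" unfolding edges_def by blast
    have "y (tgt t) = y (tgt t')" using ker src_tgt_in t by metis
    then have "y (src t) = y (src t')" using ob t permutes_inj[OF \<sigma>(1)[OF j]] by (metis injD)
    then show "v = v'" using ker src_tgt_in t by metis
  qed
qed

text \<open>Two labellings with the same coincidences differ by a permutation of
  \<open>{1..n}\<close>, and conjugating by it leaves the law unchanged.\<close>

lemma prob_obeys_eq:
  assumes P: "conjugation_invariant n P" and y: "y \<in> kernel_class \<rho> n" "y' \<in> kernel_class \<rho> n"
  shows "measure_pmf.prob P {\<sigma>. obeys y j \<sigma>} = measure_pmf.prob P {\<sigma>. obeys y' j \<sigma>}"
proof -
  \<comment> \<open>A transversal of the coincidences: on it both labellings are injective, as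
    extending their correspondence to a permutation requires.\<close>
  define R where "R = (\<lambda>v. SOME t. t \<in> I \<and> \<rho> t = v) ` \<rho> ` I"
  have R: "R \<subseteq> I" "\<And>t. t \<in> I \<Longrightarrow> \<exists>r\<in>R. \<rho> r = \<rho> t" "inj_on \<rho> R"
  proof -
    have some: "(SOME t. t \<in> I \<and> \<rho> t = v) \<in> I \<and> \<rho> (SOME t. t \<in> I \<and> \<rho> t = v) = v" if "v \<in> \<rho> ` I" for v
      using that by (intro someI_ex[of "\<lambda>t. t \<in> I \<and> \<rho> t = v"]) blast
    show "R \<subseteq> I" unfolding R_def using some by blast
    show "\<exists>r\<in>R. \<rho> r = \<rho> t" if "t \<in> I" for t unfolding R_def using some[of "\<rho> t"] that by blast
    show "inj_on \<rho> R" unfolding R_def by (rule inj_onI) (use some in auto)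
  qed
  have ker: "(y t = y t' \<longleftrightarrow> \<rho> t = \<rho> t') \<and> (y' t = y' t' \<longleftrightarrow> \<rho> t = \<rho> t')" if "t \<in> I" "t' \<in> I" for t t'
    using y that unfolding kernel_class_def by blast
  have in_n: "y ` R \<subseteq> {1..n}" "y' ` R \<subseteq> {1..n}" using y R(1) unfolding kernel_class_def by (auto simp: PiE_iff)
  have injy: "inj_on y R" "inj_on y' R" using ker R(1,3) unfolding inj_on_def by blast+
  obtain p where p: "p permutes {1..n}" "\<And>t. t \<in> R \<Longrightarrow> p (y t) = y' t"
    using extend_to_permutation[OF injy in_n] by blast
  have py: "p (y t) = y' t" if t: "t \<in> I" for t
  proof -
    obtain r where r: "r \<in> R" "\<rho> r = \<rho> t" using R(2)[OF t] by blast
    then have "y r = y t" "y' r = y' t" using ker[of r t] R(1) t by blast+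
    then show ?thesis using p(2)[OF r(1)] by simp
  qed
  have "obeys y j (inv_into UNIV p \<circ> \<sigma> \<circ> p) \<longleftrightarrow> obeys y' j \<sigma>" for \<sigma>
  proof -
    have "inv_into UNIV p (\<sigma> (p (y (src t)))) = y (tgt t) \<longleftrightarrow> \<sigma> (y' (src t)) = y' (tgt t)" if "t \<in> I" for t
      using py src_tgt_in[OF that] permutes_inverses[OF p(1)] by metis
    then show ?thesis unfolding obeys_def by auto
  qed
  then have "measure_pmf.prob P {\<sigma>. obeys y' j \<sigma>} =
      measure_pmf.prob (map_pmf (\<lambda>\<sigma>. inv_into UNIV p \<circ> \<sigma> \<circ> p) P) {\<sigma>. obeys y j \<sigma>}"
    by (simp add: vimage_def)
  also have "map_pmf (\<lambda>\<sigma>. inv_into UNIV p \<circ> \<sigma> \<circ> p) P = P"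
    using P p(1) unfolding conjugation_invariant_def by blast
  finally show ?thesis by simp
qed

lemma expectation_card_obeys:
  assumes "random_permutation n P" and fin: "finite S"
  shows "measure_pmf.expectation P (\<lambda>\<sigma>. real (card {y \<in> S. obeys y j \<sigma>})) =
     (\<Sum>y\<in>S. measure_pmf.prob P {\<sigma>. obeys y j \<sigma>})"
proof -
  have "real (card {y \<in> S. obeys y j \<sigma>}) = (\<Sum>y\<in>S. indicator {\<sigma>. obeys y j \<sigma>} \<sigma>)" for \<sigma>
    using sum.inter_filter[OF fin, of "\<lambda>_. 1::real" "\<lambda>y. obeys y j \<sigma>"] by (simp add: indicator_def of_bool_def)
  then show ?thesis
    by (simp add: integrable_measure_pmf_finite[OF finite_random_permutation[OF assms(1)]])
qed

definition class_expectation ::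
    "nat \<Rightarrow> (nat \<Rightarrow> nat \<Rightarrow> nat) pmf \<Rightarrow> ('a \<Rightarrow> 'v) \<Rightarrow> real" where
  "class_expectation n Q \<rho> = (\<Sum>y\<in>kernel_class \<rho> n. measure_pmf.prob Q {\<tau>. \<forall>j\<in>K. obeys y j (\<tau> j)})"

text \<open>For each colour all labellings of the class are equally likely to be obeyed, so this
  probability is the expected number of embeddings over the size of the class. Independence
  multiplies over the colours.\<close>

lemma class_expectation_eq:
  assumes indep: "\<And>A. measure_pmf.prob Q {\<tau>. \<forall>j\<in>K. \<tau> j \<in> A j} = (\<Prod>j\<in>K. measure_pmf.prob (marginal j Q) (A j))"
    and M: "\<And>j. j \<in> K \<Longrightarrow> random_permutation n (marginal j Q)" "\<And>j. j \<in> K \<Longrightarrow> conjugation_invariant n (marginal j Q)"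
  shows "class_expectation n Q \<rho> = real (card (kernel_class \<rho> n)) *
     (\<Prod>j\<in>K. measure_pmf.expectation (marginal j Q) (\<lambda>\<sigma>. real (card (embeddings n (\<rho> ` I) (edges \<rho> j) \<sigma>)))
        / real (card (kernel_class \<rho> n)))"
proof (cases "kernel_class \<rho> n = {}")
  case True
  then show ?thesis by (simp add: class_expectation_def)
next
  case False
  then obtain y0 where y0: "y0 \<in> kernel_class \<rho> n" by blast
  let ?N = "real (card (kernel_class \<rho> n))"
  have N: "?N > 0" using False finite_kernel_class[of \<rho> n] by (simp add: card_gt_0_iff)
  have p: "measure_pmf.prob (marginal j Q) {\<sigma>. obeys y j \<sigma>} =
     measure_pmf.expectation (marginal j Q) (\<lambda>\<sigma>. real (card (embeddings n (\<rho> ` I) (edges \<rho> j) \<sigma>))) / ?N"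
    if "j \<in> K" "y \<in> kernel_class \<rho> n" for j y
  proof -
    have "measure_pmf.expectation (marginal j Q) (\<lambda>\<sigma>. real (card (embeddings n (\<rho> ` I) (edges \<rho> j) \<sigma>)))
       = (\<Sum>y\<in>kernel_class \<rho> n. measure_pmf.prob (marginal j Q) {\<sigma>. obeys y j \<sigma>})"
      unfolding card_obeys[symmetric] by (rule expectation_card_obeys[OF M(1)[OF that(1)] finite_kernel_class])
    also have "\<dots> = (\<Sum>y'\<in>kernel_class \<rho> n. measure_pmf.prob (marginal j Q) {\<sigma>. obeys y j \<sigma>})"
      by (intro sum.cong refl prob_obeys_eq[OF M(2)[OF that(1)] _ that(2)])
    finally show ?thesis using N by (simp add: field_simps)
  qed
  have "class_expectation n Q \<rho> = (\<Sum>y\<in>kernel_class \<rho> n. \<Prod>j\<in>K. measure_pmf.prob (marginal j Q) {\<sigma>. obeys y j \<sigma>})"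
    unfolding class_expectation_def using indep[of "\<lambda>j. {\<sigma>. obeys y j \<sigma>}" for y] by simp
  also have "\<dots> = (\<Sum>y\<in>kernel_class \<rho> n. \<Prod>j\<in>K.
     measure_pmf.expectation (marginal j Q) (\<lambda>\<sigma>. real (card (embeddings n (\<rho> ` I) (edges \<rho> j) \<sigma>))) / ?N)"
    by (intro sum.cong prod.cong refl p)
  finally show ?thesis by simp
qed

lemma class_expectation_not_folded:
  assumes "\<not> folded \<rho>" and M: "\<And>j. j \<in> K \<Longrightarrow> random_permutation n (marginal j Q)"
  shows "class_expectation n Q \<rho> = 0"
proof -
  have "measure_pmf.prob Q {\<tau>. \<forall>j\<in>K. obeys y j (\<tau> j)} = 0" if y: "y \<in> kernel_class \<rho> n" for y
  proof -
    have "\<not> (\<forall>j\<in>K. obeys y j (\<tau> j))" if \<tau>: "\<tau> \<in> set_pmf Q" for \<tau>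
    proof
      assume ob: "\<forall>j\<in>K. obeys y j (\<tau> j)"
      have "\<tau> j permutes {1..n}" if "j \<in> K" for j
        using M[OF that] \<tau> unfolding random_permutation_def marginal_def by auto
      then have "folded \<rho>" using obeys_not_folded[OF y, of \<tau>] ob by blast
      then show False using assms(1) by simp
    qed
    then show ?thesis by (auto simp: measure_pmf_zero_iff)
  qed
  then show ?thesis unfolding class_expectation_def by simp
qed

end

section \<open>Contributions of short cycles\<close>

text \<open>A factor with exponent at least 2 is bounded by 1, since at most \<open>n\<close> points
  are counted, and may be dropped. If exponent 1 occurs, exactly those factors are kept, and (i)
  applies with as many indices as there are such cycles. Otherwise one factor is kept: it vanishes
  by (ii) for exponent 2, and is at most \<open>h n\<close> for a larger one.\<close>

lemma cycle_product_limit: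
  fixes c t :: "'c \<Rightarrow> nat"
  assumes few: "few_short_cycles_strong S1 S2 P" and perm: "\<And>n. 1 \<le> n \<Longrightarrow> random_permutation n (P n)"
    and fin: "finite \<C>" "\<C> \<noteq> {}" and t: "\<And>C. C \<in> \<C> \<Longrightarrow> 1 \<le> t C"
    and t1: "\<And>C. C \<in> \<C> \<Longrightarrow> t C = 1 \<Longrightarrow> c C \<in> S1" and t2: "\<And>C. C \<in> \<C> \<Longrightarrow> t C = 2 \<Longrightarrow> c C \<in> S2"
  shows "(\<lambda>n. measure_pmf.expectation (P n)
     (\<lambda>\<sigma>. \<Prod>C\<in>\<C>. real (card {x \<in> {1..n}. card (orbit \<sigma> x) = c C}) * (1 / sqrt (real n)) ^ t C)) \<longlonglongrightarrow> 0"
proof -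
  define h where "h n = 1 / sqrt (real n)" for n
  define m where "m n C \<sigma> = real (card {x \<in> {1..n}. card (orbit \<sigma> x) = c C})" for n :: nat and C \<sigma>
  have h: "0 \<le> h n" "h n \<le> 1" "real n * h n ^ 2 = 1" if "1 \<le> n" for n
    using that unfolding h_def by (auto simp: power_divide)
  have h0: "h \<longlonglongrightarrow> 0"
    using tendsto_real_sqrt[OF lim_1_over_n] unfolding h_def real_sqrt_divide by simp
  have permD: "\<sigma> permutes {1..n}" if "1 \<le> n" "\<sigma> \<in> set_pmf (P n)" for n \<sigma>
    using perm[OF that(1)] that(2) unfolding random_permutation_def by blast
  have m_eq: "m n C \<sigma> = real (c C) * real (num_cycles n (c C) \<sigma>)" if "1 \<le> n" "\<sigma> \<in> set_pmf (P n)" for n C \<sigma>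
    unfolding m_def card_points_of_cycles[OF permD[OF that]] by simp
  have m_le: "m n C \<sigma> \<le> real n" for n C \<sigma>
  proof -
    have "card {x \<in> {1..n}. card (orbit \<sigma> x) = c C} \<le> card {1..n}" by (rule card_mono) auto
    then show ?thesis unfolding m_def by simp
  qed
  have m0: "0 \<le> m n C \<sigma>" for n C \<sigma> unfolding m_def by simp
  have int: "integrable (measure_pmf (P n)) f" if "1 \<le> n" for n and f :: "_ \<Rightarrow> real"
    by (rule integrable_measure_pmf_finite[OF finite_random_permutation[OF perm[OF that]]])
  have fac: "m n C \<sigma> * h n ^ k \<le> 1" if "1 \<le> n" "2 \<le> k" for n C \<sigma> k
  proof -
    have "m n C \<sigma> * h n ^ k \<le> real n * h n ^ 2"
      using that h[OF that(1)] m_le by (intro mult_mono power_decreasing) auto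
    then show ?thesis using h(3)[OF that(1)] by simp
  qed
  let ?E = "\<lambda>n. measure_pmf.expectation (P n) (\<lambda>\<sigma>. \<Prod>C\<in>\<C>. m n C \<sigma> * h n ^ t C)"
  have E0: "0 \<le> ?E n" if "1 \<le> n" for n
    by (intro integral_nonneg_AE AE_pmfI prod_nonneg) (use m0 h(1)[OF that] in auto)
  have bound: "?E n \<le> measure_pmf.expectation (P n) (\<lambda>\<sigma>. \<Prod>C\<in>A. m n C \<sigma> * h n ^ t C)"
    if n: "1 \<le> n" and A: "A \<subseteq> \<C>" "\<And>C. C \<in> \<C> - A \<Longrightarrow> 2 \<le> t C" for n A
  proof (rule integral_mono[OF int[OF n] int[OF n]])
    fix \<sigma>
    have "(\<Prod>C\<in>\<C>. m n C \<sigma> * h n ^ t C) = (\<Prod>C\<in>\<C> - A. m n C \<sigma> * h n ^ t C) * (\<Prod>C\<in>A. m n C \<sigma> * h n ^ t C)"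
      by (rule prod.subset_diff[OF A(1) fin(1)])
    also have "\<dots> \<le> 1 * (\<Prod>C\<in>A. m n C \<sigma> * h n ^ t C)"
    proof (rule mult_right_mono)
      show "(\<Prod>C\<in>\<C> - A. m n C \<sigma> * h n ^ t C) \<le> 1"
        by (rule prod_le_1) (use m0 h(1)[OF n] fac[OF n A(2)] in auto)
      show "0 \<le> (\<Prod>C\<in>A. m n C \<sigma> * h n ^ t C)"
        by (rule prod_nonneg) (use m0 h(1)[OF n] in auto)
    qed
    finally show "(\<Prod>C\<in>\<C>. m n C \<sigma> * h n ^ t C) \<le> (\<Prod>C\<in>A. m n C \<sigma> * h n ^ t C)" by simp
  qed
  have "?E \<longlonglongrightarrow> 0"
  proof (cases "\<exists>C\<in>\<C>. t C = 1")
    case True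
    define A where "A = {C \<in> \<C>. t C = 1}"
    have A: "A \<subseteq> \<C>" "finite A" "A \<noteq> {}" "\<And>C. C \<in> \<C> - A \<Longrightarrow> 2 \<le> t C"
    proof -
      show "A \<subseteq> \<C>" "A \<noteq> {}" using True unfolding A_def by blast+
      then show "finite A" using fin(1) finite_subset by blast
      show "2 \<le> t C" if "C \<in> \<C> - A" for C using t[of C] that unfolding A_def by auto
    qed
    obtain e where e: "bij_betw e {1..card A} A" using ex_bij_betw_nat_finite_1[OF A(2)] by blast
    have p: "1 \<le> card A" using A(2,3) by (simp add: Suc_le_eq card_gt_0_iff)
    have "c (e i) \<in> S1" if "i \<in> {1..card A}" for i
      using bij_betwE[OF e] that t1 unfolding A_def by blast
    then have lim: "(\<lambda>n. measure_pmf.expectation (P n)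
        (\<lambda>\<sigma>. \<Prod>i=1..card A. real (num_cycles n (c (e i)) \<sigma>) / sqrt (real n))) \<longlonglongrightarrow> 0"
      using few[unfolded few_short_cycles_strong_def, THEN conjunct1, rule_format, OF p, of "\<lambda>i. c (e i)"] by simp
    have eq: "measure_pmf.expectation (P n) (\<lambda>\<sigma>. \<Prod>C\<in>A. m n C \<sigma> * h n ^ t C) = (\<Prod>C\<in>A. real (c C)) *
       measure_pmf.expectation (P n) (\<lambda>\<sigma>. \<Prod>i=1..card A. real (num_cycles n (c (e i)) \<sigma>) / sqrt (real n))"
      if n: "1 \<le> n" for n
    proof -
      have "(\<Prod>C\<in>A. m n C \<sigma> * h n ^ t C) = (\<Prod>C\<in>A. real (c C)) *
          (\<Prod>i=1..card A. real (num_cycles n (c (e i)) \<sigma>) / sqrt (real n))" if "\<sigma> \<in> set_pmf (P n)" for \<sigma>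
      proof -
        have "(\<Prod>C\<in>A. m n C \<sigma> * h n ^ t C) = (\<Prod>C\<in>A. real (c C) * (real (num_cycles n (c C) \<sigma>) / sqrt (real n)))"
          by (rule prod.cong) (auto simp: A_def m_eq[OF n that] h_def)
        then show ?thesis
          unfolding prod.distrib
          using prod.reindex_bij_betw[OF e, of "\<lambda>C. real (num_cycles n (c C) \<sigma>) / sqrt (real n)"] by simp
      qed
      then have "measure_pmf.expectation (P n) (\<lambda>\<sigma>. \<Prod>C\<in>A. m n C \<sigma> * h n ^ t C) =
         measure_pmf.expectation (P n) (\<lambda>\<sigma>. (\<Prod>C\<in>A. real (c C)) *
          (\<Prod>i=1..card A. real (num_cycles n (c (e i)) \<sigma>) / sqrt (real n)))"
        by (intro integral_cong_AE AE_pmfI) auto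
      then show ?thesis by simp
    qed
    have "(\<lambda>n. (\<Prod>C\<in>A. real (c C)) *
       measure_pmf.expectation (P n) (\<lambda>\<sigma>. \<Prod>i=1..card A. real (num_cycles n (c (e i)) \<sigma>) / sqrt (real n))) \<longlonglongrightarrow> 0"
      using lim by (rule tendsto_mult_right_zero)
    then show ?thesis
    proof (rule tendsto_sandwich[OF _ _ tendsto_const, rotated 2])
      show "\<forall>\<^sub>F n in sequentially. 0 \<le> ?E n"
        using eventually_ge_at_top[of 1] by eventually_elim (rule E0)
      show "\<forall>\<^sub>F n in sequentially. ?E n \<le> (\<Prod>C\<in>A. real (c C)) *
         measure_pmf.expectation (P n) (\<lambda>\<sigma>. \<Prod>i=1..card A. real (num_cycles n (c (e i)) \<sigma>) / sqrt (real n))"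
        using eventually_ge_at_top[of 1]
      proof eventually_elim
        case (elim n)
        show ?case using bound[OF elim A(1,4)] unfolding eq[OF elim] by simp
      qed
    qed
  next
    case False
    then have t2': "2 \<le> t C" if "C \<in> \<C>" for C using t[OF that] that by (cases "t C = 1") auto
    obtain C where C: "C \<in> \<C>" using fin(2) by blast
    have b: "?E n \<le> measure_pmf.expectation (P n) (\<lambda>\<sigma>. m n C \<sigma> * h n ^ t C)" if "1 \<le> n" for n
      using bound[OF that, of "{C}"] C t2' by simp
    have "(\<lambda>n. if t C = 2 then real (c C) * measure_pmf.expectation (P n) (\<lambda>\<sigma>. real (num_cycles n (c C) \<sigma>) / real n)
        else h n) \<longlonglongrightarrow> 0"
    proof (cases "t C = 2")
      case True
      have "(\<lambda>n. measure_pmf.expectation (P n) (\<lambda>\<sigma>. real (num_cycles n (c C) \<sigma>) / real n)) \<longlonglongrightarrow> 0"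
        using few t2[OF C True] unfolding few_short_cycles_strong_def by blast
      then show ?thesis using True by (simp add: tendsto_mult_right_zero del: Bochner_Integration.integral_divide_zero)
    qed (use h0 in simp)
    then show ?thesis
    proof (rule tendsto_sandwich[OF _ _ tendsto_const, rotated 2])
      show "\<forall>\<^sub>F n in sequentially. 0 \<le> ?E n"
        using eventually_ge_at_top[of 1] by eventually_elim (rule E0)
      show "\<forall>\<^sub>F n in sequentially. ?E n \<le> (if t C = 2 then real (c C) *
         measure_pmf.expectation (P n) (\<lambda>\<sigma>. real (num_cycles n (c C) \<sigma>) / real n) else h n)"
        using eventually_ge_at_top[of 1]
      proof eventually_elim
        case (elim n)
        show ?case
        proof (cases "t C = 2")
          case True
          have h2: "h n ^ 2 = 1 / real n" using elim by (simp add: h_def power_divide)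
          have "measure_pmf.expectation (P n) (\<lambda>\<sigma>. m n C \<sigma> * h n ^ t C) =
             measure_pmf.expectation (P n) (\<lambda>\<sigma>. real (c C) * (real (num_cycles n (c C) \<sigma>) / real n))"
            unfolding True h2 by (intro integral_cong_AE AE_pmfI) (auto simp: m_eq[OF elim])
          then show ?thesis using b[OF elim] True by simp
        next
          case False
          then have t3: "3 \<le> t C" using t2'[OF C] by simp
          have "measure_pmf.expectation (P n) (\<lambda>\<sigma>. m n C \<sigma> * h n ^ t C) \<le> measure_pmf.expectation (P n) (\<lambda>\<sigma>. h n)"
          proof (rule integral_mono[OF int[OF elim] int[OF elim]])
            fix \<sigma>
            have "m n C \<sigma> * h n ^ t C = (m n C \<sigma> * h n ^ (t C - 1)) * h n"
              using t3 by (cases "t C") simp_all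
            also have "\<dots> \<le> 1 * h n"
              using t3 h(1)[OF elim] by (intro mult_right_mono fac[OF elim]) auto
            finally show "m n C \<sigma> * h n ^ t C \<le> h n" by simp
          qed
          then show ?thesis using b[OF elim] False by simp
        qed
      qed
    qed
  qed
  then show ?thesis unfolding m_def h_def .
qed

lemma few_short_points_limit:
  assumes few: "few_short_cycles_strong S1 S2 P" and perm: "\<And>n. 1 \<le> n \<Longrightarrow> random_permutation n (P n)"
    and c: "c \<in> S2"
  shows "(\<lambda>n. measure_pmf.expectation (P n) (\<lambda>\<sigma>. real (card {x \<in> {1..n}. card (orbit \<sigma> x) = c}) / real n)) \<longlonglongrightarrow> 0"
proof -
  \<comment> \<open>A family with one member and exponent 2, because
    \<open>(1 / sqrt (real n)) ^ 2\<close> is the wanted factor \<open>1 / n\<close>.\<close>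
  have "(\<lambda>n. measure_pmf.expectation (P n)
     (\<lambda>\<sigma>. \<Prod>C\<in>{()}. real (card {x \<in> {1..n}. card (orbit \<sigma> x) = c}) * (1 / sqrt (real n)) ^ 2)) \<longlonglongrightarrow> 0"
    by (rule cycle_product_limit[OF few perm]) (use c in auto)
  then show ?thesis by (simp add: power_divide)
qed

section \<open>Limits for trails\<close>

lemma acyclic_root_pos:
  assumes "partial_inj W E" "cycle_verts E = {}" "W \<noteq> {}"
  shows "0 < card W - card E"
proof -
  obtain v where "v \<in> W" using assms(3) by blast
  then obtain b where "b \<in> W - Range E" using root_or_cycle[OF assms(1)] assms(2) by blast
  moreover have "finite (W - Range E)" using assms(1) unfolding partial_inj_def by simp
  ultimately have "0 < card (W - Range E)" by (auto simp: card_gt_0_iff)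
  then show ?thesis unfolding card_roots(1)[OF assms(1)] .
qed

lemma embeddings_ratio_le_1:
  assumes "partial_inj W E" "cycles_of E = {}" "1 \<le> n"
  shows "real (card (embeddings n W E \<sigma>)) / real n ^ (card W - card E) \<le> 1"
proof -
  have "real (card (embeddings n W E \<sigma>)) \<le> real (n ^ (card W - card E))"
    using card_embeddings_le[OF assms(1), of n \<sigma>] assms(2) by (simp only: of_nat_le_iff) simp
  then show ?thesis using assms(3) by (simp add: divide_le_eq_1)
qed

lemma embeddings_ratio_ge:
  assumes pi: "partial_inj W E" and cyc: "cycles_of E = {}" and n: "1 \<le> n"
    and D: "\<And>u v d. (u, v) \<in> E ^^ d \<Longrightarrow> d \<le> D" and \<sigma>: "\<sigma> permutes {1..n}"
  shows "1 - (real (card W))\<^sup>2 * (1 / real n + (\<Sum>c=1..D. real (card {x \<in> {1..n}. card (orbit \<sigma> x) = c}) / real n))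
    \<le> real (card (embeddings n W E \<sigma>)) / real n ^ (card W - card E)"
proof -
  let ?q = "card W - card E" and ?X = "card (embeddings n W E \<sigma>)"
  let ?S = "1 + (\<Sum>c=1..D. card {x \<in> {1..n}. card (orbit \<sigma> x) = c})"
  have acyc: "cycle_verts E = {}" using cyc unfolding cycles_of_def by simp
  have npos: "0 < real n ^ ?q" using n by simp
  have "real (n ^ ?q) \<le> real (?X + (card W)\<^sup>2 * (n ^ (?q - 1) * ?S))"
    unfolding of_nat_le_iff by (rule card_embeddings_ge[OF pi acyc D \<sigma>])
  then have 1: "real n ^ ?q \<le> real ?X + (real (card W))\<^sup>2 * (real n ^ (?q - 1) * real ?S)"
    by (simp only: of_nat_add of_nat_mult of_nat_power)
  have 2: "(real (card W))\<^sup>2 * (real n ^ (?q - 1) * real ?S) = real n ^ ?q * ((real (card W))\<^sup>2 * (real ?S / real n))"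
  proof (cases "W = {}")
    case False
    \<comment> \<open>A nonempty acyclic colour class has a root, so the exponent
      \<open>?q - 1\<close> is a genuine predecessor.\<close>
    have "0 < ?q" by (rule acyclic_root_pos[OF pi acyc False])
    then have "real n ^ ?q = real n * real n ^ (?q - 1)" by (cases ?q) simp_all
    then show ?thesis using n by simp
  qed simp
  have 3: "real ?S / real n = 1 / real n + (\<Sum>c=1..D. real (card {x \<in> {1..n}. card (orbit \<sigma> x) = c}) / real n)"
    by (simp add: add_divide_distrib sum_divide_distrib)
  have "real n ^ ?q * (1 - (real (card W))\<^sup>2 * (real ?S / real n)) \<le> real ?X"
    using 1 unfolding 2 by (simp add: right_diff_distrib)
  then have "1 - (real (card W))\<^sup>2 * (real ?S / real n) \<le> real ?X / real n ^ ?q"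
    using npos by (simp add: pos_le_divide_eq mult.commute)
  then show ?thesis unfolding 3 .
qed

text \<open>The assumptions on \<open>S1\<close> and \<open>S2\<close> list the lengths that
  \<open>attachments_1\<close> and \<open>attachments_2\<close> can produce, as well as those of
  short paths. The sets stay separate from \<open>N\<close>, since the walk reads
  \<open>\<Omega>\<close> while the hypotheses concern the exponents of \<open>w\<close>.\<close>

locale random_trail = trail I s col pos K N
  for I :: "'a set" and s :: "'a \<Rightarrow> 'a" and col :: "'a \<Rightarrow> nat" and pos :: "'a \<Rightarrow> bool"
    and K :: "nat set" and N :: "nat \<Rightarrow> nat set" +
  fixes Q :: "nat \<Rightarrow> (nat \<Rightarrow> nat \<Rightarrow> nat) pmf" and S1 S2 :: "nat \<Rightarrow> nat set"
  assumes indep: "\<And>n A. 1 \<le> n \<Longrightarrow>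
      measure_pmf.prob (Q n) {\<tau>. \<forall>j\<in>K. \<tau> j \<in> A j} = (\<Prod>j\<in>K. measure_pmf.prob (marginal j (Q n)) (A j))"
    and perm: "\<And>n j. 1 \<le> n \<Longrightarrow> j \<in> K \<Longrightarrow> random_permutation n (marginal j (Q n))"
    and conj_inv: "\<And>n j. 1 \<le> n \<Longrightarrow> j \<in> K \<Longrightarrow> conjugation_invariant n (marginal j (Q n))"
    and few: "\<And>j. j \<in> K \<Longrightarrow> few_short_cycles_strong (S1 j) (S2 j) (\<lambda>n. marginal j (Q n))"
    and finN: "\<And>j. finite (N j)"
    and S1: "\<And>j b c. j \<in> K \<Longrightarrow> b \<in> N j \<Longrightarrow> c dvd b \<Longrightarrow> c \<in> S1 j"
    and S2: "\<And>j b c. j \<in> K \<Longrightarrow> b \<in> N j \<Longrightarrow> 1 \<le> c \<Longrightarrow> c \<le> b \<Longrightarrow> c \<in> S2 j"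
    and S2': "\<And>j a b. j \<in> K \<Longrightarrow> a \<in> N j \<Longrightarrow> b \<in> N j \<Longrightarrow> a + b \<in> S2 j"
begin

section \<open>Asymptotics of one kernel class\<close>

definition kernel_ratio :: "('a \<Rightarrow> 'v) \<Rightarrow> nat \<Rightarrow> real" where
  "kernel_ratio \<rho> n = real (card (kernel_class \<rho> n)) / real n ^ card (\<rho> ` I)"

definition colour_ratio :: "('a \<Rightarrow> 'v) \<Rightarrow> nat \<Rightarrow> nat \<Rightarrow> real" where
  "colour_ratio \<rho> j n = measure_pmf.expectation (marginal j (Q n))
     (\<lambda>\<sigma>. real (card (embeddings n (\<rho> ` I) (edges \<rho> j) \<sigma>)) / real n ^ (card (\<rho> ` I) - card (edges \<rho> j)))"

lemma marginal_integrable: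
  fixes f :: "_ \<Rightarrow> real"
  assumes "1 \<le> n" "j \<in> K"
  shows "integrable (measure_pmf (marginal j (Q n))) f"
  by (rule integrable_measure_pmf_finite[OF finite_random_permutation[OF perm[OF assms]]])

text \<open>Without edges, the embeddings are all the injective labellings.\<close>

lemma kernel_ratio_limit: "kernel_ratio \<rho> \<longlonglongrightarrow> 1"
proof (rule tendsto_sandwich[where h = "\<lambda>_. 1" and f = "\<lambda>n. 1 - (real (card (\<rho> ` I)))\<^sup>2 * (1 / real n)"])
  have pi: "partial_inj (\<rho> ` I) {}" unfolding partial_inj_def using finI by simp
  have cyc: "cycles_of {} = {}" unfolding cycles_of_def cycle_verts_def by simp
  have eq: "kernel_ratio \<rho> n = real (card (embeddings n (\<rho> ` I) {} id)) / real n ^ (card (\<rho> ` I) - card ({} :: 'b rel))" for n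
    unfolding kernel_ratio_def card_kernel_class[of \<rho> n id] by simp
  have D: "d \<le> 0" if "(u, v) \<in> ({} :: 'b rel) ^^ d" for u v and d :: nat
    using that by (cases d) auto
  show "\<forall>\<^sub>F n in sequentially. kernel_ratio \<rho> n \<le> 1"
    using eventually_ge_at_top[of 1]
    by eventually_elim (unfold eq, rule embeddings_ratio_le_1[OF pi cyc])
  show "\<forall>\<^sub>F n in sequentially. 1 - (real (card (\<rho> ` I)))\<^sup>2 * (1 / real n) \<le> kernel_ratio \<rho> n"
    using eventually_ge_at_top[of 1]
  proof eventually_elim
    case (elim n)
    show ?case unfolding eq using embeddings_ratio_ge[OF pi cyc elim D permutes_id] by simp
  qed
  have "(\<lambda>n. 1 - (real (card (\<rho> ` I)))\<^sup>2 * (1 / real n)) \<longlonglongrightarrow> 1 - (real (card (\<rho> ` I)))\<^sup>2 * 0"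
    by (intro tendsto_intros lim_1_over_n)
  then show "(\<lambda>n. 1 - (real (card (\<rho> ` I)))\<^sup>2 * (1 / real n)) \<longlonglongrightarrow> 1" by simp
qed simp

lemma edges_le: "folded \<rho> \<Longrightarrow> j \<in> K \<Longrightarrow> card (edges \<rho> j) \<le> card (\<rho> ` I)"
proof -
  assume a: "folded \<rho>" "j \<in> K"
  have "card (Range (edges \<rho> j)) \<le> card (\<rho> ` I)"
    using finI edges_subset[of \<rho> j] by (intro card_mono) auto
  then show ?thesis unfolding card_roots(2)[OF partial_inj_edges[OF a]] .
qed

text \<open>After normalising each count by its power of \<open>n\<close>, what remains is
  \<open>n ^ (V - E)\<close>. It is written as an even power of \<open>1 / sqrt n\<close> so that it
  can be shared among the attachments, and \<open>euler_bound\<close> makes the truncated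
  subtraction in the exponent exact.\<close>

lemma class_expectation_ratio:
  assumes fold: "folded \<rho>" and n: "1 \<le> n"
  shows "class_expectation n (Q n) \<rho> = kernel_ratio \<rho> n * (\<Prod>j\<in>K. colour_ratio \<rho> j n / kernel_ratio \<rho> n) *
     (1 / sqrt (real n)) ^ (2 * (\<Sum>j\<in>K. card (edges \<rho> j)) - 2 * card (\<rho> ` I))"
proof -
  let ?V = "card (\<rho> ` I)" and ?e = "\<lambda>j. card (edges \<rho> j)" and ?N = "real (card (kernel_class \<rho> n))"
  let ?r = "kernel_ratio \<rho> n"
  let ?X = "\<lambda>j. measure_pmf.expectation (marginal j (Q n)) (\<lambda>\<sigma>. real (card (embeddings n (\<rho> ` I) (edges \<rho> j) \<sigma>)))"
  have T: "class_expectation n (Q n) \<rho> = ?N * (\<Prod>j\<in>K. ?X j / ?N)"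
    by (rule class_expectation_eq[OF indep[OF n] perm[OF n] conj_inv[OF n]])
  show ?thesis
  proof (cases "?N = 0")
    case True
    then show ?thesis unfolding T by (simp add: kernel_ratio_def)
  next
    case False
    have n0: "real n \<noteq> 0" using n by simp
    have r0: "?r \<noteq> 0" using False n0 unfolding kernel_ratio_def by simp
    have N: "?N = ?r * real n ^ ?V" using n0 unfolding kernel_ratio_def by simp
    have fac: "?X j / ?N = (colour_ratio \<rho> j n / ?r) * (1 / real n ^ ?e j)" if j: "j \<in> K" for j
    proof -
      have "?X j = colour_ratio \<rho> j n * real n ^ (?V - ?e j)"
        unfolding colour_ratio_def using n0 by simp
      moreover have "real n ^ ?V = real n ^ (?V - ?e j) * real n ^ ?e j"
        using edges_le[OF fold j] by (simp flip: power_add)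
      ultimately show ?thesis using n0 r0 unfolding N by simp
    qed
    have E: "?V \<le> (\<Sum>j\<in>K. ?e j)" using euler_bound[OF fold] by simp
    have "(\<Prod>j\<in>K. ?X j / ?N) = (\<Prod>j\<in>K. (colour_ratio \<rho> j n / ?r) * (1 / real n ^ ?e j))"
      by (rule prod.cong[OF refl fac])
    also have "\<dots> = (\<Prod>j\<in>K. colour_ratio \<rho> j n / ?r) * (\<Prod>j\<in>K. 1 / real n ^ ?e j)"
      by (rule prod.distrib)
    also have "(\<Prod>j\<in>K. 1 / real n ^ ?e j) = 1 / real n ^ (\<Sum>j\<in>K. ?e j)"
      by (simp add: prod_dividef power_sum)
    finally have P: "(\<Prod>j\<in>K. ?X j / ?N) = (\<Prod>j\<in>K. colour_ratio \<rho> j n / ?r) * (1 / real n ^ (\<Sum>j\<in>K. ?e j))" .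
    have "(1 / sqrt (real n)) ^ (2 * (\<Sum>j\<in>K. ?e j) - 2 * ?V) = ((1 / sqrt (real n)) ^ 2) ^ ((\<Sum>j\<in>K. ?e j) - ?V)"
      by (simp only: power_mult[symmetric] right_diff_distrib')
    also have "\<dots> = 1 / real n ^ ((\<Sum>j\<in>K. ?e j) - ?V)"
      using n by (simp add: power_divide)
    also have "\<dots> = real n ^ ?V / real n ^ (\<Sum>j\<in>K. ?e j)"
      using n0 E by (simp add: power_diff)
    finally have h: "(1 / sqrt (real n)) ^ (2 * (\<Sum>j\<in>K. ?e j) - 2 * ?V) = real n ^ ?V / real n ^ (\<Sum>j\<in>K. ?e j)" .
    show ?thesis unfolding T P h unfolding N by simp
  qed
qed

text \<open>An injective labelling leaves only short monochromatic paths. Almost all choices of root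
  labels extend to an embedding, because the cycle lengths that could cause a collision are at most
  the longest run and hence lie in \<open>S2 j\<close>.\<close>

lemma colour_ratio_limit_1:
  assumes inj: "inj_on \<rho> I" and j: "j \<in> K"
  shows "(\<lambda>n. colour_ratio \<rho> j n) \<longlonglongrightarrow> 1"
proof -
  note fold = injective_folded[OF inj]
  note pi = partial_inj_edges[OF fold(1) j]
  have cyc: "cycles_of (edges \<rho> j) = {}" by (rule no_cycles[OF fold(1) _ j]) (simp add: fold(2))
  have H: "card (half_edges \<rho> v) = 2" if "v \<in> \<rho> ` I" for v
    by (rule half_edges_eq_2[OF fold(1) _ that]) (simp add: fold(2))
  \<comment> \<open>The inserted 0 covers a generator that does not occur in the word, for which
    \<open>N j\<close> may be empty.\<close>
  define D where "D = Max (insert 0 (N j))"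
  have D: "d \<le> D" if uvd: "(u, v) \<in> edges \<rho> j ^^ d" for u v d
  proof (cases "d = 0")
    case False
    then obtain b where "b \<in> N j" "d \<le> b" using path_length_le[OF fold(1) H j uvd] by auto
    moreover from this have "b \<le> D" unfolding D_def using finN by (intro Max_ge) auto
    ultimately show ?thesis by simp
  qed simp
  have D': "D = 0 \<or> D \<in> N j" unfolding D_def using Max_in[of "insert 0 (N j)"] finN[of j] by simp
  let ?pt = "\<lambda>n c \<sigma>. real (card {x \<in> {1..n}. card (orbit \<sigma> x) = c}) / real n"
  let ?V2 = "(real (card (\<rho> ` I)))\<^sup>2"
  let ?low = "\<lambda>n. 1 - ?V2 * (1 / real n + (\<Sum>c=1..D. measure_pmf.expectation (marginal j (Q n)) (?pt n c)))"
  have low: "?low n \<le> colour_ratio \<rho> j n" if n: "1 \<le> n" for n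
  proof -
    note int = marginal_integrable[OF n j]
    have "?low n = measure_pmf.expectation (marginal j (Q n)) (\<lambda>\<sigma>. 1 - ?V2 * (1 / real n + (\<Sum>c=1..D. ?pt n c \<sigma>)))"
      using int by (simp del: Bochner_Integration.integral_divide_zero)
    also have "\<dots> \<le> colour_ratio \<rho> j n"
      unfolding colour_ratio_def
    proof (rule integral_mono_AE[OF int int], rule AE_pmfI)
      fix \<sigma> assume "\<sigma> \<in> set_pmf (marginal j (Q n))"
      then have "\<sigma> permutes {1..n}" using perm[OF n j] unfolding random_permutation_def by blast
      then show "1 - ?V2 * (1 / real n + (\<Sum>c=1..D. ?pt n c \<sigma>)) \<le>
         real (card (embeddings n (\<rho> ` I) (edges \<rho> j) \<sigma>)) / real n ^ (card (\<rho> ` I) - card (edges \<rho> j))"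
        by (intro embeddings_ratio_ge[OF pi cyc n] D)
    qed
    finally show ?thesis .
  qed
  have up: "colour_ratio \<rho> j n \<le> 1" if n: "1 \<le> n" for n
  proof -
    have "colour_ratio \<rho> j n \<le> measure_pmf.expectation (marginal j (Q n)) (\<lambda>_. 1)"
      unfolding colour_ratio_def
      by (intro integral_mono marginal_integrable[OF n j] embeddings_ratio_le_1[OF pi cyc n])
    then show ?thesis by simp
  qed
  have "?low \<longlonglongrightarrow> 1 - ?V2 * (0 + (\<Sum>c=1..D. 0))"
  proof (intro tendsto_intros lim_1_over_n)
    fix c assume c: "c \<in> {1..D}"
    then have "c \<in> S2 j" using D' S2[OF j, of D c] by auto
    then show "(\<lambda>n. measure_pmf.expectation (marginal j (Q n)) (?pt n c)) \<longlonglongrightarrow> 0"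
      using few_short_points_limit[OF few[OF j] perm[OF _ j]] by simp
  qed
  then have "?low \<longlonglongrightarrow> 1" by simp
  then show ?thesis
  proof (rule tendsto_sandwich[OF _ _ _ tendsto_const, rotated 2])
    show "\<forall>\<^sub>F n in sequentially. ?low n \<le> colour_ratio \<rho> j n"
      using eventually_ge_at_top[of 1] by eventually_elim (rule low)
    show "\<forall>\<^sub>F n in sequentially. colour_ratio \<rho> j n \<le> 1"
      using eventually_ge_at_top[of 1] by eventually_elim (rule up)
  qed
qed

lemma class_expectation_limit_1:
  assumes inj: "inj_on \<rho> I"
  shows "(\<lambda>n. class_expectation n (Q n) \<rho>) \<longlonglongrightarrow> 1"
proof -
  note fold = injective_folded[OF inj]
  have "(\<lambda>n. kernel_ratio \<rho> n * (\<Prod>j\<in>K. colour_ratio \<rho> j n / kernel_ratio \<rho> n)) \<longlonglongrightarrow> 1 * (\<Prod>j\<in>K. 1 / 1)"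
    by (intro tendsto_intros kernel_ratio_limit colour_ratio_limit_1[OF inj]) simp_all
  then have "(\<lambda>n. kernel_ratio \<rho> n * (\<Prod>j\<in>K. colour_ratio \<rho> j n / kernel_ratio \<rho> n)) \<longlonglongrightarrow> 1" by simp
  then show ?thesis
  proof (rule Lim_transform_eventually)
    show "\<forall>\<^sub>F n in sequentially. kernel_ratio \<rho> n * (\<Prod>j\<in>K. colour_ratio \<rho> j n / kernel_ratio \<rho> n) =
        class_expectation n (Q n) \<rho>"
      using eventually_ge_at_top[of 1]
    proof eventually_elim
      case (elim n)
      show ?case unfolding class_expectation_ratio[OF fold(1) elim] fold(2) by simp
    qed
  qed
qed

definition cycle_bound :: "('a \<Rightarrow> 'v) \<Rightarrow> nat \<Rightarrow> nat \<Rightarrow> real" where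
  "cycle_bound \<rho> j n = measure_pmf.expectation (marginal j (Q n))
     (\<lambda>\<sigma>. \<Prod>C\<in>cycles_of (edges \<rho> j). real (card {x \<in> {1..n}. card (orbit \<sigma> x) = card C}) *
        (1 / sqrt (real n)) ^ attachments \<rho> j C)"

text \<open>The trichotomy on the number of attachments meets the hypotheses here: one attachment
  puts the length in \<open>S1 j\<close>, two put it in \<open>S2 j\<close>. Without cycles the
  product is empty, whence the value 1.\<close>

lemma cycle_bound_limit:
  assumes fold: "folded \<rho>" and j: "j \<in> K"
  shows "(\<lambda>n. cycle_bound \<rho> j n) \<longlonglongrightarrow> (if cycles_of (edges \<rho> j) = {} then 1 else 0)"
proof (cases "cycles_of (edges \<rho> j) = {}")
  case True
  then show ?thesis unfolding cycle_bound_def by simp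
next
  case False
  have "(\<lambda>n. cycle_bound \<rho> j n) \<longlonglongrightarrow> 0"
    unfolding cycle_bound_def
  proof (rule cycle_product_limit[OF few[OF j] perm[OF _ j] finite_cycles_of[OF partial_inj_edges[OF fold j]] False])
    fix C assume C: "C \<in> cycles_of (edges \<rho> j)"
    show "1 \<le> attachments \<rho> j C" by (rule attachments_pos[OF fold j C])
    show "card C \<in> S1 j" if "attachments \<rho> j C = 1"
      using attachments_1[OF fold j C that] S1[OF j] by blast
    have "1 \<le> card C" using cycle_funpow(3)[OF _ C] fold j unfolding folded_def by (simp add: Suc_le_eq)
    then show "card C \<in> S2 j" if "attachments \<rho> j C = 2"
      using attachments_2[OF fold j C that] S2[OF j] S2'[OF j] by metis
  qed
  then show ?thesis using False by simp
qed

lemma colour_ratio_le_cycle_bound: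
  assumes fold: "folded \<rho>" and j: "j \<in> K" and n: "1 \<le> n"
  shows "colour_ratio \<rho> j n * (1 / sqrt (real n)) ^ (\<Sum>C\<in>cycles_of (edges \<rho> j). attachments \<rho> j C) \<le> cycle_bound \<rho> j n"
proof -
  note int = marginal_integrable[OF n j]
  let ?h = "1 / sqrt (real n)" and ?q = "card (\<rho> ` I) - card (edges \<rho> j)"
  let ?t = "\<Sum>C\<in>cycles_of (edges \<rho> j). attachments \<rho> j C"
  have "colour_ratio \<rho> j n * ?h ^ ?t = measure_pmf.expectation (marginal j (Q n))
     (\<lambda>\<sigma>. real (card (embeddings n (\<rho> ` I) (edges \<rho> j) \<sigma>)) / real n ^ ?q * ?h ^ ?t)"
    unfolding colour_ratio_def by simp
  also have "\<dots> \<le> cycle_bound \<rho> j n"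
    unfolding cycle_bound_def
  proof (rule integral_mono[OF int int])
    fix \<sigma>
    let ?m = "\<lambda>C. card {x \<in> {1..n}. card (orbit \<sigma> x) = card C}"
    have "real (card (embeddings n (\<rho> ` I) (edges \<rho> j) \<sigma>)) \<le> real (n ^ ?q * (\<Prod>C\<in>cycles_of (edges \<rho> j). ?m C))"
      unfolding of_nat_le_iff by (rule card_embeddings_le[OF partial_inj_edges[OF fold j]])
    then have "real (card (embeddings n (\<rho> ` I) (edges \<rho> j) \<sigma>)) / real n ^ ?q \<le> (\<Prod>C\<in>cycles_of (edges \<rho> j). real (?m C))"
      using n by (simp add: pos_divide_le_eq mult.commute)
    then have "real (card (embeddings n (\<rho> ` I) (edges \<rho> j) \<sigma>)) / real n ^ ?q * ?h ^ ?t
       \<le> (\<Prod>C\<in>cycles_of (edges \<rho> j). real (?m C)) * ?h ^ ?t"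
      by (rule mult_right_mono) simp
    also have "\<dots> = (\<Prod>C\<in>cycles_of (edges \<rho> j). real (?m C) * ?h ^ attachments \<rho> j C)"
      by (simp only: power_sum prod.distrib)
    finally show "real (card (embeddings n (\<rho> ` I) (edges \<rho> j) \<sigma>)) / real n ^ ?q * ?h ^ ?t
       \<le> (\<Prod>C\<in>cycles_of (edges \<rho> j). real (?m C) * ?h ^ attachments \<rho> j C)" .
  qed
  finally show ?thesis .
qed

text \<open>Each attachment takes one factor \<open>1 / sqrt n\<close> into the bound for its cycle,
  and \<open>\<delta>\<close> factors are left. Either some colour has a cycle and its bound tends
  to 0, or there are no cycles and the surplus of edges makes \<open>\<delta>\<close>
  positive.\<close>

lemma class_expectation_limit_0:
  assumes nontrivial: "folded \<rho> \<Longrightarrow> card (\<rho> ` I) < (\<Sum>j\<in>K. card (edges \<rho> j))"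
  shows "(\<lambda>n. class_expectation n (Q n) \<rho>) \<longlonglongrightarrow> 0"
proof (cases "folded \<rho>")
  case False
  show ?thesis
  proof (rule Lim_transform_eventually[OF tendsto_const])
    show "\<forall>\<^sub>F n in sequentially. 0 = class_expectation n (Q n) \<rho>"
      using eventually_ge_at_top[of 1]
      by eventually_elim (simp add: class_expectation_not_folded[OF False perm])
  qed
next
  case fold: True
  let ?\<theta> = "\<lambda>j. \<Sum>C\<in>cycles_of (edges \<rho> j). attachments \<rho> j C"
  let ?V = "card (\<rho> ` I)" and ?e = "\<Sum>j\<in>K. card (edges \<rho> j)"
  define \<delta> where "\<delta> = 2 * ?e - 2 * ?V - (\<Sum>j\<in>K. ?\<theta> j)"
  have \<delta>: "2 * ?e - 2 * ?V = (\<Sum>j\<in>K. ?\<theta> j) + \<delta>" unfolding \<delta>_def using euler_bound[OF fold] by simp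
  let ?h = "\<lambda>n. 1 / sqrt (real n)"
  let ?G = "\<lambda>n. kernel_ratio \<rho> n * (\<Prod>j\<in>K. cycle_bound \<rho> j n / kernel_ratio \<rho> n) * ?h n ^ \<delta>"
  let ?L = "\<lambda>j. if cycles_of (edges \<rho> j) = {} then 1 else 0 :: real"
  have h0: "?h \<longlonglongrightarrow> 0"
    using tendsto_real_sqrt[OF lim_1_over_n] unfolding real_sqrt_divide by simp
  have "?G \<longlonglongrightarrow> 1 * (\<Prod>j\<in>K. ?L j / 1) * 0 ^ \<delta>"
    by (intro tendsto_intros kernel_ratio_limit cycle_bound_limit[OF fold] h0) simp_all
  moreover have "1 * (\<Prod>j\<in>K. ?L j / 1) * 0 ^ \<delta> = 0"
  proof (cases "\<exists>j\<in>K. cycles_of (edges \<rho> j) \<noteq> {}")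
    case True
    then have "(\<Prod>j\<in>K. ?L j / 1) = 0" using finK by (intro prod_zero) auto
    then show ?thesis by simp
  next
    case False
    then have "(\<Sum>j\<in>K. ?\<theta> j) = 0" by simp
    then have "0 < \<delta>" using \<delta> nontrivial[OF fold] by simp
    then show ?thesis by simp
  qed
  ultimately have "?G \<longlonglongrightarrow> 0" by (simp only:)
  then show ?thesis
  proof (rule tendsto_sandwich[OF _ _ tendsto_const, rotated 2])
    show "\<forall>\<^sub>F n in sequentially. 0 \<le> class_expectation n (Q n) \<rho>"
      unfolding class_expectation_def by (intro always_eventually allI sum_nonneg) simp
    show "\<forall>\<^sub>F n in sequentially. class_expectation n (Q n) \<rho> \<le> ?G n"
      using eventually_ge_at_top[of 1]
    proof eventually_elim
      case (elim n)
      have r: "0 \<le> kernel_ratio \<rho> n" unfolding kernel_ratio_def by simp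
      have x: "0 \<le> colour_ratio \<rho> j n" for j
        unfolding colour_ratio_def by (intro integral_nonneg_AE AE_pmfI) simp
      have "class_expectation n (Q n) \<rho> =
         kernel_ratio \<rho> n * ((\<Prod>j\<in>K. colour_ratio \<rho> j n / kernel_ratio \<rho> n) * (\<Prod>j\<in>K. ?h n ^ ?\<theta> j)) * ?h n ^ \<delta>"
        unfolding class_expectation_ratio[OF fold elim] \<delta> power_add power_sum by (simp only: mult.assoc)
      also have "(\<Prod>j\<in>K. colour_ratio \<rho> j n / kernel_ratio \<rho> n) * (\<Prod>j\<in>K. ?h n ^ ?\<theta> j) =
         (\<Prod>j\<in>K. colour_ratio \<rho> j n * ?h n ^ ?\<theta> j / kernel_ratio \<rho> n)"
        unfolding prod.distrib[symmetric] by (simp only: times_divide_eq_left)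
      also have "kernel_ratio \<rho> n * \<dots> * ?h n ^ \<delta> \<le> ?G n"
      proof (intro mult_right_mono mult_left_mono prod_mono conjI divide_right_mono colour_ratio_le_cycle_bound fold elim r)
        fix j
        show "0 \<le> colour_ratio \<rho> j n * ?h n ^ ?\<theta> j / kernel_ratio \<rho> n" using x r by simp
      qed simp_all
      finally show ?case .
    qed
  qed
qed

section \<open>Sum over all kernels\<close>

text \<open>Each kernel is represented by a labelling with values in \<open>I\<close> itself. The
  set of kernels is thereby finite and the same for every \<open>n\<close>.\<close>

definition canonical_map :: "('a \<Rightarrow> 'v) \<Rightarrow> 'a \<Rightarrow> 'a" where
  "canonical_map y = (\<lambda>t\<in>I. SOME t'. t' \<in> I \<and> y t' = y t)"

lemma canonical_map_prop:
  assumes "t \<in> I"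
  shows "canonical_map y t \<in> I" "y (canonical_map y t) = y t"
proof -
  have "(SOME t'. t' \<in> I \<and> y t' = y t) \<in> I \<and> y (SOME t'. t' \<in> I \<and> y t' = y t) = y t"
    by (rule someI[of "\<lambda>t'. t' \<in> I \<and> y t' = y t" t]) (simp add: assms)
  then show "canonical_map y t \<in> I" "y (canonical_map y t) = y t"
    unfolding canonical_map_def using assms by simp_all
qed

lemma canonical_map_eq_iff:
  assumes "t \<in> I" "t' \<in> I"
  shows "canonical_map y t = canonical_map y t' \<longleftrightarrow> y t = y t'"
proof
  show "y t = y t'" if "canonical_map y t = canonical_map y t'"
    using canonical_map_prop(2)[OF assms(1), of y] canonical_map_prop(2)[OF assms(2), of y] that by simp
  show "canonical_map y t = canonical_map y t'" if "y t = y t'"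
    unfolding canonical_map_def using assms that by simp
qed

lemma canonical_map_cong:
  assumes "\<And>t t'. t \<in> I \<Longrightarrow> t' \<in> I \<Longrightarrow> y t = y t' \<longleftrightarrow> z t = z t'"
  shows "canonical_map y = canonical_map z"
proof
  fix t
  show "canonical_map y t = canonical_map z t"
  proof (cases "t \<in> I")
    case True
    have "t' \<in> I \<and> y t' = y t \<longleftrightarrow> t' \<in> I \<and> z t' = z t" for t'
      by (cases "t' \<in> I") (simp_all only: assms[OF _ True] simp_thms)
    then have "(SOME t'. t' \<in> I \<and> y t' = y t) = (SOME t'. t' \<in> I \<and> z t' = z t)"
      by (simp only:)
    then show ?thesis unfolding canonical_map_def using True by simp
  qed (simp add: canonical_map_def)
qed

text \<open>Grouping by kernels gives a finite sum of a length that does not depend on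
  \<open>n\<close>, so limits may be taken term by term. The set \<open>B\<close> holds the times
  whose labels are required to be distinct; by \<open>rigid\<close>, every kernel respecting this
  other than the trivial one has more edges than vertices or is not folded.\<close>

lemma trail_count_limit:
  assumes rigid: "\<And>\<rho> :: 'a \<Rightarrow> 'a. folded \<rho> \<Longrightarrow> (\<And>v. v \<in> \<rho> ` I \<Longrightarrow> card (half_edges \<rho> v) = 2) \<Longrightarrow>
      inj_on \<rho> B \<Longrightarrow> inj_on \<rho> I"
    and B: "B \<subseteq> I"
  shows "(\<lambda>n. \<Sum>y\<in>{y \<in> I \<rightarrow>\<^sub>E {1..n}. inj_on y B}. measure_pmf.prob (Q n) {\<tau>. \<forall>j\<in>K. obeys y j (\<tau> j)}) \<longlonglongrightarrow> 1"
proof -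
  define R where "R = {\<rho> \<in> I \<rightarrow>\<^sub>E I. canonical_map \<rho> = \<rho> \<and> inj_on \<rho> B}"
  have finR: "finite R"
  proof (rule finite_subset)
    show "R \<subseteq> I \<rightarrow>\<^sub>E I" unfolding R_def by (rule Collect_restrict)
    show "finite (I \<rightarrow>\<^sub>E I)" using finI by (simp add: finite_PiE)
  qed
  have inj_iff: "inj_on (canonical_map y) B \<longleftrightarrow> inj_on y B" for y :: "'a \<Rightarrow> nat"
    unfolding inj_on_def using canonical_map_eq_iff[of _ _ y] B by blast
  have cm_R: "canonical_map y \<in> R" if "inj_on y B" for y :: "'a \<Rightarrow> nat"
  proof -
    have "canonical_map y \<in> I \<rightarrow>\<^sub>E I" using canonical_map_prop(1)[of _ y] by (simp add: PiE_iff canonical_map_def)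
    moreover have "canonical_map (canonical_map y) = canonical_map y"
      by (rule canonical_map_cong) (rule canonical_map_eq_iff)
    ultimately show ?thesis unfolding R_def using that inj_iff by blast
  qed
  have cls: "{y \<in> {y \<in> I \<rightarrow>\<^sub>E {1..n}. inj_on y B}. canonical_map y = \<rho>} = kernel_class \<rho> n" if \<rho>: "\<rho> \<in> R" for \<rho> n
  proof (intro equalityI subsetI)
    fix y assume "y \<in> {y \<in> {y \<in> I \<rightarrow>\<^sub>E {1..n}. inj_on y B}. canonical_map y = \<rho>}"
    then show "y \<in> kernel_class \<rho> n"
      unfolding kernel_class_def using canonical_map_eq_iff[of _ _ y] by blast
  next
    fix y assume y: "y \<in> kernel_class \<rho> n"
    then have "canonical_map y = canonical_map \<rho>"
      unfolding kernel_class_def by (intro canonical_map_cong) blast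
    then have "canonical_map y = \<rho>" using \<rho> unfolding R_def by simp
    moreover from this have "inj_on y B" using \<rho> inj_iff[of y] unfolding R_def by simp
    ultimately show "y \<in> {y \<in> {y \<in> I \<rightarrow>\<^sub>E {1..n}. inj_on y B}. canonical_map y = \<rho>}"
      using y unfolding kernel_class_def by blast
  qed
  let ?T = "\<lambda>n. \<Sum>y\<in>{y \<in> I \<rightarrow>\<^sub>E {1..n}. inj_on y B}. measure_pmf.prob (Q n) {\<tau>. \<forall>j\<in>K. obeys y j (\<tau> j)}"
  have T: "?T n = (\<Sum>\<rho>\<in>R. class_expectation n (Q n) \<rho>)" for n
  proof -
    have "?T n = (\<Sum>\<rho>\<in>R. \<Sum>y\<in>{y \<in> {y \<in> I \<rightarrow>\<^sub>E {1..n}. inj_on y B}. canonical_map y = \<rho>}.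
        measure_pmf.prob (Q n) {\<tau>. \<forall>j\<in>K. obeys y j (\<tau> j)})"
    proof (rule sum.group[symmetric, OF _ finR])
      show "finite {y \<in> I \<rightarrow>\<^sub>E {1..n}. inj_on y B}"
        by (rule finite_subset[OF Collect_restrict finite_PiE[OF finI]]) simp
      show "canonical_map ` {y \<in> I \<rightarrow>\<^sub>E {1..n}. inj_on y B} \<subseteq> R" using cm_R by blast
    qed
    also have "\<dots> = (\<Sum>\<rho>\<in>R. class_expectation n (Q n) \<rho>)"
      unfolding class_expectation_def by (intro sum.cong refl cls)
    finally show ?thesis .
  qed
  have lim: "(\<lambda>n. class_expectation n (Q n) \<rho>) \<longlonglongrightarrow> (if \<rho> = restrict id I then 1 else 0)" if \<rho>: "\<rho> \<in> R" for \<rho>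
  proof (cases "\<rho> = restrict id I")
    case True
    then have "inj_on \<rho> I" by (simp add: inj_on_def)
    from class_expectation_limit_1[OF this] show ?thesis using True by simp
  next
    case False
    \<comment> \<open>An injective canonical labelling sends each time to the only representative of
      its class, namely itself.\<close>
    have ninj: "\<not> inj_on \<rho> I"
    proof
      assume inj: "inj_on \<rho> I"
      have "\<rho> t = restrict id I t" for t
      proof (cases "t \<in> I")
        case True
        have "\<rho> (canonical_map \<rho> t) = \<rho> t" by (rule canonical_map_prop(2)[OF True])
        then have "canonical_map \<rho> t = t" using inj_onD[OF inj _ canonical_map_prop(1)[OF True] True] by blast
        then show ?thesis using \<rho> True unfolding R_def by simp
      next
        case False
        then show ?thesis using \<rho> unfolding R_def by (auto simp: PiE_iff extensional_def)
      qed
      then show False using False by blast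
    qed
    have "(\<lambda>n. class_expectation n (Q n) \<rho>) \<longlonglongrightarrow> 0"
    proof (rule class_expectation_limit_0, rule ccontr)
      assume f: "folded \<rho>" and "\<not> card (\<rho> ` I) < (\<Sum>j\<in>K. card (edges \<rho> j))"
      then have "card (half_edges \<rho> v) = 2" if "v \<in> \<rho> ` I" for v
        using that by (intro half_edges_eq_2[OF f]) auto
      then have "inj_on \<rho> I" using rigid[OF f] \<rho> unfolding R_def by blast
      then show False using ninj by simp
    qed
    then show ?thesis using False by simp
  qed
  have id_R: "restrict id I \<in> R"
  proof -
    have "canonical_map (restrict id I) = restrict id I"
    proof
      fix t
      show "canonical_map (restrict id I) t = restrict id I t"
        using canonical_map_prop[of t "restrict id I"] by (cases "t \<in> I") (auto simp: canonical_map_def)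
    qed
    moreover have "inj_on (restrict id I) B" using B by (auto simp: inj_on_def)
    ultimately show ?thesis unfolding R_def by simp
  qed
  have "(\<lambda>n. \<Sum>\<rho>\<in>R. class_expectation n (Q n) \<rho>) \<longlonglongrightarrow> (\<Sum>\<rho>\<in>R. if \<rho> = restrict id I then 1 else 0)"
    by (intro tendsto_sum lim)
  also have "(\<Sum>\<rho>\<in>R. if \<rho> = restrict id I then 1 else 0) = (1 :: real)"
    using finR id_R by simp
  finally show ?thesis unfolding T .
qed

end

section \<open>Words in the free group\<close>

definition inv_word :: "fword \<Rightarrow> fword" where
  "inv_word u = rev (map (\<lambda>(j, e). (j, - e)) u)"

lemma inv_word_Cons: "inv_word (a # u) = inv_word u @ [(fst a, - snd a)]"
  by (cases a) (simp add: inv_word_def)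

lemma foldr_lmult_inv_word: "foldr lmult (inv_word u) (u @ v) = v"
proof (induction u arbitrary: v)
  case Nil
  then show ?case by (simp add: inv_word_def)
next
  case (Cons a u)
  have "lmult (fst a, - snd a) (a # u @ v) = u @ v" by (simp add: lmult_def)
  then show ?case using Cons.IH by (simp add: inv_word_Cons)
qed

lemma canonical_append_iff:
  "u @ v \<in> canonical_words k \<longleftrightarrow> u \<in> canonical_words k \<and> v \<in> canonical_words k \<and>
     (u = [] \<or> v = [] \<or> (fst (last u) = fst (hd v) \<longrightarrow> snd (last u) = snd (hd v)))"
  unfolding canonical_words_def by (auto simp: successively_append_iff case_prod_beta)

lemma lmult_canonical_Cons:
  assumes "a # w \<in> canonical_words k" shows "lmult a w = a # w"
proof (cases w)
  case (Cons b w')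
  have "fst a = fst b \<longrightarrow> snd a = snd b" "snd a \<in> {1, -1}"
    using assms unfolding Cons canonical_words_def by (cases a; cases b; auto)+
  then have "b \<noteq> (fst a, - snd a)" by auto
  then show ?thesis by (simp add: lmult_def Cons)
qed (simp add: lmult_def)

lemma foldr_lmult_canonical_append:
  assumes "u @ v \<in> canonical_words k" shows "foldr lmult u v = u @ v"
  using assms
proof (induction u)
  case (Cons a u)
  then have "u @ v \<in> canonical_words k" using canonical_ConsD[of a "u @ v"] by simp
  then show ?case using Cons lmult_canonical_Cons[of a "u @ v" k] by simp
qed simp

lemma concat_replicate_last: "concat (replicate d c) @ c = concat (replicate (Suc d) c)"
  by (induction d) auto

lemma concat_replicate_hd_last:
  assumes "c \<noteq> []" "0 < d"
  shows "concat (replicate d c) \<noteq> []" "hd (concat (replicate d c)) = hd c" "last (concat (replicate d c)) = last c"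
proof -
  obtain e where e: "d = Suc e" using assms(2) by (cases d) auto
  show "concat (replicate d c) \<noteq> []" "hd (concat (replicate d c)) = hd c" using assms(1) e by simp_all
  show "last (concat (replicate d c)) = last c"
    unfolding e concat_replicate_last[symmetric] using assms(1) by simp
qed

lemma canonical_concat_replicate:
  assumes "c \<in> canonical_words k" "c \<noteq> []" "fst (last c) = fst (hd c) \<longrightarrow> snd (last c) = snd (hd c)"
  shows "concat (replicate d c) \<in> canonical_words k"
proof (induction d)
  case 0
  then show ?case by (simp add: canonical_words_def)
next
  case (Suc d)
  show ?case
    unfolding concat_replicate_last[symmetric] canonical_append_iff
    using Suc assms concat_replicate_hd_last(3)[OF assms(2), of d] by (cases "d = 0") auto
qed

text \<open>While first and last letter are inverse to each other, they are stripped and moved into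
  \<open>u\<close>. The core never becomes empty, as two adjacent inverse letters cannot occur in a
  canonical word.\<close>

lemma cyclic_decomposition:
  assumes "w \<in> canonical_words k" "w \<noteq> []"
  shows "\<exists>u c. w = u @ c @ inv_word u \<and> c \<noteq> [] \<and> (fst (last c) = fst (hd c) \<longrightarrow> snd (last c) = snd (hd c))"
  using assms
proof (induction "length w" arbitrary: w rule: less_induct)
  case less
  show ?case
  proof (cases "fst (last w) = fst (hd w) \<longrightarrow> snd (last w) = snd (hd w)")
    case True
    then show ?thesis using less.prems by (intro exI[of _ "[]"] exI[of _ w]) (simp add: inv_word_def)
  next
    case False
    obtain a w1 where w1: "w = a # w1" using less.prems(2) by (cases w) auto
    have "w1 \<noteq> []" using False w1 by auto
    then obtain v b where v: "w1 = v @ [b]" by (cases w1 rule: rev_cases) auto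
    have w: "w = a # v @ [b]" using w1 v by simp
    have ab: "fst b = fst a" "snd b \<noteq> snd a" using False w by auto
    have "snd a \<in> {1, -1}" "snd b \<in> {1, -1}" using less.prems(1) unfolding w canonical_words_def by auto
    then have b: "b = (fst a, - snd a)" using ab by (cases b) auto
    have "v \<noteq> []"
    proof
      assume "v = []"
      then have "[a] @ [b] \<in> canonical_words k" using less.prems(1) w by simp
      then show False using ab unfolding canonical_append_iff by auto
    qed
    have "[a] @ v @ [b] \<in> canonical_words k" using less.prems(1) w by simp
    then have "v \<in> canonical_words k" unfolding canonical_append_iff by blast
    then obtain u c where "v = u @ c @ inv_word u" "c \<noteq> []" "fst (last c) = fst (hd c) \<longrightarrow> snd (last c) = snd (hd c)"
      using less.hyps[of v] \<open>v \<noteq> []\<close> w by auto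
    then show ?thesis unfolding w b
      by (intro exI[of _ "a # u"] exI[of _ c]) (simp add: inv_word_Cons)
  qed
qed

text \<open>In a power the inner copies of \<open>u\<close> and its inverse cancel, and nothing
  cancels between copies of \<open>c\<close>, which is cyclically reduced. The canonical form of the
  power is therefore visible.\<close>

lemma free_group_pow_conjugate:
  assumes "u @ c @ inv_word u \<in> canonical_words k" "c \<noteq> []"
    "fst (last c) = fst (hd c) \<longrightarrow> snd (last c) = snd (hd c)"
  shows "(u @ c @ inv_word u) [^]\<^bsub>free_group k\<^esub> Suc d = u @ concat (replicate (Suc d) c) @ inv_word u"
proof (induction d)
  case 0
  then show ?case by (simp add: nat_pow_def free_group_def)
next
  case (Suc d)
  let ?C = "concat (replicate (Suc d) c)"
  have parts: "u \<in> canonical_words k" "c \<in> canonical_words k" "inv_word u \<in> canonical_words k"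
    using assms(1) unfolding canonical_append_iff by blast+
  have C: "concat (replicate e c) \<in> canonical_words k" for e
    by (rule canonical_concat_replicate[OF parts(2) assms(2,3)])
  have "u @ concat (replicate (Suc (Suc d)) c) @ inv_word u \<in> canonical_words k"
    using assms(1) parts C[of "Suc (Suc d)"] concat_replicate_hd_last[OF assms(2), of "Suc (Suc d)"] assms(2)
    unfolding canonical_append_iff hd_append by (auto split: if_splits)
  then have can: "(u @ ?C) @ c @ inv_word u \<in> canonical_words k"
    unfolding concat_replicate_last[of "Suc d", symmetric] by simp
  have "(u @ c @ inv_word u) [^]\<^bsub>free_group k\<^esub> Suc (Suc d) =
     (u @ ?C @ inv_word u) \<otimes>\<^bsub>free_group k\<^esub> (u @ c @ inv_word u)"
    using Suc.IH by (simp add: nat_pow_def)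
  also have "\<dots> = foldr lmult ((u @ ?C) @ inv_word u) (u @ c @ inv_word u)"
    by (simp add: free_group_def)
  also have "\<dots> = foldr lmult (u @ ?C) (c @ inv_word u)"
    unfolding foldr_append foldr_lmult_inv_word ..
  also have "\<dots> = (u @ ?C) @ c @ inv_word u" by (rule foldr_lmult_canonical_append[OF can])
  also have "\<dots> = u @ concat (replicate (Suc (Suc d)) c) @ inv_word u"
    unfolding concat_replicate_last[of "Suc d", symmetric] by simp
  finally show ?case .
qed

text \<open>A nonempty conjugating part would make \<open>w\<close> begin and end with the same
  generator. So \<open>\<Omega>\<close> is cyclically reduced and its power is plain
  repetition.\<close>

lemma power_eq_concat:
  assumes "\<Omega> \<in> canonical_words k" "w = \<Omega> [^]\<^bsub>free_group k\<^esub> d" "1 \<le> d" "w \<noteq> []" "fst (last w) \<noteq> fst (hd w)"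
  shows "w = concat (replicate d \<Omega>)" "\<Omega> \<noteq> []" "fst (last \<Omega>) \<noteq> fst (hd \<Omega>)"
proof -
  obtain e where e: "d = Suc e" using assms(3) by (cases d) auto
  show ne: "\<Omega> \<noteq> []"
  proof
    assume "\<Omega> = []"
    moreover have "[] [^]\<^bsub>free_group k\<^esub> (n::nat) = []" for n
      by (induction n) (simp_all add: nat_pow_def free_group_def)
    ultimately show False using assms(2,4) by simp
  qed
  obtain u c where uc: "\<Omega> = u @ c @ inv_word u" "c \<noteq> []" "fst (last c) = fst (hd c) \<longrightarrow> snd (last c) = snd (hd c)"
    using cyclic_decomposition[OF assms(1) ne] by blast
  have w: "w = u @ concat (replicate d c) @ inv_word u"
    unfolding assms(2) e uc(1) using assms(1) uc by (intro free_group_pow_conjugate) auto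
  have u: "u = []"
  proof (cases u)
    case (Cons a u')
    then have "hd w = a" "last w = (fst a, - snd a)" unfolding w by (simp_all add: inv_word_Cons)
    then show ?thesis using assms(5) by simp
  qed
  then have "\<Omega> = c" using uc(1) by (simp add: inv_word_def)
  then show "w = concat (replicate d \<Omega>)" using w u by (simp add: inv_word_def)
  then show "fst (last \<Omega>) \<noteq> fst (hd \<Omega>)"
    using assms(3,5) concat_replicate_hd_last[OF ne, of d] by simp
qed

lemma is_power_concat:
  assumes "concat (replicate d z) \<in> canonical_words k" "z \<noteq> []" "2 \<le> d"
  shows "is_power k (concat (replicate d z))"
proof -
  have sub: "concat (replicate e z) \<in> canonical_words k" if "e \<le> d" for e
  proof -
    have "replicate d z = replicate e z @ replicate (d - e) z" using that by (simp flip: replicate_add)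
    then show ?thesis using assms(1) unfolding canonical_append_iff by (metis canonical_append_iff concat_append)
  qed
  have "z [^]\<^bsub>free_group k\<^esub> e = concat (replicate e z)" if "e \<le> d" for e
    using that
  proof (induction e)
    case 0
    then show ?case by (simp add: nat_pow_def free_group_def)
  next
    case (Suc e)
    have "concat (replicate e z) @ z \<in> canonical_words k" unfolding concat_replicate_last using Suc.prems by (rule sub)
    then have "foldr lmult (concat (replicate e z)) z = concat (replicate e z) @ z" by (rule foldr_lmult_canonical_append)
    then show ?case using Suc unfolding concat_replicate_last[symmetric] by (simp add: nat_pow_def free_group_def)
  qed
  moreover have "z \<in> canonical_words k" using sub[of 1] assms(3) by simp
  ultimately show ?thesis
    unfolding is_power_def using assms(2,3)
    by (intro bexI[of _ z] exI[of _ d]) (auto simp: free_group_def)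
qed

text \<open>If a nontrivial rotation fixes the word, its two pieces commute as lists and hence are
  repetitions of a common list, so the word is a power. The reversal matches the order in which
  letters act.\<close>

lemma not_is_power_rotate:
  assumes "\<Omega> \<in> canonical_words k" "\<not> is_power k \<Omega>" "0 < \<delta>" "\<delta> < length \<Omega>"
  shows "drop \<delta> (rev \<Omega>) @ take \<delta> (rev \<Omega>) \<noteq> rev \<Omega>"
proof
  let ?u = "rev \<Omega>"
  assume "drop \<delta> ?u @ take \<delta> ?u = ?u"
  then have "take \<delta> ?u @ drop \<delta> ?u = drop \<delta> ?u @ take \<delta> ?u" by simp
  then obtain m n zs where z: "concat (replicate m zs) = take \<delta> ?u" "concat (replicate n zs) = drop \<delta> ?u"
    using comm_append_are_replicate by blast
  have ne: "take \<delta> ?u \<noteq> []" "drop \<delta> ?u \<noteq> []" using assms(3,4) by auto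
  have m: "0 < m" "0 < n" "zs \<noteq> []" using z ne by (auto intro!: Nat.gr0I)
  have "?u = concat (replicate (m + n) zs)"
    using z by (simp add: replicate_add)
  then have "\<Omega> = rev (concat (replicate (m + n) zs))" by (metis rev_rev_ident)
  also have "\<dots> = concat (replicate (m + n) (rev zs))" by (simp add: rev_concat)
  finally have "\<Omega> = concat (replicate (m + n) (rev zs))" .
  then show False using is_power_concat[of "m + n" "rev zs" k] assms(1,2) m by simp
qed

section \<open>Runs and exponents\<close>

lemma reduced_form_hd:
  assumes "w \<noteq> []"
  shows "reduced_form w \<noteq> [] \<and> fst (hd (reduced_form w)) = fst (hd w)"
  using assms
proof (induction w rule: reduced_form.induct)
  case (2 j e w)
  show ?case by (cases "reduced_form w") (auto split: prod.splits)
qed simp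

lemma reduced_form_append:
  assumes "u = [] \<or> v = [] \<or> fst (last u) \<noteq> fst (hd v)"
  shows "reduced_form (u @ v) = reduced_form u @ reduced_form v"
  using assms
proof (induction u)
  case (Cons a u)
  obtain j e where a: "a = (j, e)" by force
  show ?case
  proof (cases "u = []")
    case True
    show ?thesis
    proof (cases "v = []")
      case False
      then have "fst (hd (reduced_form v)) \<noteq> j" "reduced_form v \<noteq> []"
        using reduced_form_hd[OF False] Cons.prems True a by auto
      then show ?thesis using True a by (cases "reduced_form v") (auto split: prod.splits)
    qed (simp add: True)
  next
    case False
    then have IH: "reduced_form (u @ v) = reduced_form u @ reduced_form v" using Cons by simp
    have "reduced_form u \<noteq> []" using reduced_form_hd[OF False] by simp
    then show ?thesis using IH a by (cases "reduced_form u") (auto split: prod.splits)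
  qed
qed simp

lemma reduced_form_replicate: "0 < b \<Longrightarrow> reduced_form (replicate b (j, e)) = [(j, int b * e)]"
proof (induction b)
  case (Suc b)
  then show ?case by (cases "b = 0") (simp_all add: algebra_simps)
qed simp

lemma run_in_N':
  assumes "w = u @ replicate b (j, e) @ v" "0 < b" "e \<in> {1, -1}"
    "u = [] \<or> fst (last u) \<noteq> j" "v = [] \<or> fst (hd v) \<noteq> j"
  shows "b \<in> N' j w"
proof -
  have "reduced_form w = reduced_form u @ reduced_form (replicate b (j, e)) @ reduced_form v"
    unfolding assms(1) using assms(2,4,5) by (subst reduced_form_append, auto)+
  then have "(j, int b * e) \<in> set (reduced_form w)" unfolding reduced_form_replicate[OF assms(2)] by simp
  moreover have "b = nat \<bar>int b * e\<bar>" using assms(3) by (auto simp: abs_mult)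
  ultimately show ?thesis unfolding N'_def by blast
qed

lemma maximal_run:
  assumes "p < length w" "j = fst (w ! p)"
  obtains a b where "a \<le> p" "p < a + b" "a + b \<le> length w" "\<And>x. a \<le> x \<Longrightarrow> x < a + b \<Longrightarrow> fst (w ! x) = j"
    "a = 0 \<or> fst (w ! (a - 1)) \<noteq> j" "a + b = length w \<or> fst (w ! (a + b)) \<noteq> j"
proof -
  define S where "S = {a. a \<le> p \<and> (\<forall>x. a \<le> x \<longrightarrow> x \<le> p \<longrightarrow> fst (w ! x) = j)}"
  define a where "a = (LEAST a. a \<in> S)"
  have "p \<in> S" unfolding S_def using assms(2) by (auto simp: le_antisym)
  then have aS: "a \<in> S" unfolding a_def by (rule LeastI)
  have a0: "a = 0 \<or> fst (w ! (a - 1)) \<noteq> j"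
  proof (rule ccontr)
    assume neg: "\<not> ?thesis"
    have "fst (w ! x) = j" if "a - 1 \<le> x" "x \<le> p" for x
    proof (cases "x = a - 1")
      case False
      then have "a \<le> x" using that by simp
      then show ?thesis using aS that unfolding S_def by blast
    qed (use neg in simp)
    then have "a - 1 \<in> S" using aS unfolding S_def by auto
    then have "a \<le> a - 1" unfolding a_def by (rule Least_le)
    then show False using neg by (cases a) auto
  qed
  define T where "T = {c. p < c \<and> (c = length w \<or> (c < length w \<and> fst (w ! c) \<noteq> j))}"
  define c where "c = (LEAST c. c \<in> T)"
  have "length w \<in> T" unfolding T_def using assms(1) by simp
  then have cT: "c \<in> T" unfolding c_def by (rule LeastI)
  have before: "fst (w ! x) = j" if "a \<le> x" "x < c" for x
  proof (cases "x \<le> p")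
    case True
    then show ?thesis using aS that unfolding S_def by blast
  next
    case False
    have "x \<notin> T" using that(2) unfolding c_def by (rule not_less_Least)
    moreover have "x < length w" using cT that unfolding T_def by auto
    ultimately show ?thesis using False unfolding T_def by auto
  qed
  have ac: "a \<le> p" "p < c" using aS cT unfolding S_def T_def by auto
  show ?thesis
    by (rule that[of a "c - a"]) (use ac before a0 cT in \<open>auto simp: T_def\<close>)
qed

lemma canonical_run_sign:
  assumes "w \<in> canonical_words k" "a + i < length w" "\<And>x. a \<le> x \<Longrightarrow> x \<le> a + i \<Longrightarrow> fst (w ! x) = j"
  shows "w ! (a + i) = w ! a"
  using assms(2,3)
proof (induction i)
  case (Suc i)
  have "successively (\<lambda>(i, e) (j, f). i = j \<longrightarrow> e = f) w" using assms(1) unfolding canonical_words_def by blast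
  then have "fst (w ! (a + i)) = fst (w ! Suc (a + i)) \<longrightarrow> snd (w ! (a + i)) = snd (w ! Suc (a + i))"
    using Suc.prems(1) successively_nth[of _ w "a + i"] by (auto simp: case_prod_beta)
  moreover have "fst (w ! (a + i)) = j" "fst (w ! Suc (a + i)) = j" using Suc.prems(2) by simp_all
  ultimately have "w ! (a + i) = w ! Suc (a + i)" by (simp add: prod_eq_iff)
  then show ?case using Suc by simp
qed simp

lemma maximal_run_in_N':
  assumes w: "w \<in> canonical_words k" and p: "p < length w" and j: "j = fst (w ! p)"
  obtains a b where "b \<in> N' j w" "a \<le> p" "p < a + b" "a + b \<le> length w" "\<And>x. a \<le> x \<Longrightarrow> x < a + b \<Longrightarrow> fst (w ! x) = j"
    "a = 0 \<or> fst (w ! (a - 1)) \<noteq> j" "a + b = length w \<or> fst (w ! (a + b)) \<noteq> j"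
proof -
  obtain a b where ab: "a \<le> p" "p < a + b" "a + b \<le> length w" "\<And>x. a \<le> x \<Longrightarrow> x < a + b \<Longrightarrow> fst (w ! x) = j"
    "a = 0 \<or> fst (w ! (a - 1)) \<noteq> j" "a + b = length w \<or> fst (w ! (a + b)) \<noteq> j"
    using maximal_run[OF p j] by blast
  have "take b (drop a w) = replicate b (w ! a)"
  proof (rule nth_equalityI)
    show "length (take b (drop a w)) = length (replicate b (w ! a))" using ab(3) by simp
    fix i assume "i < length (take b (drop a w))"
    then have i: "i < b" by simp
    have "w ! (a + i) = w ! a" using i ab by (intro canonical_run_sign[OF w, of a i j]) auto
    then show "take b (drop a w) ! i = replicate b (w ! a) ! i" using i ab(3) by simp
  qed
  moreover have "w ! a = (j, snd (w ! a))" using ab(4)[of a] ab(1,2) by (simp add: prod_eq_iff)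
  ultimately have "w = take a w @ replicate b (j, snd (w ! a)) @ drop (a + b) w"
    by (metis append_take_drop_id drop_drop add.commute)
  moreover have "snd (w ! a) \<in> {1, -1}"
  proof -
    have "w ! a \<in> set w" using ab by (intro nth_mem) simp
    then have "w ! a \<in> {1..k} \<times> {1, -1}" using w unfolding canonical_words_def by blast
    then show ?thesis by auto
  qed
  moreover have "take a w = [] \<or> fst (last (take a w)) \<noteq> j"
    using ab(1,5) p by (cases "a = 0") (auto simp: last_conv_nth)
  moreover have "drop (a + b) w = [] \<or> fst (hd (drop (a + b) w)) \<noteq> j"
    using ab(3,6) by (cases "a + b = length w") (auto simp: hd_drop_conv_nth)
  ultimately have "b \<in> N' j w" using ab(1,2) by (intro run_in_N') auto
  then show ?thesis using that ab by blast
qed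

text \<open>Since the ends of \<open>\<Omega>\<close> carry different generators, no run merges
  across a seam, and every exponent of \<open>\<Omega>\<close> survives in its power.\<close>

lemma N'_mono_concat:
  assumes "fst (last \<Omega>) \<noteq> fst (hd \<Omega>)" "\<Omega> \<noteq> []" "1 \<le> d"
  shows "N' j \<Omega> \<subseteq> N' j (concat (replicate d \<Omega>))"
proof -
  obtain e where e: "d = Suc e" using assms(3) by (cases d) auto
  have "reduced_form (\<Omega> @ concat (replicate e \<Omega>)) = reduced_form \<Omega> @ reduced_form (concat (replicate e \<Omega>))"
    using assms concat_replicate_hd_last[OF assms(2), of e] by (intro reduced_form_append) (cases "e = 0", auto)
  then show ?thesis unfolding e N'_def by auto
qed

lemma finite_N': "finite (N' j w)"
proof -
  have "N' j w \<subseteq> (\<lambda>(_, b). nat \<bar>b\<bar>) ` set (reduced_form w)" unfolding N'_def by force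
  then show ?thesis by (rule finite_subset) simp
qed

lemma N'_pos: "w \<in> canonical_words k \<Longrightarrow> b \<in> N' j w \<Longrightarrow> 0 < b"
  using reduced_form_expand[of w k] unfolding N'_def by fastforce

lemma finite_N_hat: "w \<in> canonical_words k \<Longrightarrow> finite (N_hat j w)"
proof -
  assume w: "w \<in> canonical_words k"
  have "N_hat j w \<subseteq> (\<Union>b\<in>N' j w. {..b})"
  proof
    fix c assume "c \<in> N_hat j w"
    then obtain b where b: "b \<in> N' j w" "c dvd b" unfolding N_hat_def by blast
    then have "c \<le> b" using N'_pos[OF w b(1)] by (intro dvd_imp_le)
    then show "c \<in> (\<Union>b\<in>N' j w. {..b})" using b(1) by blast
  qed
  then show ?thesis by (rule finite_subset) (simp add: finite_N')
qed

lemma N_set_interval: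
  assumes "w \<in> canonical_words k" "b \<in> N' j w" "1 \<le> c" "c \<le> b"
  shows "c \<in> N_set j w"
proof -
  have "b \<in> N_hat j w" unfolding N_hat_def using assms(2) by (intro CollectI bexI[of _ b]) simp_all
  then have "b \<le> Max (N_hat j w)" using finite_N_hat[OF assms(1)] by simp
  then have "c \<in> {1..Max (N_hat j w)}" using assms(3,4) by simp
  moreover have "N' j w \<noteq> {}" using assms(2) by blast
  ultimately show ?thesis unfolding N_set_def by simp
qed

lemma N_set_sum:
  assumes "a \<in> N' j w" "b \<in> N' j w"
  shows "a + b \<in> N_set j w"
proof -
  have "N' j w \<noteq> {}" using assms by blast
  then show ?thesis unfolding N_set_def using assms by (simp, blast)
qed

section \<open>The trail of a word\<close>

definition letter_perm :: "(nat \<Rightarrow> nat \<Rightarrow> nat) \<Rightarrow> nat \<times> int \<Rightarrow> nat \<Rightarrow> nat" where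
  "letter_perm \<tau> a = (if snd a = 1 then \<tau> (fst a) else inv_into UNIV (\<tau> (fst a)))"

lemma word_value_Nil: "word_value \<tau> [] = id"
  by (simp add: word_value_def)

lemma word_value_Cons: "word_value \<tau> (a # w) = letter_perm \<tau> a \<circ> word_value \<tau> w"
  by (cases a) (simp add: word_value_def letter_perm_def)

lemma word_value_append: "word_value \<tau> (u @ v) = word_value \<tau> u \<circ> word_value \<tau> v"
  by (induction u) (simp_all add: word_value_Nil word_value_Cons comp_assoc)

lemma word_value_concat_replicate: "word_value \<tau> (concat (replicate d w)) = word_value \<tau> w ^^ d"
  by (induction d) (simp_all add: word_value_Nil word_value_append)

lemma letter_perm_permutes:
  assumes "\<And>j. j \<in> {1..k} \<Longrightarrow> \<tau> j permutes S" "fst a \<in> {1..k}"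
  shows "letter_perm \<tau> a permutes S"
  using assms permutes_inv[OF assms(1)[OF assms(2)]] by (simp add: letter_perm_def)

lemma word_value_permutes:
  assumes "\<And>j. j \<in> {1..k} \<Longrightarrow> \<tau> j permutes S" "w \<in> canonical_words k"
  shows "word_value \<tau> w permutes S"
  using assms(2)
proof (induction w)
  case Nil
  show ?case unfolding word_value_Nil by (rule permutes_id)
next
  case (Cons a w)
  from canonical_ConsD[OF Cons.prems] have a: "fst a \<in> {1..k}" and w: "w \<in> canonical_words k" by auto
  show ?case unfolding word_value_Cons
    by (rule permutes_compose[OF Cons.IH[OF w] letter_perm_permutes[OF assms(1) a]])
qed

lemma mod_add_cancel_nat:
  fixes a b q r :: nat
  assumes "(a + q) mod r = (b + q) mod r"
  shows "a mod r = b mod r"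
proof (cases "r = 0")
  case True
  then show ?thesis using assms by simp
next
  case False
  \<comment> \<open>Adding \<open>q * (r - 1)\<close> plays the part of subtracting \<open>q\<close>
    modulo \<open>r\<close>.\<close>
  have e: "x + q + q * (r - 1) = x + q * r" for x using False by (cases r) simp_all
  have "(a + q + q * (r - 1)) mod r = (b + q + q * (r - 1)) mod r" using assms by (rule mod_add_cong) simp
  then show ?thesis unfolding e by simp
qed

section \<open>A word read cyclically\<close>

locale cyclic_word =
  fixes k :: nat and w :: fword and ms :: "nat list"
  assumes can: "w \<in> canonical_words k" and ne: "w \<noteq> []" and ends: "fst (last w) \<noteq> fst (hd w)"
    and prim: "\<not> is_power k w" and ms_pos: "\<And>m. m \<in> set ms \<Longrightarrow> 1 \<le> m"
begin

abbreviation r :: nat where "r \<equiv> length w"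

text \<open>The rightmost letter of a word acts first, so the letters are read in reverse order.\<close>

definition letter :: "nat \<Rightarrow> nat \<times> int" where
  "letter t = rev w ! (t mod r)"

text \<open>The pair \<open>(i, t)\<close> is time \<open>t\<close> of the closed trajectory
  \<open>i\<close>, which reads the word \<open>ms ! i\<close> times before it closes up.\<close>

definition positions :: "(nat \<times> nat) set" where
  "positions = {(i, t). i < length ms \<and> t < r * ms ! i}"

definition next_pos :: "nat \<times> nat \<Rightarrow> nat \<times> nat" where
  "next_pos = (\<lambda>(i, t). (i, Suc t mod (r * ms ! i)))"

definition colour :: "nat \<times> nat \<Rightarrow> nat" where
  "colour = (\<lambda>(i, t). fst (letter t))"

definition positive :: "nat \<times> nat \<Rightarrow> bool" where
  "positive = (\<lambda>(i, t). snd (letter t) = 1)"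

lemma r_pos: "0 < r"
  using ne by simp

lemma letter_mod: "t mod r = t' mod r \<Longrightarrow> letter t = letter t'"
  unfolding letter_def by simp

lemma letter_mod_mult: "letter (t mod (r * m)) = letter t"
  by (rule letter_mod) (simp add: mod_mod_cancel)

lemma letter_eq: "letter t = w ! (r - 1 - t mod r)"
  unfolding letter_def using r_pos by (simp add: rev_nth)

lemma letter_in: "letter t \<in> {1..k} \<times> {1, -1}"
proof -
  have "letter t \<in> set w" unfolding letter_eq using r_pos by (intro nth_mem) simp
  then show ?thesis using can unfolding canonical_words_def by blast
qed

text \<open>Inside a copy of \<open>w\<close> this is canonicity; at the seam between two copies the
  generators differ by \<open>ends\<close>.\<close>

lemma letter_Suc:
  assumes "fst (letter (Suc t)) = fst (letter t)"
  shows "letter (Suc t) = letter t"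
proof (cases "Suc (t mod r) = r")
  case True
  then have "letter (Suc t) = last w" unfolding letter_eq using r_pos ne by (simp add: mod_Suc last_conv_nth)
  moreover have "letter t = hd w"
  proof -
    have "r - 1 - t mod r = 0" using True by simp
    then show ?thesis unfolding letter_eq using ne by (simp add: hd_conv_nth)
  qed
  ultimately show ?thesis using assms ends by simp
next
  case False
  define a where "a = r - 1 - Suc (t mod r)"
  have lt: "Suc (t mod r) < r" using False mod_less_divisor[OF r_pos, of t] by linarith
  have "Suc t mod r = Suc (t mod r)" using False by (simp add: mod_Suc)
  then have 1: "letter (Suc t) = w ! a" unfolding letter_eq a_def by simp
  have "r - 1 - t mod r = a + 1" using lt unfolding a_def by simp
  then have 2: "letter t = w ! (a + 1)" unfolding letter_eq by simp
  have "w ! (a + 1) = w ! a"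
  proof (rule canonical_run_sign[OF can])
    show "a + 1 < r" using lt unfolding a_def by simp
    show "fst (w ! x) = fst (letter t)" if "a \<le> x" "x \<le> a + 1" for x
    proof -
      have "x = a \<or> x = a + 1" using that by linarith
      then show ?thesis using 1 2 assms by auto
    qed
  qed
  then show ?thesis using 1 2 by simp
qed

lemma letter_run:
  assumes j: "j = fst (letter t)"
  obtains a b where "b \<in> N' j w" "a \<le> t mod r" "t mod r < a + b" "a + b \<le> r"
    "\<And>x. a \<le> x \<Longrightarrow> x < a + b \<Longrightarrow> fst (letter x) = j" "fst (letter (a + b)) \<noteq> j" "fst (letter (a + r - 1)) \<noteq> j"
proof -
  have lt: "t mod r < r" using r_pos by simp
  have p: "r - 1 - t mod r < r" "j = fst (w ! (r - 1 - t mod r))" using r_pos j unfolding letter_eq by simp_all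
  obtain a' b where ab: "b \<in> N' j w" "a' \<le> r - 1 - t mod r" "r - 1 - t mod r < a' + b" "a' + b \<le> r"
    "\<And>x. a' \<le> x \<Longrightarrow> x < a' + b \<Longrightarrow> fst (w ! x) = j"
    "a' = 0 \<or> fst (w ! (a' - 1)) \<noteq> j" "a' + b = r \<or> fst (w ! (a' + b)) \<noteq> j"
    by (rule maximal_run_in_N'[OF can p]) (rule that)
  \<comment> \<open>Letters are read from the right, so the run at \<open>a'\<close> to
    \<open>a' + b - 1\<close> in \<open>w\<close> is read at times \<open>a\<close> to
    \<open>a + b - 1\<close>. Below, \<open>a + r - 1\<close> denotes the time before
    \<open>a\<close>, with \<open>r\<close> added to avoid a negative number.\<close>
  define a where "a = r - (a' + b)"
  have nth: "letter x = w ! (r - 1 - x)" if "x < r" for x unfolding letter_eq using that by simp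
  have hdl: "hd w = w ! 0" "last w = w ! (r - 1)" using ne by (simp_all add: hd_conv_nth last_conv_nth)
  show ?thesis
  proof (rule that[of b a])
    show "b \<in> N' j w" by (rule ab(1))
    show "a \<le> t mod r" "t mod r < a + b" "a + b \<le> r" using ab(2-4) lt unfolding a_def by linarith+
    show "fst (letter x) = j" if "a \<le> x" "x < a + b" for x
    proof -
      have "x < r" using that ab(4) unfolding a_def by linarith
      then show ?thesis using nth[of x] ab(5)[of "r - 1 - x"] that ab(4) unfolding a_def by simp
    qed
    show "fst (letter (a + b)) \<noteq> j"
    proof (cases "a' = 0")
      case True
      then have "a + b = r" using ab(4) unfolding a_def by simp
      then have "letter (a + b) = last w" using nth[of 0] letter_mod[of r 0] r_pos hdl by simp
      moreover have "fst (hd w) = j" using ab(5)[of 0] True ab(2,3) hdl by simp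
      ultimately show ?thesis using ends by simp
    next
      case False
      have "a + b < r" "r - 1 - (a + b) = a' - 1" using False ab(4) unfolding a_def by simp_all
      then show ?thesis using nth[of "a + b"] ab(6) False by simp
    qed
    show "fst (letter (a + r - 1)) \<noteq> j"
    proof (cases "a' + b = r")
      case True
      then have "a = 0" unfolding a_def by simp
      then have "letter (a + r - 1) = hd w" using nth[of "r - 1"] r_pos hdl by simp
      moreover have "fst (last w) = j" using ab(5)[of "r - 1"] True ab(2,3) hdl r_pos by simp
      ultimately show ?thesis using ends by auto
    next
      case False
      then have a: "0 < a" using ab(4) unfolding a_def by simp
      have "a \<le> r" unfolding a_def by simp
      have "(a + r - 1) mod r = (a - 1 + r) mod r" using a by simp
      then have "letter (a + r - 1) = letter (a - 1)" by (intro letter_mod) simp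
      moreover have "a - 1 < r" "r - 1 - (a - 1) = a' + b" using a \<open>a \<le> r\<close> False ab(4) unfolding a_def by simp_all
      ultimately show ?thesis using nth[of "a - 1"] ab(7) False by simp
    qed
  qed
qed

lemma ms_nth_pos: "i < length ms \<Longrightarrow> 1 \<le> ms ! i"
  using ms_pos nth_mem by blast

lemma next_pow:
  assumes "(i, t) \<in> positions"
  shows "(next_pos ^^ q) (i, t) = (i, (t + q) mod (r * ms ! i))"
proof (induction q)
  case 0
  then show ?case using assms unfolding positions_def by simp
next
  case (Suc q)
  then show ?case by (simp add: next_pos_def mod_Suc_eq)
qed

lemma letter_next_pow:
  assumes "(i, t) \<in> positions"
  shows "colour ((next_pos ^^ q) (i, t)) = fst (letter (t + q))"
    "positive ((next_pos ^^ q) (i, t)) \<longleftrightarrow> snd (letter (t + q)) = 1"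
  unfolding next_pow[OF assms] colour_def positive_def by (simp_all add: letter_mod_mult)

lemma finite_positions: "finite positions"
proof (rule finite_subset)
  show "positions \<subseteq> (SIGMA i:{..<length ms}. {..<r * ms ! i})" unfolding positions_def by auto
qed auto

lemma cycle_len_pos: "i < length ms \<Longrightarrow> 0 < r * ms ! i"
  using r_pos ms_nth_pos[of i] by simp

lemma next_in: "p \<in> positions \<Longrightarrow> next_pos p \<in> positions"
  unfolding positions_def next_pos_def using cycle_len_pos by auto

lemma pred_pos:
  assumes "(i, t) \<in> positions"
  shows "(i, (t + r * ms ! i - 1) mod (r * ms ! i)) \<in> positions"
    "next_pos (i, (t + r * ms ! i - 1) mod (r * ms ! i)) = (i, t)"
proof -
  have R: "0 < r * ms ! i" "i < length ms" "t < r * ms ! i" using assms cycle_len_pos unfolding positions_def by auto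
  then show "(i, (t + r * ms ! i - 1) mod (r * ms ! i)) \<in> positions" unfolding positions_def by simp
  have "Suc ((t + r * ms ! i - 1) mod (r * ms ! i)) mod (r * ms ! i) = Suc (t + r * ms ! i - 1) mod (r * ms ! i)"
    by (rule mod_Suc_eq)
  also have "Suc (t + r * ms ! i - 1) = t + r * ms ! i" using R(1) by simp
  finally show "next_pos (i, (t + r * ms ! i - 1) mod (r * ms ! i)) = (i, t)"
    unfolding next_pos_def using R(3) by simp
qed

lemma bij_next: "bij_betw next_pos positions positions"
proof -
  have "next_pos ` positions = positions"
  proof (intro equalityI subsetI)
    show "p \<in> positions" if "p \<in> next_pos ` positions" for p using that next_in by blast
    show "p \<in> next_pos ` positions" if p: "p \<in> positions" for p
    proof -
      obtain i t where it: "p = (i, t)" by (cases p)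
      show ?thesis using pred_pos[of i t] p unfolding it by (metis imageI)
    qed
  qed
  moreover from this have "inj_on next_pos positions"
    by (intro eq_card_imp_inj_on[OF finite_positions]) simp
  ultimately show ?thesis unfolding bij_betw_def by blast
qed

lemma trail: "trail positions next_pos colour positive {1..k} (\<lambda>j. N' j w)"
proof
  show "finite positions" by (rule finite_positions)
  show "finite {1..k}" by simp
  show "bij_betw next_pos positions positions" by (rule bij_next)
  show "colour p \<in> {1..k}" for p using letter_in[of "snd p"] unfolding colour_def by (cases p) auto
  show "positive (next_pos p) = positive p" if p: "p \<in> positions" "colour (next_pos p) = colour p" for p
  proof -
    obtain i t where it: "p = (i, t)" by (cases p)
    have 1: "colour (next_pos p) = fst (letter (Suc t))" "positive (next_pos p) = (snd (letter (Suc t)) = 1)"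
      unfolding it colour_def positive_def next_pos_def by (simp_all add: letter_mod_mult)
    have "letter (Suc t) = letter t" using p(2) unfolding 1 by (intro letter_Suc) (simp add: it colour_def)
    then show ?thesis unfolding 1 by (simp add: it positive_def)
  qed
  fix p assume p: "p \<in> positions"
  obtain i t where it: "p = (i, t)" by (cases p)
  let ?R = "r * ms ! i"
  have R: "t < ?R" "i < length ms" "1 \<le> ms ! i" using p ms_nth_pos unfolding it positions_def by auto
  define j where "j = fst (letter t)"
  have cp: "colour p = j" unfolding it j_def colour_def by simp
  obtain a b where ab: "b \<in> N' j w" "a \<le> t mod r" "t mod r < a + b" "a + b \<le> r"
    "\<And>x. a \<le> x \<Longrightarrow> x < a + b \<Longrightarrow> fst (letter x) = j" "fst (letter (a + b)) \<noteq> j" "fst (letter (a + r - 1)) \<noteq> j"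
    by (rule letter_run[OF j_def]) (rule that)
  \<comment> \<open>The start of the run, in the same copy of \<open>w\<close> as \<open>t\<close>;
    runs never cross a seam.\<close>
  define t0 where "t0 = t - (t mod r - a)"
  have t0: "t0 = t div r * r + a" "t0 + (t mod r - a) = t" "t0 < ?R"
    using ab(2) R(1) div_mult_mod_eq[of t r] unfolding t0_def by linarith+
  have m0: "(t0 + x) mod r = (a + x) mod r" for x
    unfolding t0(1) by (simp add: add.assoc)
  have P0: "(i, t0) \<in> positions" using R t0(3) unfolding positions_def by simp
  show "\<exists>t0\<in>positions. \<exists>b\<in>N' (colour p) w. \<exists>i<b. p = (next_pos ^^ i) t0 \<and>
          (\<forall>i<b. colour ((next_pos ^^ i) t0) = colour p) \<and> colour ((next_pos ^^ b) t0) \<noteq> colour p \<and>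
          (\<exists>t1\<in>positions. next_pos t1 = t0 \<and> colour t1 \<noteq> colour p)"
    unfolding cp
  proof (rule bexI[OF _ P0], rule bexI[OF _ ab(1)], rule exI[of _ "t mod r - a"], intro conjI allI impI)
    show "t mod r - a < b" using ab(2,3) by linarith
    show "p = (next_pos ^^ (t mod r - a)) (i, t0)" unfolding next_pow[OF P0] t0(2) it using R(1) by simp
    show "colour ((next_pos ^^ x) (i, t0)) = j" if "x < b" for x
      unfolding letter_next_pow[OF P0] using letter_mod[OF m0[of x]] ab(5)[of "a + x"] that by simp
    show "colour ((next_pos ^^ b) (i, t0)) \<noteq> j"
      unfolding letter_next_pow[OF P0] using letter_mod[OF m0[of b]] ab(6) by simp
    show "\<exists>t1\<in>positions. next_pos t1 = (i, t0) \<and> colour t1 \<noteq> j"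
    proof (intro bexI[OF _ pred_pos(1)[OF P0]] conjI pred_pos(2)[OF P0])
      have "?R = r * (ms ! i - 1) + r" using R(3) by (cases "ms ! i") simp_all
      then have "t0 + ?R - 1 = (t0 + (r - 1)) + r * (ms ! i - 1)" using r_pos by linarith
      then have "(t0 + ?R - 1) mod r = (t0 + (r - 1)) mod r" by simp
      also have "\<dots> = (a + (r - 1)) mod r" by (rule m0)
      also have "a + (r - 1) = a + r - 1" using r_pos by linarith
      finally have "letter (t0 + ?R - 1) = letter (a + r - 1)" by (rule letter_mod)
      then show "colour (i, (t0 + ?R - 1) mod ?R) \<noteq> j"
        unfolding colour_def using ab(7) by (simp add: letter_mod_mult)
    qed
  qed
qed

sublocale trail positions next_pos colour positive "{1..k}" "\<lambda>j. N' j w"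
  by (rule trail)

section \<open>Rigidity for a word that is not a power\<close>

text \<open>Two readings that agree forever with different phases make \<open>w\<close> invariant
  under a nontrivial rotation, which is impossible when \<open>w\<close> is not a power.\<close>

lemma letter_shift_period:
  assumes "\<And>q. letter (x + q) = letter (y + q)"
  shows "x mod r = y mod r"
proof -
  have *: "x mod r = y mod r" if le: "x mod r \<le> y mod r" and L: "\<And>q. letter (x + q) = letter (y + q)" for x y
  proof (rule ccontr)
    assume ne': "x mod r \<noteq> y mod r"
    define \<delta> where "\<delta> = y mod r - x mod r"
    have ylt: "y mod r < r" using r_pos by simp
    have \<delta>: "0 < \<delta>" "\<delta> < r" using le ne' ylt unfolding \<delta>_def by linarith+
    have shift: "letter q = letter (\<delta> + q)" for q
    proof -
      have xlt: "x mod r < r" using r_pos by simp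
      define c where "c = r - x mod r + q"
      have "(x + c) mod r = (x mod r + c) mod r" by (simp add: mod_add_left_eq)
      also have "x mod r + c = q + r" using xlt unfolding c_def by simp
      finally have 1: "letter (x + c) = letter q" by (intro letter_mod) simp
      have "(y + c) mod r = (y mod r + c) mod r" by (simp add: mod_add_left_eq)
      also have "y mod r + c = \<delta> + q + r" using xlt le unfolding c_def \<delta>_def by simp
      finally have 2: "letter (y + c) = letter (\<delta> + q)" by (intro letter_mod) simp
      show ?thesis using L[of c] 1 2 by simp
    qed
    have "drop \<delta> (rev w) @ take \<delta> (rev w) = rev w"
    proof (rule nth_equalityI)
      show "length (drop \<delta> (rev w) @ take \<delta> (rev w)) = length (rev w)" using \<delta> by simp
      fix q assume "q < length (drop \<delta> (rev w) @ take \<delta> (rev w))"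
      then have q: "q < r" using \<delta> by simp
      have "rev w ! q = rev w ! ((\<delta> + q) mod r)" using shift[of q] q unfolding letter_def by simp
      moreover have "(drop \<delta> (rev w) @ take \<delta> (rev w)) ! q = rev w ! ((\<delta> + q) mod r)"
      proof (cases "\<delta> + q < r")
        case True
        then have "q < r - \<delta>" by linarith
        then show ?thesis using \<delta> True by (simp add: nth_append)
      next
        case False
        then have "(\<delta> + q) mod r = \<delta> + q - r" using \<delta> q by (simp add: le_mod_geq)
        have "\<not> q < r - \<delta>" "\<delta> + q - r = q - (r - \<delta>)" "q - (r - \<delta>) < \<delta>" using False \<delta> q by linarith+
        then show ?thesis using \<open>(\<delta> + q) mod r = \<delta> + q - r\<close> by (simp add: nth_append)
      qed
      ultimately show "(drop \<delta> (rev w) @ take \<delta> (rev w)) ! q = rev w ! q" by simp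
    qed
    then show False using not_is_power_rotate[OF can prim \<delta>] by blast
  qed
  show ?thesis
  proof (cases "x mod r \<le> y mod r")
    case True
    then show ?thesis using *[of x y] assms by blast
  next
    case False
    then show ?thesis using *[of y x] assms by (metis nat_le_linear)
  qed
qed

text \<open>The times at which a new copy of the word begins. Their labels are the successive points
  of a cycle of \<open>word_value \<tau> w\<close>, so they are the ones that must be
  distinct.\<close>

definition base_points :: "(nat \<times> nat) set" where
  "base_points = {(i, t) \<in> positions. r dvd t}"

lemma base_points_subset: "base_points \<subseteq> positions"
  unfolding base_points_def by blast

text \<open>If two times with equal labels read the same letters forever, they have the same phase;
  advanced to the next base point, they are still identified and therefore equal. If one reading
  retraces the other backwards, the two meet halfway, where either a letter is its own inverse or
  two adjacent letters are mutually inverse. That is why \<open>w\<close> is not conjugate to its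
  inverse.\<close>

lemma rigid_word:
  fixes \<rho> :: "nat \<times> nat \<Rightarrow> 'v"
  assumes fold: "folded \<rho>" and H: "\<And>v. v \<in> \<rho> ` positions \<Longrightarrow> card (half_edges \<rho> v) = 2"
    and B: "inj_on \<rho> base_points"
  shows "inj_on \<rho> positions"
proof (rule inj_onI)
  fix p p' assume p: "p \<in> positions" "p' \<in> positions" "\<rho> p = \<rho> p'"
  obtain u where u: "u \<in> positions" "p' = next_pos u"
    using p(2) bij_next unfolding bij_betw_def by blast
  obtain i x where ix: "p = (i, x)" by (cases p)
  obtain i' x' where ix': "p' = (i', x')" by (cases p')
  obtain iu y where iy: "u = (iu, y)" by (cases u)
  note P = p(1)[unfolded ix] and P' = p(2)[unfolded ix'] and U = u(1)[unfolded iy]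
  have snd_letter: "snd (letter t) = 1 \<or> snd (letter t) = -1" for t using letter_in[of t] by auto
  from rigid[OF fold H p(1) u(1)] p(3) u(2)
  consider (same) "\<And>q. \<rho> ((next_pos ^^ q) p) = \<rho> ((next_pos ^^ q) p') \<and>
      colour ((next_pos ^^ q) p) = colour ((next_pos ^^ q) p') \<and> positive ((next_pos ^^ q) p) = positive ((next_pos ^^ q) p')"
    | (opp) "\<And>q u'. u' \<in> positions \<Longrightarrow> (next_pos ^^ q) u' = u \<Longrightarrow>
      colour ((next_pos ^^ q) p) = colour u' \<and> positive ((next_pos ^^ q) p) = (\<not> positive u')"
    by auto
  then show "p = p'"
  proof cases
    case same
    have "letter (x + q) = letter (x' + q)" for q
      using same[of q] snd_letter[of "x + q"] snd_letter[of "x' + q"]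
      unfolding ix ix' letter_next_pow[OF P] letter_next_pow[OF P'] by (auto simp: prod_eq_iff)
    then have mod: "x mod r = x' mod r" by (rule letter_shift_period)
    define q where "q = r - x mod r"
    have xq: "r dvd x + q"
    proof -
      have "x + q = x div r * r + r" using div_mult_mod_eq[of x r] mod_less_divisor[OF r_pos, of x] unfolding q_def by linarith
      then show ?thesis by simp
    qed
    have xq': "r dvd x' + q"
    proof -
      have "x' + q = x' div r * r + r"
        using div_mult_mod_eq[of x' r] mod_less_divisor[OF r_pos, of x'] mod unfolding q_def by linarith
      then show ?thesis by simp
    qed
    have base: "(next_pos ^^ q) (a, t) \<in> base_points" if "(a, t) \<in> positions" "r dvd t + q" for a t
    proof -
      have "r dvd (t + q) mod (r * ms ! a)" using that(2) by (simp add: dvd_mod)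
      moreover have "(next_pos ^^ q) (a, t) \<in> positions" by (rule s_pow_in[OF that(1)])
      ultimately show ?thesis unfolding base_points_def next_pow[OF that(1)] by simp
    qed
    have "(next_pos ^^ q) p = (next_pos ^^ q) p'"
      using inj_onD[OF B] same[of q] base[OF P xq] base[OF P' xq'] unfolding ix ix' by blast
    moreover have "inj_on (next_pos ^^ q) positions"
      using bij_betw_funpow[OF bij_next, of q] unfolding bij_betw_def by blast
    ultimately show ?thesis using p inj_onD by metis
  next
    case opp
    have iu: "iu < length ms" "y < r * ms ! iu" using U unfolding positions_def by auto
    let ?R = "r * ms ! iu"
    have anti: "fst (letter (x + q)) = fst (letter z) \<and> (snd (letter (x + q)) = 1 \<longleftrightarrow> snd (letter z) \<noteq> 1)"
      if z: "(z + q) mod r = y mod r" for q z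
    proof -
      \<comment> \<open>The time \<open>q\<close> steps before \<open>y\<close> on its trajectory,
        with \<open>q * (?R - 1)\<close> standing for \<open>- q\<close> modulo
        \<open>?R\<close>.\<close>
      let ?t = "(y + q * (?R - 1)) mod ?R"
      have R0: "0 < ?R" using iu by linarith
      have u': "(iu, ?t) \<in> positions" using iu R0 unfolding positions_def by simp
      have e: "y + q * (?R - 1) + q = y + q * ?R"
        using R0 by (cases ?R) (simp_all add: algebra_simps)
      have "(?t + q) mod ?R = (y + q * (?R - 1) + q) mod ?R" by (simp add: mod_add_left_eq)
      then have "(next_pos ^^ q) (iu, ?t) = u" unfolding next_pow[OF u'] iy e using iu(2) by simp
      note o = opp[OF u' this]
      have "letter ?t = letter z"
      proof -
        have "(y + q * (?R - 1) + q) mod r = y mod r" unfolding e by (simp add: mult.left_commute[of q r])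
        then have "(y + q * (?R - 1) + q) mod r = (z + q) mod r" using z by simp
        then have "(y + q * (?R - 1)) mod r = z mod r" by (rule mod_add_cancel_nat)
        then have "letter (y + q * (?R - 1)) = letter z" by (rule letter_mod)
        then show ?thesis by (simp only: letter_mod_mult)
      qed
      then show ?thesis using o unfolding ix letter_next_pow[OF P] by (simp add: colour_def positive_def)
    qed
    \<comment> \<open>The distance from \<open>x\<close> to \<open>y\<close> modulo
      \<open>r\<close>; the multiple \<open>r * x\<close> keeps the difference from being
      truncated.\<close>
    define D where "D = y + r * x - x"
    have D: "x + D = y + r * x" using r_pos unfolding D_def by (cases r) simp_all
    show ?thesis
    proof (cases "even D")
      case True
      then obtain q where q: "D = q + q" by (metis evenE mult_2)
      have "((x + q) + q) mod r = y mod r" using D unfolding q by (simp add: add.assoc)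
      from anti[OF this] show ?thesis by simp
    next
      case False
      then obtain q where q: "D = q + q + 1" by (metis oddE mult_2)
      have "(Suc (x + q) + q) mod r = y mod r" using D unfolding q by (simp add: add.assoc)
      from anti[OF this] have a: "fst (letter (x + q)) = fst (letter (Suc (x + q)))"
        "snd (letter (x + q)) = 1 \<longleftrightarrow> snd (letter (Suc (x + q))) \<noteq> 1" by blast+
      then show ?thesis using letter_Suc[of "x + q"] by simp
    qed
  qed
qed

end

section \<open>Cycle tuples as closed trajectories\<close>

text \<open>Exact cycle lengths and distinct cycles are both encoded in one injectivity: each
  trajectory closes after the prescribed number of steps, and no two of the points listed before
  closing coincide. This is the form in which trails express it.\<close>

lemma cycle_tuples_iff:
  assumes \<pi>: "permutation \<pi>" and pos: "\<And>i. i < length ms \<Longrightarrow> 1 \<le> ms ! i"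
    and x: "x \<in> {..<length ms} \<rightarrow>\<^sub>E {1..n}"
  shows "x \<in> cycle_tuples n \<pi> ms \<longleftrightarrow> (\<forall>i<length ms. (\<pi> ^^ (ms ! i)) (x i) = x i) \<and>
     inj_on (\<lambda>(i, q). (\<pi> ^^ q) (x i)) (SIGMA i:{..<length ms}. {..<ms ! i})"
    (is "_ \<longleftrightarrow> ?fix \<and> inj_on ?f ?S")
proof
  assume "x \<in> cycle_tuples n \<pi> ms"
  then have c: "\<And>i. i < length ms \<Longrightarrow> card (orbit \<pi> (x i)) = ms ! i"
    and o: "inj_on (\<lambda>i. orbit \<pi> (x i)) {..<length ms}" unfolding cycle_tuples_def by blast+
  have ?fix using funpow_eq_self_iff_card_orbit_dvd[OF \<pi>] c by simp
  moreover have "inj_on ?f ?S"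
  proof (rule inj_onI)
    fix u u' assume u: "u \<in> ?S" "u' \<in> ?S" "?f u = ?f u'"
    obtain i q where iq: "u = (i, q)" by (cases u)
    obtain i' q' where iq': "u' = (i', q')" by (cases u')
    have *: "i \<in> {..<length ms}" "q \<in> {..<ms ! i}" "i' \<in> {..<length ms}" "q' \<in> {..<ms ! i'}"
      and eq: "(\<pi> ^^ q) (x i) = (\<pi> ^^ q') (x i')"
      using u unfolding iq iq' by simp_all
    have "(\<pi> ^^ q) (x i) \<in> orbit \<pi> (x i)" "(\<pi> ^^ q') (x i') \<in> orbit \<pi> (x i')"
      unfolding orbit_altdef_permutation[OF \<pi>] by blast+
    then have "orbit \<pi> (x i) = orbit \<pi> (x i')" using orbit_eq_iff[OF \<pi>] eq by metis
    then have i: "i = i'" using inj_onD[OF o] *(1,3) by blast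
    have same: "b = a" if "a \<le> b" "b < ms ! i" "(\<pi> ^^ a) (x i) = (\<pi> ^^ b) (x i)" for a b
    proof -
      have "(\<pi> ^^ (b - a)) (x i) = x i"
        using that by (intro funpow_diff) (use \<pi> in \<open>simp_all add: permutation_bijective bij_is_inj\<close>)
      then have "ms ! i dvd b - a" using funpow_eq_self_iff_card_orbit_dvd[OF \<pi>] c *(1) by simp
      moreover have "b - a < ms ! i" using that(2) by simp
      ultimately have "b - a = 0" using nat_dvd_not_less by blast
      then show ?thesis using that(1) by simp
    qed
    have "q = q'"
    proof (cases "q \<le> q'")
      case True
      then show ?thesis using same[of q q'] eq *(4) i by simp
    next
      case False
      then show ?thesis using same[of q' q] eq *(2) i by simp
    qed
    then show "u = u'" using i unfolding iq iq' by simp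
  qed
  ultimately show "?fix \<and> inj_on ?f ?S" by blast
next
  assume a: "?fix \<and> inj_on ?f ?S"
  then have fix': "\<And>i. i < length ms \<Longrightarrow> (\<pi> ^^ (ms ! i)) (x i) = x i" and inj: "inj_on ?f ?S" by blast+
  have injD: "i = i' \<and> q = q'" if "i < length ms" "q < ms ! i" "i' < length ms" "q' < ms ! i'"
     "(\<pi> ^^ q) (x i) = (\<pi> ^^ q') (x i')" for i q i' q'
    using inj_onD[OF inj, of "(i, q)" "(i', q')"] that by simp
  have c: "card (orbit \<pi> (x i)) = ms ! i" if i: "i < length ms" for i
  proof -
    let ?c = "card (orbit \<pi> (x i))"
    have d: "?c dvd ms ! i" using fix'[OF i] funpow_eq_self_iff_card_orbit_dvd[OF \<pi>] by blast
    then have le: "?c \<le> ms ! i" using pos[OF i] by (intro dvd_imp_le) auto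
    have c0: "0 < ?c" by (rule card_orbit_pos[OF \<pi>])
    have "(\<pi> ^^ ?c) (x i) = x i" using funpow_eq_self_iff_card_orbit_dvd[OF \<pi>, of ?c "x i"] by simp
    then have "\<not> ?c < ms ! i" using injD[OF i _ i, of ?c 0] c0 pos[OF i] by auto
    then show ?thesis using le by simp
  qed
  have "inj_on (\<lambda>i. orbit \<pi> (x i)) {..<length ms}"
  proof (rule inj_onI)
    fix i i' assume *: "i \<in> {..<length ms}" "i' \<in> {..<length ms}" "orbit \<pi> (x i) = orbit \<pi> (x i')"
    then have "x i' \<in> orbit \<pi> (x i)" using orbit_eq_iff[OF \<pi>] by metis
    then obtain q where "x i' = (\<pi> ^^ q) (x i)" unfolding orbit_altdef_permutation[OF \<pi>] by blast
    then have "x i' = (\<pi> ^^ (q mod ms ! i)) (x i)" using funpow_mod_eq[OF fix'] *(1) by simp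
    then have eq: "(\<pi> ^^ (q mod ms ! i)) (x i) = (\<pi> ^^ 0) (x i')" by simp
    have l: "i < length ms" "i' < length ms" using *(1,2) by simp_all
    then have "q mod ms ! i < ms ! i" "0 < ms ! i'" using pos[OF l(1)] pos[OF l(2)] by simp_all
    from injD[OF l(1) this(1) l(2) this(2) eq] show "i = i'" by (rule conjunct1)
  qed
  then show "x \<in> cycle_tuples n \<pi> ms" unfolding cycle_tuples_def using x c by blast
qed

context cyclic_word
begin

primrec traj :: "(nat \<Rightarrow> nat \<Rightarrow> nat) \<Rightarrow> nat \<Rightarrow> nat \<Rightarrow> nat" where
  "traj \<tau> x 0 = x"
| "traj \<tau> x (Suc t) = letter_perm \<tau> (letter t) (traj \<tau> x t)"

lemma traj_word: "t \<le> r \<Longrightarrow> traj \<tau> x t = word_value \<tau> (rev (take t (rev w))) x"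
proof (induction t)
  case 0
  then show ?case by (simp add: word_value_Nil)
next
  case (Suc t)
  have "take (Suc t) (rev w) = take t (rev w) @ [rev w ! t]" using Suc.prems by (intro take_Suc_conv_app_nth) simp
  moreover have "letter t = rev w ! t" using Suc.prems unfolding letter_def by simp
  ultimately show ?case using Suc by (simp add: word_value_Cons)
qed

lemma traj_length: "traj \<tau> x r = word_value \<tau> w x"
  using traj_word[of r \<tau> x] by simp

lemma traj_length_add: "traj \<tau> x (r + t) = traj \<tau> (word_value \<tau> w x) t"
proof (induction t)
  case 0
  then show ?case using traj_length by simp
next
  case (Suc t)
  have "letter (r + t) = letter t" by (rule letter_mod) simp
  then show ?case using Suc by simp
qed

lemma traj_mult: "traj \<tau> x (r * q) = (word_value \<tau> w ^^ q) x"
proof (induction q arbitrary: x)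
  case (Suc q)
  have "traj \<tau> x (r * Suc q) = traj \<tau> (word_value \<tau> w x) (r * q)"
    using traj_length_add[of \<tau> x "r * q"] by simp
  then show ?case using Suc by (simp add: funpow_swap1)
qed simp

lemma obeys_iff_step:
  assumes \<tau>: "\<And>j. j \<in> {1..k} \<Longrightarrow> \<tau> j permutes {1..n}"
  shows "(\<forall>j\<in>{1..k}. obeys y j (\<tau> j)) \<longleftrightarrow>
     (\<forall>(i, t)\<in>positions. y (next_pos (i, t)) = letter_perm \<tau> (letter t) (y (i, t)))"
proof -
  have col: "colour p \<in> {1..k}" if "p \<in> positions" for p using colK that by blast
  have "(\<forall>j\<in>{1..k}. obeys y j (\<tau> j)) \<longleftrightarrow> (\<forall>p\<in>positions. \<tau> (colour p) (y (src p)) = y (tgt p))"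
    unfolding obeys_def using col by blast
  also have "\<dots> \<longleftrightarrow> (\<forall>(i, t)\<in>positions. y (next_pos (i, t)) = letter_perm \<tau> (letter t) (y (i, t)))"
  proof (rule ball_cong[OF refl])
    fix p assume p: "p \<in> positions"
    obtain i t where it: "p = (i, t)" by (cases p)
    have c: "colour p = fst (letter t)" "positive p \<longleftrightarrow> snd (letter t) = 1"
      unfolding it colour_def positive_def by simp_all
    note inv = permutes_inverses[OF \<tau>[OF col[OF p]]]
    have "\<tau> (colour p) (y (src p)) = y (tgt p) \<longleftrightarrow> y (next_pos p) = letter_perm \<tau> (letter t) (y p)"
    proof (cases "positive p")
      case True
      then show ?thesis using c unfolding src_def tgt_def letter_perm_def by auto
    next
      case False
      have "\<tau> (colour p) (y (next_pos p)) = y p \<longleftrightarrow> y (next_pos p) = inv_into UNIV (\<tau> (colour p)) (y p)"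
        using inv by metis
      then show ?thesis using False c unfolding src_def tgt_def letter_perm_def by auto
    qed
    then show "\<tau> (colour p) (y (src p)) = y (tgt p) \<longleftrightarrow>
        (case p of (i, t) \<Rightarrow> y (next_pos (i, t)) = letter_perm \<tau> (letter t) (y (i, t)))"
      unfolding it by simp
  qed
  finally show ?thesis .
qed

lemma letter_perm_in:
  assumes \<tau>: "\<And>j. j \<in> {1..k} \<Longrightarrow> \<tau> j permutes {1..n}" and v: "v \<in> {1..n}"
  shows "letter_perm \<tau> (letter t) v \<in> {1..n}"
proof -
  have "fst (letter t) \<in> {1..k}" using letter_in[of t] by auto
  then have "letter_perm \<tau> (letter t) permutes {1..n}" by (intro letter_perm_permutes[where k = k] \<tau>)
  from permutes_in_image[OF this, of v] show ?thesis using v by blast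
qed

text \<open>An obeying labelling is determined by its starting points, since each label forces the
  next one. Closing up means that \<open>ms ! i\<close> applications of the word fix the starting
  point, and distinct labels at base points mean distinct iterates.\<close>

lemma card_solutions:
  assumes \<tau>: "\<And>j. j \<in> {1..k} \<Longrightarrow> \<tau> j permutes {1..n}"
  shows "card {y \<in> {y \<in> positions \<rightarrow>\<^sub>E {1..n}. inj_on y base_points}. \<forall>j\<in>{1..k}. obeys y j (\<tau> j)} =
     card (cycle_tuples n (word_value \<tau> w) ms)"
proof -
  let ?\<pi> = "word_value \<tau> w" and ?p = "length ms"
  have "?\<pi> permutes {1..n}" by (intro word_value_permutes[where k = k] \<tau> can)
  then have \<pi>: "permutation ?\<pi>" by (rule permutes_permutation)
  let ?Y = "{y \<in> positions \<rightarrow>\<^sub>E {1..n}. inj_on y base_points \<and>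
     (\<forall>(i, t)\<in>positions. y (next_pos (i, t)) = letter_perm \<tau> (letter t) (y (i, t)))}"
  let ?f = "\<lambda>y. \<lambda>i\<in>{..<?p}. y (i, 0)"
  let ?g = "\<lambda>x. \<lambda>p\<in>positions. traj \<tau> (x (fst p)) (snd p)"
  let ?S = "SIGMA i:{..<?p}. {..<ms ! i}"
  have base: "base_points = (\<lambda>(i, q). (i, r * q)) ` ?S"
  proof (intro equalityI subsetI)
    fix p assume "p \<in> base_points"
    then obtain i t q where "p = (i, r * q)" "i < ?p" "r * q < r * ms ! i"
      unfolding base_points_def positions_def by (auto elim!: dvdE)
    then show "p \<in> (\<lambda>(i, q). (i, r * q)) ` ?S" by (intro image_eqI[of _ _ "(i, q)"]) auto
  next
    fix p assume "p \<in> (\<lambda>(i, q). (i, r * q)) ` ?S"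
    then show "p \<in> base_points" using r_pos unfolding base_points_def positions_def by auto
  qed
  have inj_base: "inj_on (\<lambda>(i, q). (i, r * q)) ?S" using r_pos by (auto simp: inj_on_def)
  have pos0: "(i, 0) \<in> positions" if "i < ?p" for i using cycle_len_pos[OF that] that unfolding positions_def by simp
  have traj_y: "y (i, t) = traj \<tau> (y (i, 0)) t"
    if st: "\<forall>(i, t)\<in>positions. y (next_pos (i, t)) = letter_perm \<tau> (letter t) (y (i, t))"
      and it: "(i, t) \<in> positions" for y :: "nat \<times> nat \<Rightarrow> nat" and i t
    using it
  proof (induction t)
    case (Suc t)
    have t: "(i, t) \<in> positions" using Suc.prems unfolding positions_def by auto
    have "next_pos (i, t) = (i, Suc t)" using Suc.prems unfolding next_pos_def positions_def by simp
    moreover have "y (next_pos (i, t)) = letter_perm \<tau> (letter t) (y (i, t))" using st t by blast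
    ultimately show ?case using Suc.IH[OF t] by simp
  qed simp
  have closing: "(?\<pi> ^^ (ms ! i)) (y (i, 0)) = y (i, 0)"
    if st: "\<forall>(i, t)\<in>positions. y (next_pos (i, t)) = letter_perm \<tau> (letter t) (y (i, t))"
      and i: "i < ?p" for y :: "nat \<times> nat \<Rightarrow> nat" and i
  proof -
    \<comment> \<open>\<open>R\<close> is the last time of trajectory \<open>i\<close>; its
      successor is time 0, which turns the final step into the closing condition.\<close>
    obtain R where R: "r * ms ! i = Suc R" using cycle_len_pos[OF i] by (cases "r * ms ! i") auto
    have P: "(i, R) \<in> positions" using i R unfolding positions_def by simp
    have "(?\<pi> ^^ (ms ! i)) (y (i, 0)) = letter_perm \<tau> (letter R) (traj \<tau> (y (i, 0)) R)"
      unfolding traj_mult[symmetric] R by simp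
    also have "\<dots> = letter_perm \<tau> (letter R) (y (i, R))" using traj_y[OF st P] by simp
    also have "\<dots> = y (next_pos (i, R))" using st P by fastforce
    also have "next_pos (i, R) = (i, 0)" unfolding next_pos_def by (simp add: R)
    finally show ?thesis .
  qed
  have inj_iff: "inj_on y base_points \<longleftrightarrow> inj_on (\<lambda>(i, q). (?\<pi> ^^ q) (y (i, 0))) ?S"
    if st: "\<forall>(i, t)\<in>positions. y (next_pos (i, t)) = letter_perm \<tau> (letter t) (y (i, t))" for y :: "nat \<times> nat \<Rightarrow> nat"
  proof -
    have "inj_on y base_points \<longleftrightarrow> inj_on (y \<circ> (\<lambda>(i, q). (i, r * q))) ?S"
      unfolding base by (rule comp_inj_on_iff[OF inj_base])
    also have "\<dots> \<longleftrightarrow> inj_on (\<lambda>(i, q). (?\<pi> ^^ q) (y (i, 0))) ?S"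
    proof (rule inj_on_cong)
      fix p assume p: "p \<in> ?S"
      then obtain i q where iq: "p = (i, q)" "i < ?p" "q < ms ! i" by auto
      then have "(i, r * q) \<in> positions" using r_pos unfolding positions_def by simp
      from traj_y[OF st this] show "(y \<circ> (\<lambda>(i, q). (i, r * q))) p = (\<lambda>(i, q). (?\<pi> ^^ q) (y (i, 0))) p"
        unfolding iq(1) by (simp add: traj_mult)
    qed
    finally show ?thesis .
  qed
  have bij: "bij_betw ?f ?Y (cycle_tuples n ?\<pi> ms)"
  proof (rule bij_betwI[where g = ?g])
    show "?f \<in> ?Y \<rightarrow> cycle_tuples n ?\<pi> ms"
    proof
      fix y assume y: "y \<in> ?Y"
      then have st: "\<forall>(i, t)\<in>positions. y (next_pos (i, t)) = letter_perm \<tau> (letter t) (y (i, t))"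
        and yP: "y \<in> positions \<rightarrow>\<^sub>E {1..n}" and yi: "inj_on y base_points" by blast+
      have x: "?f y \<in> {..<?p} \<rightarrow>\<^sub>E {1..n}"
        using PiE_mem[OF yP pos0] by (intro restrict_PiE_iff[THEN iffD2] ballI) simp
      have "inj_on (\<lambda>(i, q). (?\<pi> ^^ q) (?f y i)) ?S \<longleftrightarrow> inj_on (\<lambda>(i, q). (?\<pi> ^^ q) (y (i, 0))) ?S"
        by (rule inj_on_cong) auto
      then show "?f y \<in> cycle_tuples n ?\<pi> ms"
        using closing[OF st] yi inj_iff[OF st]
        by (subst cycle_tuples_iff[OF \<pi> ms_nth_pos x]) simp_all
    qed
    show "?g \<in> cycle_tuples n ?\<pi> ms \<rightarrow> ?Y"
    proof
      fix x assume x: "x \<in> cycle_tuples n ?\<pi> ms"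
      then have xP: "x \<in> {..<?p} \<rightarrow>\<^sub>E {1..n}" unfolding cycle_tuples_def by blast
      have fx: "(?\<pi> ^^ (ms ! i)) (x i) = x i" if "i < ?p" for i
        using x that cycle_tuples_iff[OF \<pi> ms_nth_pos xP] by blast
      have xinj: "inj_on (\<lambda>(i, q). (?\<pi> ^^ q) (x i)) ?S"
        using x cycle_tuples_iff[OF \<pi> ms_nth_pos xP] by blast
      have gv: "?g x (i, t) = traj \<tau> (x i) t" if "(i, t) \<in> positions" for i t using that by simp
      have "traj \<tau> (x i) t \<in> {1..n}" if "i < ?p" for i t
        by (induction t) (use PiE_mem[OF xP] that letter_perm_in[OF \<tau>] in \<open>simp_all del: atLeastAtMost_iff\<close>)
      then have "?g x \<in> positions \<rightarrow>\<^sub>E {1..n}"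
        by (intro restrict_PiE_iff[THEN iffD2] ballI) (simp add: positions_def case_prod_beta)
      moreover have st: "\<forall>(i, t)\<in>positions. ?g x (next_pos (i, t)) = letter_perm \<tau> (letter t) (?g x (i, t))"
      proof (intro ballI, clarify)
        fix i t assume it: "(i, t) \<in> positions"
        then have i: "i < ?p" and t: "t < r * ms ! i" unfolding positions_def by auto
        have "?g x (next_pos (i, t)) = traj \<tau> (x i) (Suc t mod (r * ms ! i))"
          using gv[of i "Suc t mod (r * ms ! i)"] next_in[OF it] unfolding next_pos_def by simp
        also have "\<dots> = traj \<tau> (x i) (Suc t)"
        proof (cases "Suc t = r * ms ! i")
          case True
          have "traj \<tau> (x i) (Suc t) = x i" unfolding True traj_mult by (rule fx[OF i])
          then show ?thesis unfolding True by simp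
        next
          case False
          then show ?thesis using t by simp
        qed
        finally show "?g x (next_pos (i, t)) = letter_perm \<tau> (letter t) (?g x (i, t))"
          using gv[OF it] by simp
      qed
      moreover have "inj_on (?g x) base_points"
      proof -
        have "inj_on (\<lambda>(i, q). (?\<pi> ^^ q) (?g x (i, 0))) ?S \<longleftrightarrow> inj_on (\<lambda>(i, q). (?\<pi> ^^ q) (x i)) ?S"
          by (rule inj_on_cong) (use pos0 in auto)
        then show ?thesis unfolding inj_iff[OF st] using xinj by blast
      qed
      ultimately show "?g x \<in> ?Y" by blast
    qed
    show "?g (?f y) = y" if y: "y \<in> ?Y" for y
    proof
      fix p :: "nat \<times> nat"
      obtain i t where it: "p = (i, t)" by (cases p)
      have st: "\<forall>(i, t)\<in>positions. y (next_pos (i, t)) = letter_perm \<tau> (letter t) (y (i, t))" using y by blast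
      show "?g (?f y) p = y p"
      proof (cases "p \<in> positions")
        case True
        then have "i < ?p" unfolding it positions_def by simp
        then show ?thesis using traj_y[OF st True[unfolded it]] True unfolding it by simp
      next
        case False
        have "y \<in> extensional positions" using y by (simp add: PiE_def)
        from extensional_arb[OF this False] show ?thesis using False by simp
      qed
    qed
    show "?f (?g x) = x" if x: "x \<in> cycle_tuples n ?\<pi> ms" for x
    proof
      fix i
      show "?f (?g x) i = x i"
        using x pos0[of i] unfolding cycle_tuples_def by (cases "i < ?p") (auto simp: PiE_iff extensional_def)
    qed
  qed
  have eqY: "{y \<in> {y \<in> positions \<rightarrow>\<^sub>E {1..n}. inj_on y base_points}. \<forall>j\<in>{1..k}. obeys y j (\<tau> j)} = ?Y"
  proof -
    have "(\<forall>j\<in>{1..k}. obeys y j (\<tau> j)) \<longleftrightarrow>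
       (\<forall>(i, t)\<in>positions. y (next_pos (i, t)) = letter_perm \<tau> (letter t) (y (i, t)))" for y
      by (rule obeys_iff_step) (rule \<tau>)
    then show ?thesis by (simp only: mem_Collect_eq conj_assoc)
  qed
  show ?thesis unfolding eqY by (rule bij_betw_same_card[OF bij])
qed

lemma expectation_cycle_tuples:
  assumes perm: "\<And>j. j \<in> {1..k} \<Longrightarrow> random_permutation n (marginal j Q)"
  shows "measure_pmf.expectation Q (\<lambda>\<tau>. real (card (cycle_tuples n (word_value \<tau> w) ms))) =
     (\<Sum>y\<in>{y \<in> positions \<rightarrow>\<^sub>E {1..n}. inj_on y base_points}. measure_pmf.prob Q {\<tau>. \<forall>j\<in>{1..k}. obeys y j (\<tau> j)})"
proof -
  let ?Y = "{y \<in> positions \<rightarrow>\<^sub>E {1..n}. inj_on y base_points}"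
  have finY: "finite ?Y"
    by (rule finite_subset[OF Collect_restrict finite_PiE[OF finite_positions]]) simp
  have "real (card (cycle_tuples n (word_value \<tau> w) ms)) = (\<Sum>y\<in>?Y. indicator {\<tau>. \<forall>j\<in>{1..k}. obeys y j (\<tau> j)} \<tau>)"
    if \<tau>: "\<tau> \<in> set_pmf Q" for \<tau>
  proof -
    have \<tau>p: "\<tau> j permutes {1..n}" if "j \<in> {1..k}" for j
      using perm[OF that] \<tau> unfolding random_permutation_def marginal_def by auto
    have "card {y \<in> ?Y. \<forall>j\<in>{1..k}. obeys y j (\<tau> j)} = card (cycle_tuples n (word_value \<tau> w) ms)"
      by (rule card_solutions) (rule \<tau>p)
    then show ?thesis
      using sum.inter_filter[OF finY, of "\<lambda>_. 1::real" "\<lambda>y. \<forall>j\<in>{1..k}. obeys y j (\<tau> j)"]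
      by (simp add: indicator_def of_bool_def)
  qed
  then have "measure_pmf.expectation Q (\<lambda>\<tau>. real (card (cycle_tuples n (word_value \<tau> w) ms))) =
     measure_pmf.expectation Q (\<lambda>\<tau>. \<Sum>y\<in>?Y. indicator {\<tau>. \<forall>j\<in>{1..k}. obeys y j (\<tau> j)} \<tau>)"
    by (intro integral_cong_AE AE_pmfI) auto
  also have "\<dots> = (\<Sum>y\<in>?Y. measure_pmf.expectation Q (indicator {\<tau>. \<forall>j\<in>{1..k}. obeys y j (\<tau> j)}))"
    by (intro Bochner_Integration.integral_sum integrable_real_indicator)
      (auto simp: measure_pmf.emeasure_finite less_top[symmetric])
  finally show ?thesis by simp
qed

end

lemma independent_coordsD:
  assumes "independent_coords k Q" "1 \<le> k"
  shows "measure_pmf.prob Q {\<tau>. \<forall>j\<in>{1..k}. \<tau> j \<in> A j} = (\<Prod>j\<in>{1..k}. measure_pmf.prob (marginal j Q) (A j))"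
proof -
  have "measure_pmf.prob Q (\<Inter>j\<in>{1..k}. (\<lambda>\<tau>. \<tau> j) -` A j \<inter> space (measure_pmf Q)) =
     (\<Prod>j\<in>{1..k}. measure_pmf.prob Q ((\<lambda>\<tau>. \<tau> j) -` A j \<inter> space (measure_pmf Q)))"
    using assms unfolding independent_coords_def by (intro prob_space.indep_varsD_finite[OF measure_pmf.prob_space_axioms]) auto
  moreover have "(\<Inter>j\<in>{1..k}. (\<lambda>\<tau>. \<tau> j) -` A j \<inter> space (measure_pmf Q)) = {\<tau>. \<forall>j\<in>{1..k}. \<tau> j \<in> A j}"
    using assms(2) by auto
  ultimately show ?thesis by (simp add: marginal_def vimage_def)
qed

text \<open>Two words appear: trajectories read \<open>w\<close>, while the hypotheses on short
  cycles are stated for \<open>v\<close>. In the application \<open>w\<close> is the root and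
  \<open>v\<close> its power, whose exponents include those of the root.\<close>

lemma cycle_tuples_limit:
  fixes Q :: "nat \<Rightarrow> (nat \<Rightarrow> nat \<Rightarrow> nat) pmf"
  assumes word: "cyclic_word k w ms" and k: "1 \<le> k"
    and v: "v \<in> canonical_words k" "\<And>j. N' j w \<subseteq> N' j v"
    and indep: "\<And>n. 1 \<le> n \<Longrightarrow> independent_coords k (Q n)"
    and perm: "\<And>n j. 1 \<le> n \<Longrightarrow> j \<in> {1..k} \<Longrightarrow> random_permutation n (marginal j (Q n))"
    and conj_inv: "\<And>n j. 1 \<le> n \<Longrightarrow> j \<in> {1..k} \<Longrightarrow> conjugation_invariant n (marginal j (Q n))"
    and few: "\<And>j. j \<in> {1..k} \<Longrightarrow> few_short_cycles_strong (N_hat j v) (N_set j v) (\<lambda>n. marginal j (Q n))"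
  shows "(\<lambda>n. measure_pmf.expectation (Q n) (\<lambda>\<tau>. real (card (cycle_tuples n (word_value \<tau> w) ms)))) \<longlonglongrightarrow> 1"
proof -
  interpret cyclic_word k w ms by (rule word)
  interpret random_trail positions next_pos colour positive "{1..k}" "\<lambda>j. N' j w" Q "\<lambda>j. N_hat j v" "\<lambda>j. N_set j v"
  proof
    show "measure_pmf.prob (Q n) {\<tau>. \<forall>j\<in>{1..k}. \<tau> j \<in> A j} = (\<Prod>j\<in>{1..k}. measure_pmf.prob (marginal j (Q n)) (A j))"
      if "1 \<le> n" for n A
      by (rule independent_coordsD[OF indep[OF that] k])
    show "finite (N' j w)" for j by (rule finite_N')
    show "c \<in> N_hat j v" if "b \<in> N' j w" "c dvd b" for j b c
      using that v(2) unfolding N_hat_def by blast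
    show "c \<in> N_set j v" if "b \<in> N' j w" "1 \<le> c" "c \<le> b" for j b c
      using that v(2) by (intro N_set_interval[OF v(1)]) blast+
    show "a + b \<in> N_set j v" if "a \<in> N' j w" "b \<in> N' j w" for j a b
      using that v(2) by (intro N_set_sum) blast+
  qed (fact perm conj_inv few)+
  have "(\<lambda>n. \<Sum>y\<in>{y \<in> positions \<rightarrow>\<^sub>E {1..n}. inj_on y base_points}.
      measure_pmf.prob (Q n) {\<tau>. \<forall>j\<in>{1..k}. obeys y j (\<tau> j)}) \<longlonglongrightarrow> 1"
    by (rule trail_count_limit[OF rigid_word base_points_subset])
  then show ?thesis
  proof (rule Lim_transform_eventually)
    show "\<forall>\<^sub>F n in sequentially. (\<Sum>y\<in>{y \<in> positions \<rightarrow>\<^sub>E {1..n}. inj_on y base_points}.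
      measure_pmf.prob (Q n) {\<tau>. \<forall>j\<in>{1..k}. obeys y j (\<tau> j)}) =
      measure_pmf.expectation (Q n) (\<lambda>\<tau>. real (card (cycle_tuples n (word_value \<tau> w) ms)))"
      using eventually_ge_at_top[of 1]
      by eventually_elim (rule expectation_cycle_tuples[OF perm, symmetric])
  qed
qed

section \<open>The limit law\<close>

definition cycle_vector :: "nat \<Rightarrow> nat \<Rightarrow> (nat \<Rightarrow> nat) \<Rightarrow> nat \<Rightarrow> nat" where
  "cycle_vector M n \<sigma> = (\<lambda>m. if m \<in> {1..M} then num_cycles n m \<sigma> else 0)"

definition power_cycle_counts :: "nat \<Rightarrow> nat \<Rightarrow> (nat \<Rightarrow> nat) \<Rightarrow> nat \<Rightarrow> nat" where
  "power_cycle_counts d d' x = (\<lambda>l\<in>{1..d'}. \<Sum>m\<in>{m \<in> {1..d * d'}. m = l * gcd m d}. gcd m d * x m)"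

text \<open>A cycle of length \<open>m\<close> of a permutation splits in its \<open>d\<close>-th power into \<open>gcd m d\<close> cycles of
  length \<open>m div gcd m d\<close>, and the cycle counts of a word that is not a power are asymptotically
  independent Poisson variables of parameters \<open>1 / m\<close>.\<close>

definition limit_law :: "nat \<Rightarrow> nat \<Rightarrow> (nat \<Rightarrow> nat) pmf" where
  "limit_law d d' = map_pmf (power_cycle_counts d d') (poisson_vec (d * d'))"

lemma finite_cycle_vector: "finite (range (cycle_vector M n))"
proof (rule finite_subset)
  show "range (cycle_vector M n) \<subseteq> PiE_dflt {1..M} 0 (\<lambda>_. {..n})"
    unfolding PiE_dflt_def cycle_vector_def using num_cycles_le by auto
qed auto

lemma ex_list_count:
  fixes a :: "nat \<Rightarrow> nat"
  shows "\<exists>ms. set ms \<subseteq> {1..M} \<and> (\<forall>l\<in>{1..M}. count_list ms l = a l)"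
proof (induction M)
  case 0
  then show ?case by (intro exI[of _ "[]"]) simp
next
  case (Suc M)
  then obtain ms where ms: "set ms \<subseteq> {1..M}" "\<forall>l\<in>{1..M}. count_list ms l = a l" by blast
  have rep: "count_list (replicate b x) y = (if x = y then b else 0)" for b and x y :: nat
    by (induction b) auto
  have "count_list ms (Suc M) = 0" using ms(1) by (intro count_notin) auto
  then have "count_list (ms @ replicate (a (Suc M)) (Suc M)) l = a l" if "l \<in> {1..Suc M}" for l
    using that ms by (cases "l = Suc M") (auto simp: rep)
  moreover have "set (ms @ replicate (a (Suc M)) (Suc M)) \<subseteq> {1..Suc M}" using ms(1) by auto
  ultimately show ?case by blast
qed

text \<open>The tuple count for a list containing each \<open>m\<close> exactly \<open>a m\<close>
  times is the product of binomials times a constant \<open>c\<close>, independent of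
  \<open>n\<close>. The limit 1 becomes \<open>1 / c\<close>, which is the binomial moment of
  independent Poisson variables of parameters \<open>1 / m\<close>.\<close>

lemma binomial_moment_limit:
  fixes Q :: "nat \<Rightarrow> (nat \<Rightarrow> nat \<Rightarrow> nat) pmf" and a :: "nat \<Rightarrow> nat"
  assumes perm: "\<And>n. 1 \<le> n \<Longrightarrow> \<forall>\<tau>\<in>set_pmf (Q n). word_value \<tau> w permutes {1..n}"
    and tuples: "\<And>ms. (\<And>m. m \<in> set ms \<Longrightarrow> 1 \<le> m) \<Longrightarrow>
      (\<lambda>n. measure_pmf.expectation (Q n) (\<lambda>\<tau>. real (card (cycle_tuples n (word_value \<tau> w) ms)))) \<longlonglongrightarrow> 1"
  shows "(\<lambda>n. measure_pmf.expectation (map_pmf (\<lambda>\<tau>. cycle_vector M n (word_value \<tau> w)) (Q n))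
       (\<lambda>x. \<Prod>m\<in>{1..M}. real (x m choose a m))) \<longlonglongrightarrow> (\<Prod>m\<in>{1..M}. (1 / real m) ^ a m / fact (a m))"
proof -
  obtain ms where ms: "set ms \<subseteq> {1..M}" "\<And>l. l \<in> {1..M} \<Longrightarrow> count_list ms l = a l"
    using ex_list_count[of M a] by blast
  define c where "c = (\<Prod>m\<in>{1..M}. real m ^ a m * fact (a m))"
  have c0: "c \<noteq> 0" unfolding c_def by auto
  have ic: "1 / c = (\<Prod>m\<in>{1..M}. (1 / real m) ^ a m / fact (a m))"
    unfolding c_def by (simp add: prod_dividef power_one_over flip: prod_inversef)
  have eq: "measure_pmf.expectation (map_pmf (\<lambda>\<tau>. cycle_vector M n (word_value \<tau> w)) (Q n))
       (\<lambda>x. \<Prod>m\<in>{1..M}. real (x m choose a m)) =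
     measure_pmf.expectation (Q n) (\<lambda>\<tau>. real (card (cycle_tuples n (word_value \<tau> w) ms))) / c"
    if n: "1 \<le> n" for n
  proof -
    have "(\<Prod>m\<in>{1..M}. real (cycle_vector M n (word_value \<tau> w) m choose a m)) =
       real (card (cycle_tuples n (word_value \<tau> w) ms)) / c" if \<tau>: "\<tau> \<in> set_pmf (Q n)" for \<tau>
    proof -
      have "word_value \<tau> w permutes {1..n}" using perm[OF n] \<tau> by blast
      from card_cycle_tuples[OF this ms(1)]
      have "card (cycle_tuples n (word_value \<tau> w) ms) =
        (\<Prod>l\<in>{1..M}. l ^ a l * fact (a l) * (num_cycles n l (word_value \<tau> w) choose a l))"
        using ms(2) by simp
      then have "real (card (cycle_tuples n (word_value \<tau> w) ms)) =
        c * (\<Prod>l\<in>{1..M}. real (num_cycles n l (word_value \<tau> w) choose a l))"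
        unfolding c_def by (simp add: prod.distrib of_nat_prod)
      moreover have "(\<Prod>l\<in>{1..M}. real (num_cycles n l (word_value \<tau> w) choose a l)) =
         (\<Prod>m\<in>{1..M}. real (cycle_vector M n (word_value \<tau> w) m choose a m))"
        by (rule prod.cong) (simp_all add: cycle_vector_def)
      ultimately show ?thesis using c0 by simp
    qed
    then have "measure_pmf.expectation (Q n) (\<lambda>\<tau>. \<Prod>m\<in>{1..M}. real (cycle_vector M n (word_value \<tau> w) m choose a m))
       = measure_pmf.expectation (Q n) (\<lambda>\<tau>. real (card (cycle_tuples n (word_value \<tau> w) ms)) / c)"
      by (intro integral_cong_AE AE_pmfI) auto
    then show ?thesis by (simp add: integral_map_pmf)
  qed
  have "(\<lambda>n. measure_pmf.expectation (Q n) (\<lambda>\<tau>. real (card (cycle_tuples n (word_value \<tau> w) ms))) / c) \<longlonglongrightarrow> 1 / c"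
    by (intro tendsto_intros tuples c0) (use ms(1) in auto)
  then show ?thesis unfolding ic[symmetric]
  proof (rule Lim_transform_eventually)
    show "\<forall>\<^sub>F n in sequentially. measure_pmf.expectation (Q n) (\<lambda>\<tau>. real (card (cycle_tuples n (word_value \<tau> w) ms))) / c =
      measure_pmf.expectation (map_pmf (\<lambda>\<tau>. cycle_vector M n (word_value \<tau> w)) (Q n))
       (\<lambda>x. \<Prod>m\<in>{1..M}. real (x m choose a m))"
      using eventually_ge_at_top[of 1] by eventually_elim (rule eq[symmetric])
  qed
qed

lemma monomial_power_cycle_counts:
  "monomial d' a (power_cycle_counts d d' x) =
     (\<Prod>i=1..d'. real (\<Sum>m\<in>{m \<in> {1..d * d'}. m = i * gcd m d}. gcd m d * x m) ^ a i)"
  unfolding monomial_def power_cycle_counts_def by (rule prod.cong) simp_all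

lemma expectation_limit_monomial:
  fixes P :: "nat \<Rightarrow> (nat \<Rightarrow> nat) pmf"
  assumes "\<And>n a. integrable (P n) (\<lambda>x. \<Prod>m\<in>{1..d * d'}. real (x m choose a m))"
    and "\<And>a. (\<lambda>n. measure_pmf.expectation (P n) (\<lambda>x. \<Prod>m\<in>{1..d * d'}. real (x m choose a m)))
                 \<longlonglongrightarrow> (\<Prod>m\<in>{1..d * d'}. (1 / real m) ^ a m / fact (a m))"
  shows "expectation_limit P (poisson_vec (d * d')) (\<lambda>x. monomial d' a (power_cycle_counts d d' x))"
  unfolding monomial_power_cycle_counts
  by (rule expectation_limit_polynomial[OF assms refl]) auto

lemma limit_law_moments: "finite_joint_moments d' (limit_law d d')"
proof -
  \<comment> \<open>The constant sequence satisfies the hypotheses trivially, and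
    \<open>expectation_limit\<close> includes integrability under the limit.\<close>
  have "expectation_limit (\<lambda>_. poisson_vec (d * d')) (poisson_vec (d * d')) (\<lambda>x. monomial d' a (power_cycle_counts d d' x))" for a
    by (rule expectation_limit_monomial) (simp_all only: poisson_vec_binomial_moment tendsto_const)
  then show ?thesis
    unfolding finite_joint_moments_def limit_law_def expectation_limit_def by (simp add: integrable_map_pmf_eq)
qed

lemma limit_law_support: "vector_distribution d' (limit_law d d')"
  unfolding vector_distribution_def limit_law_def power_cycle_counts_def by auto

text \<open>For \<open>n \<ge> 1\<close> the counts of the power are the image of those of the root
  under the fixed map \<open>power_cycle_counts\<close>. Composition with it preserves bounded
  functions and turns monomials into polynomials, so both kinds of convergence carry over from
  \<open>P\<close>.\<close>

lemma cycle_counts_limit: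
  fixes Q :: "nat \<Rightarrow> (nat \<Rightarrow> nat \<Rightarrow> nat) pmf"
  assumes d: "1 \<le> d" and perm: "\<And>n. 1 \<le> n \<Longrightarrow> \<forall>\<tau>\<in>set_pmf (Q n). word_value \<tau> w permutes {1..n}"
    and tuples: "\<And>ms. (\<And>m. m \<in> set ms \<Longrightarrow> 1 \<le> m) \<Longrightarrow>
      (\<lambda>n. measure_pmf.expectation (Q n) (\<lambda>\<tau>. real (card (cycle_tuples n (word_value \<tau> w) ms)))) \<longlonglongrightarrow> 1"
  shows "converges_in_distribution (\<lambda>n. map_pmf (\<lambda>\<tau>. cycle_counts n d' (word_value \<tau> w ^^ d)) (Q n)) (limit_law d d')"
    "joint_moments_converge d' (\<lambda>n. map_pmf (\<lambda>\<tau>. cycle_counts n d' (word_value \<tau> w ^^ d)) (Q n)) (limit_law d d')"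
proof -
  let ?M = "d * d'"
  define P where "P n = map_pmf (\<lambda>\<tau>. cycle_vector ?M n (word_value \<tau> w)) (Q n)" for n
  have fin: "finite (set_pmf (P n))" for n
    by (rule finite_subset[OF _ finite_cycle_vector[of ?M n]]) (auto simp: P_def)
  have supp: "x m = 0" if "x \<in> set_pmf (P n)" "m \<notin> {1..?M}" for n x m
    using that unfolding P_def cycle_vector_def by auto
  have lim: "(\<lambda>n. measure_pmf.expectation (P n) (\<lambda>x. \<Prod>m\<in>{1..?M}. real (x m choose a m)))
      \<longlonglongrightarrow> (\<Prod>m\<in>{1..?M}. (1 / real m) ^ a m / fact (a m))" for a
    unfolding P_def by (rule binomial_moment_limit[OF perm tuples])
  have eq: "map_pmf (\<lambda>\<tau>. cycle_counts n d' (word_value \<tau> w ^^ d)) (Q n) = map_pmf (power_cycle_counts d d') (P n)"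
    if n: "1 \<le> n" for n
    unfolding P_def map_pmf_comp
  proof (rule map_pmf_cong[OF refl])
    fix \<tau> assume "\<tau> \<in> set_pmf (Q n)"
    then have \<sigma>: "word_value \<tau> w permutes {1..n}" using perm[OF n] by blast
    show "cycle_counts n d' (word_value \<tau> w ^^ d) = power_cycle_counts d d' (cycle_vector ?M n (word_value \<tau> w))"
      unfolding cycle_counts_def power_cycle_counts_def
    proof (rule restrict_ext)
      fix l assume l: "l \<in> {1..d'}"
      show "num_cycles n l (word_value \<tau> w ^^ d) =
        (\<Sum>m\<in>{m \<in> {1..?M}. m = l * gcd m d}. gcd m d * cycle_vector ?M n (word_value \<tau> w) m)"
        unfolding num_cycles_funpow[OF \<sigma> d l] by (rule sum.cong) (auto simp: cycle_vector_def)
    qed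
  qed
  have "converges_in_distribution P (poisson_vec ?M)"
    by (intro converges_in_distribution_of_pmf pmf_limit_of_binomial_moments fin lim) (rule supp)
  then have dist: "(\<lambda>n. measure_pmf.expectation (P n) (\<lambda>x. f (power_cycle_counts d d' x)))
     \<longlonglongrightarrow> measure_pmf.expectation (poisson_vec ?M) (\<lambda>x. f (power_cycle_counts d d' x))"
    if "bounded (range f)" for f :: "_ \<Rightarrow> real"
  proof -
    have "bounded (range (\<lambda>x. f (power_cycle_counts d d' x)))"
      by (rule bounded_subset[OF that]) auto
    then show ?thesis using \<open>converges_in_distribution P (poisson_vec ?M)\<close>
      unfolding converges_in_distribution_def by blast
  qed
  have transfer: "(\<lambda>n. measure_pmf.expectation (map_pmf (\<lambda>\<tau>. cycle_counts n d' (word_value \<tau> w ^^ d)) (Q n)) f)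
      \<longlonglongrightarrow> measure_pmf.expectation (limit_law d d') f"
    if "(\<lambda>n. measure_pmf.expectation (P n) (\<lambda>x. f (power_cycle_counts d d' x)))
       \<longlonglongrightarrow> measure_pmf.expectation (poisson_vec ?M) (\<lambda>x. f (power_cycle_counts d d' x))" for f :: "_ \<Rightarrow> real"
  proof (rule Lim_transform_eventually)
    show "(\<lambda>n. measure_pmf.expectation (map_pmf (power_cycle_counts d d') (P n)) f)
      \<longlonglongrightarrow> measure_pmf.expectation (limit_law d d') f"
      using that unfolding limit_law_def integral_map_pmf .
    show "\<forall>\<^sub>F n in sequentially. measure_pmf.expectation (map_pmf (power_cycle_counts d d') (P n)) f =
      measure_pmf.expectation (map_pmf (\<lambda>\<tau>. cycle_counts n d' (word_value \<tau> w ^^ d)) (Q n)) f"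
      using eventually_ge_at_top[of 1] by eventually_elim (simp only: eq)
  qed
  show "converges_in_distribution (\<lambda>n. map_pmf (\<lambda>\<tau>. cycle_counts n d' (word_value \<tau> w ^^ d)) (Q n)) (limit_law d d')"
    unfolding converges_in_distribution_def using transfer dist by blast
  show "joint_moments_converge d' (\<lambda>n. map_pmf (\<lambda>\<tau>. cycle_counts n d' (word_value \<tau> w ^^ d)) (Q n)) (limit_law d d')"
    unfolding joint_moments_converge_def
    using transfer expectation_limit_monomial[OF integrable_measure_pmf_finite[OF fin] lim]
    unfolding expectation_limit_def by blast
qed

theorem theorem1p5:
  shows "\<exists>\<nu> :: nat \<Rightarrow> nat \<Rightarrow> (nat \<Rightarrow> nat) pmf.
    (\<forall>d\<ge>1. \<forall>d'\<ge>1. vector_distribution d' (\<nu> d d') \<and> finite_joint_moments d' (\<nu> d d')) \<and>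
    (\<forall>(k::nat) (w::fword) (\<Omega>::fword) (d::nat) (Q :: nat \<Rightarrow> (nat \<Rightarrow> nat \<Rightarrow> nat) pmf).
       k > 1 \<and>
       w \<in> carrier (free_group k) \<and> w \<noteq> [] \<and> fst (last w) \<noteq> fst (hd w) \<and>
       d \<ge> 1 \<and> \<Omega> \<in> carrier (free_group k) \<and> \<not> is_power k \<Omega> \<and>
       w = \<Omega> [^]\<^bsub>free_group k\<^esub> d \<and>
       (\<forall>n\<ge>1. independent_coords k (Q n) \<and>
          (\<forall>j\<in>{1..k}. random_permutation n (marginal j (Q n)) \<and>
                       conjugation_invariant n (marginal j (Q n)))) \<and>
       (\<forall>j\<in>{1..k}. few_short_cycles_strong (N_hat j w) (N_set j w) (\<lambda>n. marginal j (Q n)))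
       \<longrightarrow>
       (\<forall>d'\<ge>1.
          converges_in_distribution
            (\<lambda>n. map_pmf (\<lambda>\<tau>. cycle_counts n d' (word_value \<tau> w)) (Q n)) (\<nu> d d') \<and>
          joint_moments_converge d'
            (\<lambda>n. map_pmf (\<lambda>\<tau>. cycle_counts n d' (word_value \<tau> w)) (Q n)) (\<nu> d d')))"
proof (intro exI[of _ limit_law] conjI allI impI)
  show "vector_distribution d' (limit_law d d')" for d d' by (rule limit_law_support)
  show "finite_joint_moments d' (limit_law d d')" for d d' by (rule limit_law_moments)
next
  fix k :: nat and w \<Omega> :: fword and d d' :: nat and Q :: "nat \<Rightarrow> (nat \<Rightarrow> nat \<Rightarrow> nat) pmf"
  assume H: "k > 1 \<and> w \<in> carrier (free_group k) \<and> w \<noteq> [] \<and> fst (last w) \<noteq> fst (hd w) \<and>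
       d \<ge> 1 \<and> \<Omega> \<in> carrier (free_group k) \<and> \<not> is_power k \<Omega> \<and>
       w = \<Omega> [^]\<^bsub>free_group k\<^esub> d \<and>
       (\<forall>n\<ge>1. independent_coords k (Q n) \<and>
          (\<forall>j\<in>{1..k}. random_permutation n (marginal j (Q n)) \<and>
                       conjugation_invariant n (marginal j (Q n)))) \<and>
       (\<forall>j\<in>{1..k}. few_short_cycles_strong (N_hat j w) (N_set j w) (\<lambda>n. marginal j (Q n)))"
  then have k: "1 \<le> k" and d: "1 \<le> d" and w: "w \<in> canonical_words k" "w \<noteq> []" "fst (last w) \<noteq> fst (hd w)"
    and \<Omega>: "\<Omega> \<in> canonical_words k" "\<not> is_power k \<Omega>" and pow: "w = \<Omega> [^]\<^bsub>free_group k\<^esub> d"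
    unfolding free_group_def by auto
  have indep: "\<And>n. 1 \<le> n \<Longrightarrow> independent_coords k (Q n)"
    and perm: "\<And>n j. 1 \<le> n \<Longrightarrow> j \<in> {1..k} \<Longrightarrow> random_permutation n (marginal j (Q n))"
    and conj_inv: "\<And>n j. 1 \<le> n \<Longrightarrow> j \<in> {1..k} \<Longrightarrow> conjugation_invariant n (marginal j (Q n))"
    and few: "\<And>j. j \<in> {1..k} \<Longrightarrow> few_short_cycles_strong (N_hat j w) (N_set j w) (\<lambda>n. marginal j (Q n))"
    using H by blast+
  \<comment> \<open>From here on the problem concerns the root: \<open>w\<close> is literally
    \<open>d\<close> copies of \<open>\<Omega>\<close>, and \<open>\<Omega>\<close> inherits
    different generators at its ends.\<close>
  note \<Omega>' = power_eq_concat[OF \<Omega>(1) pow d w(2,3)]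
  have wv: "word_value \<tau> w = word_value \<tau> \<Omega> ^^ d" for \<tau>
    unfolding \<Omega>'(1) by (rule word_value_concat_replicate)
  have perm': "\<forall>\<tau>\<in>set_pmf (Q n). word_value \<tau> \<Omega> permutes {1..n}" if n: "1 \<le> n" for n
  proof
    fix \<tau> assume \<tau>: "\<tau> \<in> set_pmf (Q n)"
    have "\<tau> j permutes {1..n}" if "j \<in> {1..k}" for j
      using perm[OF n that] \<tau> unfolding random_permutation_def marginal_def by auto
    then show "word_value \<tau> \<Omega> permutes {1..n}" by (intro word_value_permutes[where k = k] \<Omega>(1))
  qed
  have tuples: "(\<lambda>n. measure_pmf.expectation (Q n) (\<lambda>\<tau>. real (card (cycle_tuples n (word_value \<tau> \<Omega>) ms)))) \<longlonglongrightarrow> 1"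
    if "\<And>m. m \<in> set ms \<Longrightarrow> 1 \<le> m" for ms
  proof (rule cycle_tuples_limit[OF _ k w(1) _ indep perm conj_inv few])
    show "cyclic_word k \<Omega> ms" using \<Omega> \<Omega>'(2,3) that by unfold_locales
    show "N' j \<Omega> \<subseteq> N' j w" for j
      unfolding \<Omega>'(1) by (rule N'_mono_concat[OF \<Omega>'(3,2) d])
  qed
  note lims = cycle_counts_limit[OF d perm' tuples]
  show "converges_in_distribution (\<lambda>n. map_pmf (\<lambda>\<tau>. cycle_counts n d' (word_value \<tau> w)) (Q n)) (limit_law d d')"
    unfolding wv by (rule lims(1))
  show "joint_moments_converge d' (\<lambda>n. map_pmf (\<lambda>\<tau>. cycle_counts n d' (word_value \<tau> w)) (Q n)) (limit_law d d')"
    unfolding wv by (rule lims(2))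
qed

end
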